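(* Let $\hat{\pi}(x)$ denote the number of primes $p\le x$ such that $p=\lfloor \operatorname{Li}^{-1}(n)\rfloor$ for some integer $n$. Then, as $x\to\infty$, \[ \hat{\pi}(x)\sim \frac{x}{\log^2 x}. \]
   Context: For $x>2$, $\operatorname{Li}(x):=\int_2^x \frac{dt}{\log t}$ is the logarithmic integral, and $\operatorname{Li}^{-1}$ denotes its inverse function (so $\operatorname{Li}^{-1}(x)\sim x\log x$). $\lfloor\cdot\rfloor$ denotes the floor function. *)

theory Defs
  imports
    "HOL-Analysis.Analysis"
    "HOL-Computational_Algebra.Primes"
    "HOL-Library.Landau_Symbols"
begin

definition Li :: "real \<Rightarrow> real" where
  "Li x = integral {2..x} (\<lambda>t. 1 / ln t)"

text \<open>The inverse of \<open>Li\<close> on its domain \<open>{2<..}\<close>; the value is meaningful only for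
  arguments in \<open>Li ` {2<..}\<close>, mathematically the positive reals.\<close>

definition Li_inv :: "real \<Rightarrow> real" where
  "Li_inv = the_inv_into {2<..} Li"

text \<open>The condition \<open>of_int n \<in> Li ` {2<..}\<close> restricts \<open>n\<close> to the integers at which
  \<open>Li_inv\<close> is defined, i.e. \<open>n \<ge> 1\<close>, so that junk values of the total function do not
  contribute.\<close>

definition pi_hat :: "real \<Rightarrow> nat" where
  "pi_hat x = card {p :: nat. prime p \<and> real p \<le> x \<and>
     (\<exists>n :: int. of_int n \<in> Li ` {2<..} \<and> int p = \<lfloor>Li_inv (of_int n)\<rfloor>)}"

end

theory Submission
  imports
    Defs
    "HOL-Number_Theory.Prime_Powers"
    "HOL-Computational_Algebra.Squarefree"
    "HOL-Complex_Analysis.Complex_Analysis"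
    "HOL-Real_Asymp.Real_Asymp"
begin

text \<open>
  A prime \<open>p \<ge> 3\<close> is counted iff the interval \<open>[Li p, Li (p + 1))\<close>, whose length is about
  \<open>1 / ln p\<close>, contains an integer. It is therefore enough to show that the numbers \<open>Li p\<close>,
  weighted by the von Mangoldt function, are equidistributed modulo 1 at the scale \<open>1 / ln x\<close>,
  and to apply the prime number theorem to the main term.

  Equidistribution is tested against the Fejer kernel, which reduces it to saving a power of
  \<open>ln x\<close> in \<open>\<Sum>n\<le>x. \<Lambda>(n) e(h Li(n))\<close> for \<open>h\<close> up to a power of \<open>ln x\<close>. In Vaughan's identity both
  cut-offs can be taken to be powers of \<open>ln x\<close>: the derivative of \<open>Li\<close> varies so slowly that
  in the bilinear sums one variable can be cut into blocks as short as a power of \<open>ln x\<close>, and after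
  Cauchy-Schwarz on each block the second derivative test already saves enough.

  The prime number theorem is obtained from Newman's contour argument applied to the
  Dirichlet series with the bounded coefficients \<open>(\<psi>(n) - n) / n\<close>.
\<close>

section \<open>Moebius inversion and Vaughan's identity\<close>

text \<open>A window of length about 1 / ln x must be resolved, so equidistribution without a rate
  is too weak, while saving a fixed power of ln x is enough. Write x for ln N. Smoothing by x^(-3/2)
  is negligible against 1 / x; a kernel of degree about x^4 then leaks a share of at most 1 / x; and
  adding up x^4 frequencies with total error of order N / x asks for the saving x^5 in each
  exponential sum. The other exponents follow backwards: bilinear blocks of length x^16 save x^8, of
  which logarithmic factors consume two powers, and keeping the off-diagonal correlations of such a
  block below its diagonal requires the other variable to range up to at least x^76. Cut-offs of
  this size do little harm to the smooth sums, where the second derivative test saves a power of N.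
  The interval length Li (p + 1) - Li p depends on p; it is compared with one fixed length, from
  below with 1 / ln (N + 1), and from above with a slightly longer one after discarding the primes
  up to N / (ln N)^3.\<close>

definition mu :: "nat \<Rightarrow> real" where
  "mu n = (if squarefree n then (-1) ^ card (prime_factors n) else 0)"

lemma abs_mu_le: "\<bar>mu n\<bar> \<le> 1"
  by (simp add: mu_def power_abs)

lemma mu_prime_mult:
  assumes "prime p" "\<not> p dvd d" "d > 0"
  shows "mu (p * d) = - mu d"
proof -
  have cop: "coprime p d" using assms by (simp add: prime_imp_coprime)
  have sf: "squarefree (p * d) \<longleftrightarrow> squarefree d"
    using assms cop squarefree_mult_coprime[OF cop] squarefree_multD[of p d] squarefree_prime[of p] by auto
  have "prime_factors (p * d) = insert p (prime_factors d)"
    using assms by (simp add: prime_factorization_mult prime_factorization_prime)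
  moreover have "p \<notin> prime_factors d" using assms by auto
  ultimately have "card (prime_factors (p * d)) = Suc (card (prime_factors d))"
    by simp
  then show ?thesis by (simp add: mu_def sf)
qed

lemma mu_square_mult:
  assumes "prime p" "p dvd d"
  shows "mu (p * d) = 0"
proof -
  have "p\<^sup>2 dvd p * d" using assms by (auto simp: power2_eq_square)
  then have "\<not> squarefree (p * d)"
    using assms by (metis not_prime_unit squarefree_def)
  then show ?thesis by (simp add: mu_def)
qed

text \<open>Fix a prime \<open>p\<close> dividing \<open>n\<close>. Multiplication by
  \<open>p\<close> pairs each divisor prime to \<open>p\<close> with one divisible by
  \<open>p\<close>, of opposite sign; the divisors left over are divisible by the square of
  \<open>p\<close> and have \<open>mu\<close> zero.\<close>

lemma sum_mu_divisors:
  assumes "n > 0"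
  shows "(\<Sum>d | d dvd n. mu d) = (if n = 1 then 1 else 0)"
proof (cases "n = 1")
  case True
  then show ?thesis by (simp add: mu_def)
next
  case False
  then obtain p where p: "prime p" "p dvd n" using prime_factor_nat by blast
  define A where "A = {d. d dvd n \<and> \<not> p dvd d}"
  define B where "B = {d. d dvd n \<and> p dvd d}"
  have fin: "finite {d. d dvd n}" using assms by simp
  have fA: "finite A" "finite B" using fin by (auto simp: A_def B_def)
  have "(\<Sum>d\<in>B. mu d) = (\<Sum>d\<in>(*) p ` A. mu d)"
  proof (rule sum.mono_neutral_right)
    show "finite B" by fact
    show "(*) p ` A \<subseteq> B"
    proof safe
      fix d assume "d \<in> A"
      then have "d dvd n" "coprime p d" using p by (auto simp: A_def prime_imp_coprime)
      then show "p * d \<in> B" using p by (auto simp: B_def divides_mult)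
    qed
    show "\<forall>i\<in>B - (*) p ` A. mu i = 0"
    proof
      fix i assume i: "i \<in> B - (*) p ` A"
      then obtain d where d: "i = p * d" by (auto simp: B_def)
      have "d dvd n" using i d by (auto simp: B_def dest: dvd_mult_right)
      then have "p dvd d" using i d by (auto simp: A_def)
      then show "mu i = 0" using mu_square_mult p d by simp
    qed
  qed
  also have "\<dots> = (\<Sum>d\<in>A. mu (p * d))"
    using p by (subst sum.reindex) (auto simp: inj_on_def prime_gt_0_nat)
  also have "\<dots> = (\<Sum>d\<in>A. - mu d)"
  proof (rule sum.cong[OF refl])
    fix d assume "d \<in> A"
    then have "d > 0" "\<not> p dvd d" using assms by (auto simp: A_def intro!: Nat.gr0I)
    then show "mu (p * d) = - mu d" using mu_prime_mult p by blast
  qed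
  finally have "(\<Sum>d\<in>A. mu d) + (\<Sum>d\<in>B. mu d) = 0" by (simp add: sum_negf)
  moreover have "{d. d dvd n} = A \<union> B" "A \<inter> B = {}" by (auto simp: A_def B_def)
  ultimately show ?thesis using False fA by (simp add: sum.union_disjoint)
qed

lemma sum_divisors_swap:
  fixes G :: "nat \<Rightarrow> nat \<Rightarrow> 'a::comm_monoid_add"
  shows "(\<Sum>n\<in>{1..N}. \<Sum>d | d dvd n. G d (n div d)) = (\<Sum>d\<in>{1..N}. \<Sum>j\<in>{1..N div d}. G d j)"
proof -
  have "(\<Sum>n\<in>{1..N}. \<Sum>d | d dvd n. G d (n div d)) =
        (\<Sum>(n,d)\<in>(SIGMA n:{1..N}. {d. d dvd n}). G d (n div d))"
    by (rule sum.Sigma) auto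
  also have "\<dots> = (\<Sum>(d,j)\<in>(SIGMA d:{1..N}. {1..N div d}). G d j)"
  proof (rule sum.reindex_bij_witness[where i = "\<lambda>(d,j). (d * j, d)" and j = "\<lambda>(n,d). (d, n div d)"])
    fix a assume a: "a \<in> (SIGMA n:{1..N}. {d. d dvd n})"
    obtain n d where nd: "a = (n, d)" by force
    have 1: "1 \<le> n" "n \<le> N" "d dvd n" using a nd by auto
    then have "d > 0" "d \<le> n" by (auto dest: dvd_imp_le intro!: Nat.gr0I)
    then have "n div d > 0" "n div d \<le> N div d" using 1 by (auto simp: div_le_mono div_greater_zero_iff)
    then show "(\<lambda>(n,d). (d, n div d)) a \<in> (SIGMA d:{1..N}. {1..N div d})"
      using nd 1 \<open>d > 0\<close> \<open>d \<le> n\<close> by auto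
    show "(\<lambda>(d,j). (d * j, d)) ((\<lambda>(n,d). (d, n div d)) a) = a" using nd 1 by auto
    show "(case (case a of (n, d) \<Rightarrow> (d, n div d)) of (d, x) \<Rightarrow> G d x) = (case a of (n, d) \<Rightarrow> G d (n div d))"
      by (simp add: nd)
  next
    fix a assume a: "a \<in> (SIGMA d:{1..N}. {1..N div d})"
    obtain d j where dj: "a = (d, j)" by force
    have 1: "d \<ge> 1" "j \<ge> 1" "j \<le> N div d" using a dj by auto
    then have "d * j \<le> N" by (simp add: less_eq_div_iff_mult_less_eq mult.commute)
    then show "(\<lambda>(d,j). (d * j, d)) a \<in> (SIGMA n:{1..N}. {d. d dvd n})"
      using dj 1 by auto
    show "(\<lambda>(n,d). (d, n div d)) ((\<lambda>(d,j). (d * j, d)) a) = a"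
      using dj 1 by auto
  qed
  also have "\<dots> = (\<Sum>d\<in>{1..N}. \<Sum>j\<in>{1..N div d}. G d j)"
    by (rule sum.Sigma[symmetric]) auto
  finally show ?thesis .
qed

lemma moebius_inversion:
  fixes a :: "nat \<Rightarrow> real"
  assumes "n > 0"
  shows "(\<Sum>d | d dvd n. mu d * (\<Sum>c | c dvd n div d. a c)) = a n"
proof -
  have fin: "finite {d. d dvd m}" if "m > 0" for m :: nat using that by simp
  have pos: "n div d > 0" if "d dvd n" for d
    using that assms by (auto elim!: dvdE)
  have "(\<Sum>d | d dvd n. mu d * (\<Sum>c | c dvd n div d. a c)) =
        (\<Sum>(d,c)\<in>(SIGMA d:{d. d dvd n}. {c. c dvd n div d}). mu d * a c)"
    unfolding sum_distrib_left using assms pos by (intro sum.Sigma) auto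
  also have "\<dots> = (\<Sum>(c,d)\<in>(SIGMA c:{c. c dvd n}. {d. d dvd n div c}). mu d * a c)"
  proof (rule sum.reindex_bij_witness[where i = "\<lambda>(x,y). (y,x)" and j = "\<lambda>(x,y). (y,x)"])
    have *: "c dvd n \<and> d dvd n div c" if "d dvd n" "c dvd n div d" for c d :: nat
      using that assms by (metis dvd_div_iff_mult dvd_mult_right mult.commute not_less0 dvd_0_left_iff neq0_conv dvd_trans dvd_triv_left div_dvd_iff_mult dvd_def nonzero_mult_div_cancel_left)
    fix a assume "a \<in> (SIGMA d:{d. d dvd n}. {c. c dvd n div d})"
    then show "(\<lambda>(x,y). (y,x)) a \<in> (SIGMA c:{c. c dvd n}. {d. d dvd n div c})"
      using * by auto
  next
    have *: "c dvd n \<and> d dvd n div c" if "d dvd n" "c dvd n div d" for c d :: nat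
      using that assms by (metis dvd_div_iff_mult dvd_mult_right mult.commute not_less0 dvd_0_left_iff neq0_conv dvd_trans dvd_triv_left div_dvd_iff_mult dvd_def nonzero_mult_div_cancel_left)
    fix a assume "a \<in> (SIGMA c:{c. c dvd n}. {d. d dvd n div c})"
    then show "(\<lambda>(x,y). (y,x)) a \<in> (SIGMA d:{d. d dvd n}. {c. c dvd n div d})"
      using * by auto
  qed auto
  also have "\<dots> = (\<Sum>c | c dvd n. a c * (\<Sum>d | d dvd n div c. mu d))"
    unfolding sum_distrib_left using assms pos by (subst sum.Sigma) (auto simp: mult.commute)
  also have "\<dots> = (\<Sum>c | c dvd n. if c = n then a c else 0)"
  proof (rule sum.cong[OF refl])
    fix c assume "c \<in> {c. c dvd n}"
    then have c: "c dvd n" by simp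
    then have "n div c = 1 \<longleftrightarrow> c = n" using assms by (auto elim!: dvdE)
    then show "a c * (\<Sum>d | d dvd n div c. mu d) = (if c = n then a c else 0)"
      using sum_mu_divisors[OF pos[OF c]] by simp
  qed
  also have "\<dots> = a n" using assms by simp
  finally show ?thesis .
qed

text \<open>The Dirichlet convolution of 1 with the part of \<open>mangoldt\<close> from
  \<open>L\<close> on. As the coefficient of the bilinear sum it lies between 0 and
  \<open>ln j\<close> and vanishes for \<open>0 < j < L\<close>, so both variables of that sum are
  large.\<close>

definition mangoldt_above :: "nat \<Rightarrow> nat \<Rightarrow> real" where
  "mangoldt_above L j = (\<Sum>c | c dvd j \<and> L \<le> c. mangoldt c)"

lemma mangoldt_above_split:
  assumes "j > 0"
  shows "mangoldt_above L j = ln (real j) - (\<Sum>c | c dvd j. if c < L then mangoldt c else 0)"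
proof -
  have f: "finite {c. c dvd j}" using assms by simp
  have "(\<Sum>c | c dvd j. mangoldt c) =
     (\<Sum>c | c dvd j. (if L \<le> c then mangoldt c else 0) + (if c < L then mangoldt c else 0 :: real))"
    by (intro sum.cong) auto
  also have "\<dots> = mangoldt_above L j + (\<Sum>c | c dvd j. if c < L then mangoldt c else 0)"
    unfolding mangoldt_above_def sum.distrib using f
    by (simp add: sum.inter_filter[symmetric] conj_commute)
  finally show ?thesis using mangoldt_sum[of j, where 'a=real] assms by simp
qed

lemma mangoldt_above_nonneg: "0 \<le> mangoldt_above L j"
  unfolding mangoldt_above_def by (intro sum_nonneg) (auto intro: mangoldt_nonneg)

lemma mangoldt_above_le:
  assumes "j > 0"
  shows "mangoldt_above L j \<le> ln (real j)"
  using mangoldt_above_split[OF assms, of L]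
    sum_nonneg[of "{c. c dvd j}" "\<lambda>c. if c < L then mangoldt c else 0 :: real"]
  by (auto simp: mangoldt_nonneg)

lemma mangoldt_above_eq_0:
  assumes "j < L" "j > 0" shows "mangoldt_above L j = 0"
  unfolding mangoldt_above_def using assms by (intro sum.neutral) (auto dest: dvd_imp_le)

text \<open>By Moebius inversion the part of \<open>mangoldt\<close> from \<open>L\<close> on is the
  convolution of \<open>mu\<close> with \<open>mangoldt_above L\<close>. For \<open>d <= V\<close>
  the second factor is expanded as \<open>ln\<close> minus a divisor sum over \<open>c < L\<close>,
  which leaves smooth inner sums; for \<open>d > V\<close> it is kept.\<close>

lemma vaughan_identity:
  fixes E :: "nat \<Rightarrow> complex"
  assumes V: "V \<le> N" and L: "L \<le> N"
  shows "(\<Sum>n\<in>{1..N}. mangoldt n * E n) =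
     (\<Sum>n\<in>{1..<L}. mangoldt n * E n)
   + (\<Sum>d\<in>{1..V}. mu d * (\<Sum>j\<in>{1..N div d}. ln (real j) * E (d * j)))
   - (\<Sum>d\<in>{1..V}. mu d * (\<Sum>c\<in>{1..<L}. mangoldt c * (\<Sum>r\<in>{1..N div d div c}. E (d * (c * r)))))
   + (\<Sum>d\<in>{V<..N}. mu d * (\<Sum>j\<in>{1..N div d}. mangoldt_above L j * E (d * j)))"
proof -
  define T where "T d = (\<Sum>j\<in>{1..N div d}. mangoldt_above L j * E (d * j))" for d
  have id: "(\<Sum>n\<in>{1..N}. (if L \<le> n then mangoldt n else 0) * E n) = (\<Sum>d\<in>{1..N}. mu d * T d)"
  proof -
    have "(\<Sum>n\<in>{1..N}. (if L \<le> n then mangoldt n else 0) * E n) =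
          (\<Sum>n\<in>{1..N}. \<Sum>d | d dvd n. mu d * (mangoldt_above L (n div d) * E (d * (n div d))))"
    proof (rule sum.cong[OF refl])
      fix n assume n: "n \<in> {1..N}"
      have "(\<Sum>d | d dvd n. complex_of_real (mu d) * (mangoldt_above L (n div d) * E (d * (n div d)))) =
            complex_of_real (\<Sum>d | d dvd n. mu d * mangoldt_above L (n div d)) * E n"
        by (auto simp: sum_distrib_right mult.assoc intro!: sum.cong)
      also have "(\<Sum>d | d dvd n. mu d * mangoldt_above L (n div d)) =
          (\<Sum>d | d dvd n. mu d * (\<Sum>c | c dvd n div d. if L \<le> c then mangoldt c else 0))"
      proof (intro sum.cong refl arg_cong2[where f="(*)"])
        fix d assume "d \<in> {d. d dvd n}"
        then have "n div d > 0" using n by (auto elim!: dvdE)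
        then show "mangoldt_above L (n div d) = (\<Sum>c | c dvd n div d. if L \<le> c then mangoldt c else 0)"
          by (simp add: mangoldt_above_def sum.inter_filter[symmetric] conj_commute)
      qed
      also have "\<dots> = (if L \<le> n then mangoldt n else 0)"
        using n by (subst moebius_inversion) auto
      finally show "(if L \<le> n then mangoldt n else 0) * E n =
          (\<Sum>d | d dvd n. mu d * (mangoldt_above L (n div d) * E (d * (n div d))))"
        by simp
    qed
    also have "\<dots> = (\<Sum>d\<in>{1..N}. mu d * T d)"
      unfolding sum_divisors_swap[of "\<lambda>d j. mu d * (mangoldt_above L j * E (d * j))" N] T_def
      by (simp add: sum_distrib_left)
    finally show ?thesis .
  qed
  have T: "T d = (\<Sum>j\<in>{1..N div d}. ln (real j) * E (d * j)) -
       (\<Sum>c\<in>{1..<L}. mangoldt c * (\<Sum>r\<in>{1..N div d div c}. E (d * (c * r))))" for d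
  proof -
    define M where "M = N div d"
    have "T d = (\<Sum>j\<in>{1..M}. ln (real j) * E (d * j) -
         (\<Sum>c | c dvd j. (if c < L then mangoldt c else 0) * E (d * (c * (j div c)))))"
      unfolding T_def M_def
    proof (rule sum.cong[OF refl])
      fix j assume j: "j \<in> {1..N div d}"
      have "(\<Sum>c | c dvd j. (if c < L then mangoldt c else 0) * E (d * (c * (j div c)))) =
            complex_of_real (\<Sum>c | c dvd j. if c < L then mangoldt c else 0) * E (d * j)"
        unfolding of_real_sum sum_distrib_right by (intro sum.cong) auto
      then show "mangoldt_above L j * E (d * j) = ln (real j) * E (d * j) -
         (\<Sum>c | c dvd j. (if c < L then mangoldt c else 0) * E (d * (c * (j div c))))"
        using j by (simp add: mangoldt_above_split left_diff_distrib del: of_real_sum)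
    qed
    also have "\<dots> = (\<Sum>j\<in>{1..M}. ln (real j) * E (d * j)) -
       (\<Sum>c\<in>{1..M}. \<Sum>r\<in>{1..M div c}. (if c < L then mangoldt c else 0) * E (d * (c * r)))"
      unfolding sum_subtractf
      using sum_divisors_swap[of "\<lambda>c r. (if c < L then mangoldt c else 0) * E (d * (c * r))" M]
      by simp
    \<comment> \<open>For \<open>c > M\<close> the inner range is empty. Extending \<open>c\<close>
      to \<open>N\<close> makes its range independent of \<open>d\<close>, so that the cut at
      \<open>L\<close> is the same for all \<open>d\<close>.\<close>
    also have "(\<Sum>c\<in>{1..M}. \<Sum>r\<in>{1..M div c}. (if c < L then mangoldt c else 0) * E (d * (c * r))) =
      (\<Sum>c\<in>{1..N}. \<Sum>r\<in>{1..M div c}. (if c < L then mangoldt c else 0) * E (d * (c * r)))"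
      by (rule sum.mono_neutral_left) (auto simp: M_def intro: order.trans[OF _ div_le_dividend])
    also have "\<dots> = (\<Sum>c\<in>{1..<L}. \<Sum>r\<in>{1..M div c}. (if c < L then mangoldt c else 0) * E (d * (c * r)))"
      using L by (intro sum.mono_neutral_right) auto
    finally show ?thesis by (simp add: M_def sum_distrib_left)
  qed
  have "(\<Sum>n\<in>{1..N}. mangoldt n * E n) =
    (\<Sum>n\<in>{1..N}. (if L \<le> n then 0 else mangoldt n) * E n) + (\<Sum>n\<in>{1..N}. (if L \<le> n then mangoldt n else 0) * E n)"
    unfolding sum.distrib[symmetric] by (intro sum.cong) auto
  also have "(\<Sum>n\<in>{1..N}. (if L \<le> n then 0 else mangoldt n) * E n) = (\<Sum>n\<in>{1..<L}. mangoldt n * E n)"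
    using L by (intro sum.mono_neutral_cong_right) auto
  also note id
  also have "(\<Sum>d\<in>{1..N}. mu d * T d) = (\<Sum>d\<in>{1..V}. mu d * T d) + (\<Sum>d\<in>{V<..N}. mu d * T d)"
    using V by (subst sum.union_disjoint[symmetric]) (auto intro!: sum.cong)
  also have "(\<Sum>d\<in>{1..V}. mu d * T d) = (\<Sum>d\<in>{1..V}. mu d * (\<Sum>j\<in>{1..N div d}. ln (real j) * E (d * j))) -
    (\<Sum>d\<in>{1..V}. mu d * (\<Sum>c\<in>{1..<L}. mangoldt c * (\<Sum>r\<in>{1..N div d div c}. E (d * (c * r)))))"
    unfolding T by (simp add: right_diff_distrib sum_subtractf)
  finally show ?thesis unfolding T_def
    by (simp add: algebra_simps)
qed

section \<open>Van der Corput's second derivative test\<close>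

definition expi :: "real \<Rightarrow> complex" where
  "expi t = cis (2 * pi * t)"

lemma norm_expi [simp]: "norm (expi t) = 1"
  by (simp add: expi_def)

lemma expi_add: "expi (s + t) = expi s * expi t"
  by (simp add: expi_def cis_mult algebra_simps)

lemma expi_int [simp]: "expi (of_int j) = 1"
proof -
  have "cis (2 * pi * of_int j) = 1"
    by (metis cis_multiple_2pi Ints_of_int)
  then show ?thesis by (simp add: expi_def)
qed

lemma expi_diff_int: "expi (t - of_int j) = expi t"
  using expi_add[of "t - of_int j" "of_int j"] by simp

lemma expi_uminus: "expi (- t) = cnj (expi t)"
  by (simp add: expi_def cis_cnj)

lemma one_minus_expi: "1 - expi t = - 2 * \<i> * sin (pi * t) * cis (pi * t)"
proof -
  have "cos (2 * (pi * t)) = 1 - 2 * sin (pi * t) ^ 2" "sin (2 * (pi * t)) = 2 * sin (pi * t) * cos (pi * t)"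
    by (simp_all add: cos_double_sin sin_double)
  then show ?thesis
    unfolding expi_def by (intro complex_eqI) (simp_all add: mult_ac power2_eq_square)
qed

lemma norm_one_minus_expi: "norm (1 - expi t) = 2 * \<bar>sin (pi * t)\<bar>"
  unfolding one_minus_expi by (simp add: norm_mult)

lemma sin_pi_ge:
  assumes "0 \<le> t" "t \<le> 1/2"
  shows "2 * t \<le> sin (pi * t)"
proof -
  have cc: "concave_on {0..pi/2} sin"
    unfolding concave_on_def
  proof (rule f''_ge0_imp_convex[where f' = "\<lambda>x. - cos x" and f'' = "\<lambda>x. sin x"])
    show "convex {0..pi/2}" by simp
    fix x assume "x \<in> {0..pi/2}"
    then show "0 \<le> sin x" by (intro sin_ge_zero) auto
  qed (auto intro!: derivative_eq_intros)
  have "sin ((1 - 2*t) *\<^sub>R 0 + (2*t) *\<^sub>R (pi/2)) \<ge> (1 - 2*t) * sin 0 + (2*t) * sin (pi/2)"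
    using assms by (intro concave_onD[OF cc]) auto
  then show ?thesis by (simp add: mult_ac)
qed

lemma sin_pi_ge_dist:
  assumes "0 < \<Delta>" "\<Delta> \<le> t" "t \<le> 1 - \<Delta>"
  shows "2 * \<Delta> \<le> sin (pi * t)"
proof (cases "t \<le> 1/2")
  case True
  then show ?thesis using sin_pi_ge[of t] assms by simp
next
  case False
  have "sin (pi * t) = sin (pi * (1 - t))"
    by (simp add: right_diff_distrib)
  then show ?thesis using sin_pi_ge[of "1 - t"] assms False by simp
qed

lemma inverse_one_minus_expi:
  assumes "sin (pi * t) \<noteq> 0"
  shows "1 / (1 - expi t) = (1 + \<i> * cot (pi * t)) / 2"
proof -
  have "(1 + \<i> * cot (pi * t)) * sin (pi * t) = \<i> * cis (- (pi * t))"
    using assms by (intro complex_eqI) (simp_all add: cot_def)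
  then have "(1 + \<i> * cot (pi * t)) / 2 * (1 - expi t) = \<i> * cis (- (pi * t)) * (- \<i>) * cis (pi * t)"
    unfolding one_minus_expi by (simp add: field_simps)
  also have "\<dots> = 1" by (simp add: cis_mult mult_ac)
  finally show ?thesis
    by (metis mult_zero_right nonzero_eq_divide_eq zero_neq_one)
qed

text \<open>
  Since \<open>1 / (1 - expi x) = (1 + \<i> cot (\<pi> x)) / 2\<close> has a monotone imaginary part, the variation
  produced by summation by parts telescopes.
\<close>

lemma kuzmin_landau:
  fixes u :: "nat \<Rightarrow> real"
  assumes "0 < \<Delta>"
    and d: "\<And>n. a \<le> n \<Longrightarrow> n < b \<Longrightarrow> of_int j + \<Delta> \<le> u (Suc n) - u n \<and> u (Suc n) - u n \<le> of_int j + 1 - \<Delta>"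
    and mono: "\<And>n. a \<le> n \<Longrightarrow> Suc n < b \<Longrightarrow> u (Suc n) - u n \<le> u (Suc (Suc n)) - u (Suc n)"
  shows "norm (\<Sum>n\<in>{a..<b}. expi (u n)) \<le> 1 / \<Delta>"
proof (cases "a < b")
  case False
  then show ?thesis using assms(1) by simp
next
  case True
  define x where "x n = u (Suc n) - u n - of_int j" for n
  have x: "\<Delta> \<le> x n" "x n \<le> 1 - \<Delta>" if "a \<le> n" "n < b" for n
    using d[OF that] by (auto simp: x_def)
  have sn: "2 * \<Delta> \<le> sin (pi * x n)" if "a \<le> n" "n < b" for n
    using sin_pi_ge_dist[OF assms(1)] x[OF that] by blast
  define g where "g n = 1 / (1 - expi (x n))" for n
  define c where "c n = cot (pi * x n)" for n
  have geq: "g n = (1 + \<i> * c n) / 2" if "a \<le> n" "n < b" for n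
    unfolding g_def c_def using sn[OF that] assms(1) by (intro inverse_one_minus_expi) auto
  have gn: "norm (g n) \<le> 1 / (4 * \<Delta>)" if "a \<le> n" "n < b" for n
  proof -
    have "norm (g n) = 1 / (2 * sin (pi * x n))"
      using sn[OF that] assms(1) by (simp add: g_def norm_divide norm_one_minus_expi)
    also have "\<dots> \<le> 1 / (2 * (2 * \<Delta>))"
      using sn[OF that] assms(1) by (intro divide_left_mono mult_left_mono mult_pos_pos) auto
    finally show ?thesis by simp
  qed
  have cn: "\<bar>c n\<bar> \<le> 1 / (2 * \<Delta>)" if "a \<le> n" "n < b" for n
  proof -
    have "\<bar>c n\<bar> = 2 * \<bar>Im (g n)\<bar>" by (simp add: geq[OF that])
    also have "\<dots> \<le> 2 * norm (g n)" using abs_Im_le_cmod by simp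
    finally show ?thesis using gn[OF that] by simp
  qed
  have cmono: "c (Suc n) \<le> c n" if "a \<le> n" "Suc n < b" for n
  proof -
    have le: "x n \<le> x (Suc n)" using mono[OF that] by (simp add: x_def)
    have s1: "sin (pi * x n) > 0" "sin (pi * x (Suc n)) > 0"
      using sn[of n] sn[of "Suc n"] that assms(1) by auto
    have "0 \<le> sin (pi * x (Suc n) - pi * x n)"
    proof (rule sin_ge_zero)
      show "0 \<le> pi * x (Suc n) - pi * x n" using le by simp
      have "pi * (x (Suc n) - x n) \<le> pi * 1"
        using x[of n] x[of "Suc n"] that assms(1) by (intro mult_left_mono) auto
      then show "pi * x (Suc n) - pi * x n \<le> pi" by (simp add: right_diff_distrib)
    qed
    then have "0 \<le> sin (pi * x (Suc n)) * cos (pi * x n) - cos (pi * x (Suc n)) * sin (pi * x n)"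
      by (simp add: sin_diff)
    then show ?thesis unfolding c_def cot_def using s1
      by (simp add: divide_simps) (simp add: algebra_simps)
  qed
  \<comment> \<open>A discrete primitive: up to the integer \<open>j\<close>, invisible to
    \<open>expi\<close>, \<open>x n\<close> is the increment of the phase, so consecutive values
    differ by the factor \<open>expi (x n)\<close>.\<close>
  have E: "expi (u n) = (expi (u n) - expi (u (Suc n))) * g n" if "a \<le> n" "n < b" for n
  proof -
    have ne: "1 - expi (x n) \<noteq> 0"
    proof
      assume "1 - expi (x n) = 0"
      then have "sin (pi * x n) = 0" using norm_one_minus_expi[of "x n"] by simp
      then show False using sn[OF that] assms(1) by simp
    qed
    have "u n + x n = u (Suc n) - of_int j" by (simp add: x_def)
    then have "expi (u (Suc n)) = expi (u n) * expi (x n)"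
      by (metis expi_add expi_diff_int)
    then have "expi (u n) - expi (u (Suc n)) = expi (u n) * (1 - expi (x n))"
      by (simp add: algebra_simps)
    then show ?thesis using ne by (simp add: g_def)
  qed
  have parts: "(\<Sum>n\<in>{a..<b'}. (expi (u n) - expi (u (Suc n))) * g n) =
     expi (u a) * g a - expi (u b') * g (b' - 1) + (\<Sum>n\<in>{a..<b'-1}. expi (u (Suc n)) * (g (Suc n) - g n))"
    if "a < b'" for b'
    using that
  proof (induction b')
    case (Suc m)
    show ?case
    proof (cases "a < m")
      case True
      then obtain k where k: "m = Suc k" "a \<le> k" by (cases m) auto
      show ?thesis using Suc True k by (simp add: algebra_simps)
    next
      case False
      then show ?thesis using Suc by (simp add: less_Suc_eq algebra_simps)
    qed
  qed simp
  have tel: "(\<Sum>n\<in>{a..<b'-1}. c n - c (Suc n)) = c a - c (b' - 1)" if "a < b'" for b'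
    using that
  proof (induction b')
    case (Suc m)
    show ?case
    proof (cases "a < m")
      case True
      then obtain k where k: "m = Suc k" "a \<le> k" by (cases m) auto
      show ?thesis using Suc True k by simp
    next
      case False
      then show ?thesis using Suc by (simp add: less_Suc_eq)
    qed
  qed simp
  have "(\<Sum>n\<in>{a..<b}. expi (u n)) = (\<Sum>n\<in>{a..<b}. (expi (u n) - expi (u (Suc n))) * g n)"
    using E by (intro sum.cong) auto
  also have "norm \<dots> \<le> norm (expi (u a) * g a) + norm (expi (u b) * g (b - 1)) +
       norm (\<Sum>n\<in>{a..<b-1}. expi (u (Suc n)) * (g (Suc n) - g n))"
    unfolding parts[OF True] by (intro norm_triangle_le norm_triangle_le_diff add_mono order.refl)
  also have "\<dots> \<le> 1 / (4 * \<Delta>) + 1 / (4 * \<Delta>) + (\<Sum>n\<in>{a..<b-1}. (c n - c (Suc n)) / 2)"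
  proof (intro add_mono)
    show "norm (expi (u a) * g a) \<le> 1 / (4 * \<Delta>)" using gn True by (simp add: norm_mult)
    show "norm (expi (u b) * g (b-1)) \<le> 1 / (4 * \<Delta>)" using gn True by (simp add: norm_mult)
    show "norm (\<Sum>n\<in>{a..<b-1}. expi (u (Suc n)) * (g (Suc n) - g n)) \<le> (\<Sum>n\<in>{a..<b-1}. (c n - c (Suc n)) / 2)"
    proof (rule sum_norm_le)
      fix n assume n: "n \<in> {a..<b-1}"
      have gs: "g n = (1 + \<i> * c n) / 2" "g (Suc n) = (1 + \<i> * c (Suc n)) / 2"
        using n geq by auto
      have "g (Suc n) - g n = \<i> * complex_of_real ((c (Suc n) - c n) / 2)"
        unfolding gs by (simp add: field_simps)
      then have "norm (expi (u (Suc n)) * (g (Suc n) - g n)) = \<bar>(c (Suc n) - c n) / 2\<bar>"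
        by (simp only: norm_mult norm_expi norm_ii norm_of_real)
      also have "\<dots> = (c n - c (Suc n)) / 2" using n cmono[of n] by auto
      finally show "norm (expi (u (Suc n)) * (g (Suc n) - g n)) \<le> (c n - c (Suc n)) / 2" by simp
    qed
  qed
  also have "\<dots> = 1 / (2 * \<Delta>) + (c a - c (b - 1)) / 2"
    unfolding sum_divide_distrib[symmetric] tel[OF True] by simp
  also have "\<dots> \<le> 1 / (2 * \<Delta>) + (1 / (2*\<Delta>) + 1 / (2*\<Delta>)) / 2"
  proof -
    have "\<bar>c a\<bar> \<le> 1 / (2*\<Delta>)" "\<bar>c (b - 1)\<bar> \<le> 1 / (2*\<Delta>)" using cn True by auto
    then have "c a \<le> 1 / (2*\<Delta>)" "- c (b - 1) \<le> 1 / (2*\<Delta>)" by (blast dest: abs_le_D1 abs_le_D2)+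
    from add_mono[OF this] have "c a - c (b - 1) \<le> 1 / (2*\<Delta>) + 1 / (2*\<Delta>)" by simp
    then show ?thesis by (intro add_left_mono divide_right_mono) auto
  qed
  also have "\<dots> = 1 / \<Delta>" using assms(1) by simp
  finally show ?thesis .
qed

lemma interval_nat_if_convex:
  fixes S :: "nat set"
  assumes "finite S" "\<And>x y z. x \<in> S \<Longrightarrow> z \<in> S \<Longrightarrow> x \<le> y \<Longrightarrow> y \<le> z \<Longrightarrow> y \<in> S"
  obtains a b where "S = {a..<b}"
proof (cases "S = {}")
  case True
  then show ?thesis using that[of 0 0] by simp
next
  case False
  have "S = {Min S..<Suc (Max S)}"
  proof (intro equalityI subsetI)
    fix y assume "y \<in> S"
    then show "y \<in> {Min S..<Suc (Max S)}" using assms(1) by (simp add: less_Suc_eq_le)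
  next
    fix y assume "y \<in> {Min S..<Suc (Max S)}"
    then show "y \<in> S"
      using assms(2)[OF Min_in[OF assms(1) False] Max_in[OF assms(1) False], of y] by simp
  qed
  then show ?thesis using that by blast
qed

lemma card_le_if_diameter:
  fixes S :: "nat set"
  assumes "finite S" "0 < l" "0 \<le> w"
    and "\<And>m n. m \<in> S \<Longrightarrow> n \<in> S \<Longrightarrow> m \<le> n \<Longrightarrow> l * (real n - real m) \<le> w"
  shows "real (card S) \<le> w / l + 1"
proof (cases "S = {}")
  case True
  then show ?thesis using assms by simp
next
  case False
  have "S \<subseteq> {Min S..Max S}" using assms(1) by auto
  then have "card S \<le> card {Min S..Max S}" by (intro card_mono) auto
  also have "\<dots> = Suc (Max S) - Min S" by simp
  finally have "real (card S) \<le> real (Suc (Max S) - Min S)" by (rule of_nat_mono)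
  moreover have mm: "Min S \<le> Max S" using assms(1) False by simp
  ultimately have "real (card S) \<le> (real (Max S) - real (Min S)) + 1" by (simp add: of_nat_diff)
  moreover have "real (Max S) - real (Min S) \<le> w / l"
    using assms(4)[of "Min S" "Max S"] assms(1,2) False mm by (simp add: pos_le_divide_eq mult.commute)
  ultimately show ?thesis by simp
qed

text \<open>The increments of \<open>u\<close> grow by at least \<open>l\<close> per step. Those
  within \<open>sqrt l\<close> of a given integer number at most \<open>2 / sqrt l + 1\<close> and
  are counted trivially; those between two such neighbourhoods form an interval to which
  Kuzmin-Landau applies with gap \<open>sqrt l\<close>. This choice of the gap balances the two
  bounds. All increments lie in a range of length \<open>T\<close>, which produces at most
  \<open>T + 2\<close> classes.\<close>

lemma second_difference_test:
  fixes u :: "nat \<Rightarrow> real"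
  assumes l: "0 < l" "l \<le> 1/4" and T: "0 \<le> T"
    and rng: "\<And>n. a \<le> n \<Longrightarrow> n < b \<Longrightarrow> D \<le> u (Suc n) - u n \<and> u (Suc n) - u n \<le> D + T"
    and step: "\<And>n. a \<le> n \<Longrightarrow> Suc n < b \<Longrightarrow> l \<le> (u (Suc (Suc n)) - u (Suc n)) - (u (Suc n) - u n)"
  shows "norm (\<Sum>n\<in>{a..<b}. expi (u n)) \<le> 4 * (T + 2) / sqrt l"
proof -
  define \<Delta> where "\<Delta> = sqrt l"
  define d where "d n = u (Suc n) - u n" for n
  have \<Delta>: "0 < \<Delta>" "\<Delta> * \<Delta> = l" using l by (auto simp: \<Delta>_def)
  have \<Delta>2: "\<Delta> \<le> 1/2" unfolding \<Delta>_def
    by (rule real_le_lsqrt) (use l in \<open>auto simp: power2_eq_square\<close>)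
  have grow: "l * (real n - real m) \<le> d n - d m" if "a \<le> m" "m \<le> n" "n < b" for m n
    using that(2,3)
  proof (induction n rule: dec_induct)
    case (step k)
    then have "l \<le> d (Suc k) - d k" using assms(5)[of k] that(1) by (auto simp: d_def)
    then show ?case using step by (simp add: algebra_simps)
  qed simp
  have dmono: "d m \<le> d n" if "a \<le> m" "m \<le> n" "n < b" for m n
  proof -
    have "0 \<le> l * (real n - real m)" using that l by simp
    then show ?thesis using grow[OF that] by linarith
  qed
  \<comment> \<open>The shift by \<open>\<Delta>\<close> makes class \<open>j\<close> the range from
    \<open>j - \<Delta>\<close> to \<open>j + 1 - \<Delta>\<close>, so that the neighbourhood of an
    integer is not torn between two classes.\<close>
  define fl where "fl n = \<lfloor>d n + \<Delta>\<rfloor>" for n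
  define J where "J = {\<lfloor>D + \<Delta>\<rfloor>..\<lfloor>D + T + \<Delta>\<rfloor>}"
  have flJ: "fl ` {a..<b} \<subseteq> J"
    using rng by (auto simp: fl_def J_def d_def intro!: floor_mono)
  have cardJ: "real (card J) \<le> T + 2"
  proof -
    have "real (nat (\<lfloor>D + T + \<Delta>\<rfloor> - \<lfloor>D + \<Delta>\<rfloor> + 1)) \<le> T + 2" using T by linarith
    then show ?thesis by (simp add: J_def)
  qed
  have part: "norm (\<Sum>n | n \<in> {a..<b} \<and> fl n = j. expi (u n)) \<le> 4 / \<Delta>" for j
  proof -
    define A where "A = {n \<in> {a..<b}. fl n = j \<and> d n < of_int j + \<Delta>}"
    define B where "B = {n \<in> {a..<b}. fl n = j \<and> of_int j + \<Delta> \<le> d n}"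
    have fin: "finite A" "finite B" by (auto simp: A_def B_def)
    have flj: "of_int j \<le> d n + \<Delta> \<and> d n + \<Delta> < of_int j + 1" if "fl n = j" for n
      using that unfolding fl_def by linarith
    have "real (card A) \<le> 2 * \<Delta> / l + 1"
    proof (rule card_le_if_diameter)
      fix m n assume "m \<in> A" "n \<in> A" "m \<le> n"
      then show "l * (real n - real m) \<le> 2 * \<Delta>"
        using grow[of m n] flj[of m] by (auto simp: A_def)
    qed (use fin l \<Delta> in auto)
    then have nA: "norm (\<Sum>n\<in>A. expi (u n)) \<le> 2 * \<Delta> / l + 1"
      using sum_norm_le[of A "\<lambda>n. expi (u n)" "\<lambda>_. 1"] by simp
    obtain a' b' where B: "B = {a'..<b'}"
    proof (rule interval_nat_if_convex[OF fin(2)])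
      fix x y z assume h: "x \<in> B" "z \<in> B" "x \<le> y" "y \<le> z"
      then have y: "y \<in> {a..<b}" by (auto simp: B_def)
      have dd: "d x \<le> d y" "d y \<le> d z" using dmono h by (auto simp: B_def)
      have "\<lfloor>d y + \<Delta>\<rfloor> = j"
        using flj[of x] flj[of z] h dd by (intro floor_unique) (auto simp: B_def)
      then show "y \<in> B" using h dd y by (auto simp: B_def fl_def)
    qed
    have nB: "norm (\<Sum>n\<in>B. expi (u n)) \<le> 1 / \<Delta>"
      unfolding B
    proof (rule kuzmin_landau[OF \<Delta>(1)])
      fix n assume "a' \<le> n" "n < b'"
      then have "n \<in> B" by (simp add: B)
      then show "of_int j + \<Delta> \<le> u (Suc n) - u n \<and> u (Suc n) - u n \<le> of_int j + 1 - \<Delta>"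
        using flj[of n] by (auto simp: B_def d_def)
    next
      fix n assume "a' \<le> n" "Suc n < b'"
      then have "n \<in> B" "Suc n \<in> B" by (simp_all add: B)
      then show "u (Suc n) - u n \<le> u (Suc (Suc n)) - u (Suc n)"
        using step[of n] l by (auto simp: B_def)
    qed
    have "{n. n \<in> {a..<b} \<and> fl n = j} = A \<union> B" "A \<inter> B = {}" by (auto simp: A_def B_def)
    then have "(\<Sum>n | n \<in> {a..<b} \<and> fl n = j. expi (u n)) = (\<Sum>n\<in>A. expi (u n)) + (\<Sum>n\<in>B. expi (u n))"
      using fin by (simp add: sum.union_disjoint)
    then have "norm (\<Sum>n | n \<in> {a..<b} \<and> fl n = j. expi (u n)) \<le> (2 * \<Delta> / l + 1) + 1 / \<Delta>"
      using norm_triangle_le[OF add_mono[OF nA nB]] by simp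
    also have "2 * \<Delta> / l = 2 * (1 / \<Delta>)" unfolding \<Delta>(2)[symmetric] using \<Delta>(1) by simp
    also have "(2 * (1 / \<Delta>) + 1) + 1 / \<Delta> \<le> 4 * (1 / \<Delta>)"
    proof -
      have "1 \<le> 1 / \<Delta>" using \<Delta>(1) \<Delta>2 by (simp add: pos_le_divide_eq)
      then show ?thesis by linarith
    qed
    also have "4 * (1 / \<Delta>) = 4 / \<Delta>" by simp
    finally show ?thesis .
  qed
  have "(\<Sum>n\<in>{a..<b}. expi (u n)) = (\<Sum>j\<in>J. \<Sum>n | n \<in> {a..<b} \<and> fl n = j. expi (u n))"
    using flJ by (subst sum.group) (auto simp: J_def)
  also have "norm \<dots> \<le> (\<Sum>j\<in>J. 4 / \<Delta>)" by (intro sum_norm_le part)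
  also have "\<dots> = real (card J) * (4 / \<Delta>)" by simp
  also have "\<dots> \<le> (T + 2) * (4 / \<Delta>)" using cardJ \<Delta> by (intro mult_right_mono) auto
  finally show ?thesis by (simp add: \<Delta>_def mult.commute)
qed

text \<open>The phases built from \<open>Li\<close> have a decreasing derivative, so the difference
  test is applied to \<open>- F\<close>, whose increments lie between \<open>- T\<close> and 0; this
  merely conjugates the exponential sum.\<close>

lemma second_derivative_test:
  fixes F F' F'' :: "real \<Rightarrow> real"
  assumes l: "0 < l" "l \<le> 1/4" and T: "0 \<le> T"
    and F: "\<And>t. real a \<le> t \<Longrightarrow> t \<le> real b \<Longrightarrow> (F has_real_derivative F' t) (at t)"
    and F': "\<And>t. real a \<le> t \<Longrightarrow> t \<le> real b \<Longrightarrow> (F' has_real_derivative F'' t) (at t)"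
    and rng: "\<And>t. real a \<le> t \<Longrightarrow> t \<le> real b \<Longrightarrow> 0 \<le> F' t \<and> F' t \<le> T"
    and F'': "\<And>t. real a \<le> t \<Longrightarrow> t \<le> real b \<Longrightarrow> F'' t \<le> - l"
  shows "norm (\<Sum>n\<in>{a..<b}. expi (F (real n))) \<le> 4 * (T + 2) / sqrt l"
proof -
  have "norm (\<Sum>n\<in>{a..<b}. expi (- F (real n))) \<le> 4 * (T + 2) / sqrt l"
  proof (rule second_difference_test[OF l T, where D = "- T"])
    fix n assume n: "a \<le> n" "n < b"
    then have "\<exists>z. real n < z \<and> z < real (Suc n) \<and> F (real (Suc n)) - F (real n) = (real (Suc n) - real n) * F' z"
      by (intro MVT2[where f = F and f' = F']) (auto intro!: F)
    then obtain z where "real n < z" "z < real (Suc n)" "F (real (Suc n)) - F (real n) = F' z"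
      by auto
    moreover have "0 \<le> F' z \<and> F' z \<le> T" using calculation n by (intro rng) auto
    ultimately show "- T \<le> - F (real (Suc n)) - - F (real n) \<and> - F (real (Suc n)) - - F (real n) \<le> - T + T"
      by linarith
  next
    fix n assume n: "a \<le> n" "Suc n < b"
    \<comment> \<open>The second difference is an increment of \<open>G\<close>, and two mean values
      turn it into one value of \<open>F''\<close>. The points used stay below \<open>n + 2\<close>,
      which is at most \<open>b\<close>.\<close>
    define G where "G t = F (t + 1) - F t" for t
    have "\<exists>z. real n < z \<and> z < real (Suc n) \<and> G (real (Suc n)) - G (real n) = (real (Suc n) - real n) * (F' (z + 1) - F' z)"
    proof (rule MVT2[where f = G and f' = "\<lambda>x. F' (x + 1) - F' x"])
      fix x assume x: "real n \<le> x" "x \<le> real (Suc n)"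
      have "((\<lambda>t. F (t + 1)) has_real_derivative F' (x + 1) * 1) (at x)"
        using x n by (intro DERIV_chain2[where f = F] F) (auto intro!: derivative_eq_intros)
      then show "(G has_real_derivative F' (x + 1) - F' x) (at x)"
        unfolding G_def using x n by (intro DERIV_diff F) auto
    qed simp
    then obtain z where z: "real n < z" "z < real (Suc n)" "G (real (Suc n)) - G (real n) = F' (z + 1) - F' z"
      by auto
    have "\<exists>y. z < y \<and> y < z + 1 \<and> F' (z + 1) - F' z = (z + 1 - z) * F'' y"
      using z n by (intro MVT2[where f = F' and f' = F''] F') auto
    then obtain y where y: "z < y" "y < z + 1" "F' (z + 1) - F' z = F'' y" by auto
    have "F'' y \<le> - l" using z y n by (intro F'') auto
    then show "l \<le> (- F (real (Suc (Suc n))) - - F (real (Suc n))) - (- F (real (Suc n)) - - F (real n))"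
      using z(3) y(3) by (simp add: G_def add_ac)
  qed
  also have "(\<Sum>n\<in>{a..<b}. expi (- F (real n))) = cnj (\<Sum>n\<in>{a..<b}. expi (F (real n)))"
    by (simp add: expi_uminus)
  finally show ?thesis by (simp only: complex_mod_cnj)
qed

section \<open>Exponential sums along Li\<close>

lemma ln_ge_1: "3 \<le> x \<Longrightarrow> 1 \<le> ln (x::real)"
  using exp_le by (subst ln_ge_iff) auto

text \<open>Here 81 is \<open>3 ^ 4\<close>, with \<open>exp 1\<close> at most 3. A logarithm
  \<open>w\<close> of at least 4 makes \<open>2 / w ^ 3\<close> at most half of
  \<open>1 / w\<^sup>2\<close> in the correlation estimate; this is the origin of the lower bounds
  81 on variables below.\<close>

lemma ln_ge_4: "81 \<le> x \<Longrightarrow> 4 \<le> ln (x::real)"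
proof -
  assume x: "81 \<le> x"
  have "exp (4 * 1 :: real) = exp 1 ^ 4" by (subst exp_of_nat_mult[symmetric]) simp
  also have "\<dots> \<le> 3 ^ 4" using exp_le by (intro power_mono) auto
  finally show ?thesis using x by (subst ln_ge_iff) auto
qed

section \<open>Li and the smooth (type I) sums\<close>

lemma Li_has_real_derivative:
  assumes "2 < t"
  shows "(Li has_real_derivative 1 / ln t) (at t)"
proof -
  have "(Li has_real_derivative 1 / ln t) (at t within {2..t+1})"
    unfolding Li_def[abs_def] using assms
    by (intro integral_has_real_derivative continuous_intros) auto
  then show ?thesis using assms at_within_Icc_at[of 2 t "t + 1"] by simp
qed

text \<open>The phase \<open>h * Li (q * t)\<close> has derivative between 0 and
  \<open>h * q\<close> and second derivative at most \<open>- 1 / (N * (ln N)\<^sup>2)\<close>,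
  since \<open>t\<close> and \<open>q * t\<close> do not exceed \<open>N\<close>. The loss in
  \<open>h\<close> and \<open>q\<close> is linear, the saving a power of \<open>N\<close>.\<close>

lemma norm_Li_sum_le:
  assumes h: "1 \<le> h" and q: "1 \<le> q" and N: "q * R \<le> N"
  shows "norm (\<Sum>r\<in>{1..R}. expi (h * Li (real (q * r)))) \<le> 3 + 4 * (h * real q + 2) * (sqrt (real N) * ln (real N))"
proof (cases "R \<le> 3")
  case True
  have "norm (\<Sum>r\<in>{1..R}. expi (h * Li (real (q * r)))) \<le> real R"
    using sum_norm_le[of "{1..R}" "\<lambda>r. expi (h * Li (real (q * r)))" "\<lambda>_. 1"] by simp
  moreover have "0 \<le> 4 * (h * real q + 2) * (sqrt (real N) * ln (real N))"
    using h by (cases "N = 0") auto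
  ultimately show ?thesis using True by simp
next
  case False
  then have R: "R \<ge> 4" by simp
  have "R \<le> q * R" using q by simp
  then have N4: "N \<ge> 4" using R N by linarith
  have lnN: "1 \<le> ln (real N)" using N4 by (intro ln_ge_1) auto
  define l where "l = 1 / (real N * (ln (real N))\<^sup>2)"
  have qt: "3 \<le> real q * t" "real q * t \<le> real N" "3 \<le> t" if "real 3 \<le> t" "t \<le> real R" for t
  proof -
    have "1 * 3 \<le> real q * t" using q that by (intro mult_mono) auto
    moreover have "real q * t \<le> real q * real R" using that by (intro mult_left_mono) auto
    moreover have "real q * real R \<le> real N" using N by (metis of_nat_le_iff of_nat_mult)
    ultimately show "3 \<le> real q * t" "real q * t \<le> real N" by linarith+
    show "3 \<le> t" using that by simp
  qed
  have main: "norm (\<Sum>r\<in>{3..<R}. expi (h * Li (real q * real r))) \<le> 4 * (h * real q + 2) / sqrt l"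
  proof (rule second_derivative_test[where F = "\<lambda>t. h * Li (real q * t)" and F' = "\<lambda>t. h * real q / ln (real q * t)"
        and F'' = "\<lambda>t. - (h * real q / (t * (ln (real q * t))\<^sup>2))"])
    show "0 < l" using N4 lnN by (simp add: l_def)
    have "4 * 1 \<le> real N * (ln (real N))\<^sup>2" using N4 lnN by (intro mult_mono) (auto simp: one_le_power)
    then show "l \<le> 1 / 4" unfolding l_def by (intro divide_left_mono) auto
    show "0 \<le> h * real q" using h by simp
    fix t assume t: "real 3 \<le> t" "t \<le> real R"
    note qt = qt[OF t]
    have ln1: "1 \<le> ln (real q * t)" using qt by (intro ln_ge_1) auto
    have "((\<lambda>t. Li (real q * t)) has_real_derivative 1 / ln (real q * t) * real q) (at t)"
      by (rule DERIV_chain2[where f = Li], rule Li_has_real_derivative)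
         (use qt in \<open>auto intro!: derivative_eq_intros\<close>)
    from DERIV_cmult[OF this, of h]
    show "((\<lambda>t. h * Li (real q * t)) has_real_derivative h * real q / ln (real q * t)) (at t)"
      by simp
    show "((\<lambda>t. h * real q / ln (real q * t)) has_real_derivative - (h * real q / (t * (ln (real q * t))\<^sup>2))) (at t)"
    proof -
      have "real q * t > 0" "ln (real q * t) \<noteq> 0" "t > 0" "real q > 0" using qt ln1 q by auto
      then show ?thesis
        by (auto intro!: derivative_eq_intros simp: power2_eq_square)
    qed
    have "h * real q / ln (real q * t) \<le> h * real q / 1"
      using h ln1 by (intro divide_left_mono) auto
    then show "0 \<le> h * real q / ln (real q * t) \<and> h * real q / ln (real q * t) \<le> h * real q"
      using h ln1 by auto
    have "l \<le> 1 / (t * (ln (real q * t))\<^sup>2)"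
      unfolding l_def
    proof (intro divide_left_mono mult_mono power_mono)
      have "1 * t \<le> real q * t" using q t by (intro mult_right_mono) auto
      then show "t \<le> real N" using qt by linarith
      show "ln (real q * t) \<le> ln (real N)" using qt by simp
      show "0 < real N * (ln (real N))\<^sup>2 * (t * (ln (real q * t))\<^sup>2)"
        using qt ln1 lnN N4 by (intro mult_pos_pos) auto
    qed (use ln1 qt in auto)
    also have "\<dots> \<le> h * real q / (t * (ln (real q * t))\<^sup>2)"
    proof (intro divide_right_mono)
      have "1 * 1 \<le> h * real q" using h q by (intro mult_mono) auto
      then show "1 \<le> h * real q" by simp
      show "0 \<le> t * (ln (real q * t))\<^sup>2" using t by auto
    qed
    finally show "- (h * real q / (t * (ln (real q * t))\<^sup>2)) \<le> - l" by simp
  qed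
  \<comment> \<open>The derivative of \<open>Li\<close> is available only beyond 2, so the test
    starts at 3, which works for every \<open>q\<close>; the last term is split off because the test
    sums over a half-open range. Hence the summand 3.\<close>
  have "{1..R} = {1,2,R} \<union> {3..<R}" using R by auto
  moreover have "{1,2,R} \<inter> {3..<R} = {}" by auto
  ultimately have "(\<Sum>r\<in>{1..R}. expi (h * Li (real (q * r)))) =
     (\<Sum>r\<in>{1,2,R}. expi (h * Li (real (q * r)))) + (\<Sum>r\<in>{3..<R}. expi (h * Li (real q * real r)))"
    by (simp only: sum.union_disjoint finite.intros finite_atLeastLessThan of_nat_mult)
  also have "norm \<dots> \<le> 3 + 4 * (h * real q + 2) / sqrt l"
  proof (intro norm_triangle_le add_mono main)
    have "norm (\<Sum>r\<in>{1,2,R}. expi (h * Li (real (q * r)))) \<le> (\<Sum>r\<in>{1,2,R}. 1)"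
      by (intro sum_norm_le) auto
    also have "\<dots> = 3" using R by simp
    finally show "norm (\<Sum>r\<in>{1,2,R}. expi (h * Li (real (q * r)))) \<le> 3" .
  qed
  also have "sqrt l = 1 / (sqrt (real N) * ln (real N))"
    using lnN by (simp add: l_def real_sqrt_divide real_sqrt_mult)
  finally show ?thesis by simp
qed

section \<open>Bilinear (type II) sums\<close>

text \<open>The mean value theorem is used in the multiplier \<open>s\<close> between
  \<open>k'\<close> and \<open>k\<close>, for fixed \<open>t\<close>. The second derivative of the
  phase is \<open>- h / t\<close> times an increment of \<open>s / (ln (s * t))\<^sup>2\<close>,
  whose derivative in \<open>s\<close> is positive; so even for \<open>k - k' = 1\<close> it is at
  most \<open>- k / (2 * N * (ln N)\<^sup>2)\<close>.\<close>

lemma norm_Li_correlation_le: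
  assumes h: "1 \<le> h" and k: "81 \<le> k'" "k' < k" and a: "1 \<le> a" and N: "k * R \<le> N"
  shows "norm (\<Sum>m\<in>{a..R}. expi (h * Li (real (m * k)) - h * Li (real (m * k')))) \<le>
     1 + 4 * (h * (real k - real k') + 2) * (sqrt (2 * (real N / real k)) * ln (real N))"
proof (cases "a \<le> R")
  case False
  have "0 \<le> 4 * (h * (real k - real k') + 2) * (sqrt (2 * (real N / real k)) * ln (real N))"
    using h k by (cases "N = 0") auto
  then show ?thesis using False by simp
next
  case True
  have "k * 1 \<le> k * R" using True a by (intro mult_left_mono) auto
  then have kN: "k \<le> N" using N by linarith
  have lnN: "4 \<le> ln (real N)" using kN k by (intro ln_ge_4) auto
  define l where "l = real k / (2 * real N * (ln (real N))\<^sup>2)"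
  have kR: "real k * real R \<le> real N" using N by (metis of_nat_le_iff of_nat_mult)
  have st: "81 \<le> s * t" "s * t \<le> real N" "0 < t" "0 < s" "4 \<le> ln (s * t)" "ln (s * t) \<le> ln (real N)"
    if "real a \<le> t" "t \<le> real R" "real k' \<le> s" "s \<le> real k" for s t
  proof -
    have "81 * 1 \<le> s * t" using k a that by (intro mult_mono) auto
    then show "81 \<le> s * t" by simp
    then show "4 \<le> ln (s * t)" by (intro ln_ge_4)
    show "0 < t" "0 < s" using a k that by auto
    have "s * t \<le> real k * real R" using that \<open>0 < t\<close> by (intro mult_mono) auto
    then show "s * t \<le> real N" using kR by linarith
    then show "ln (s * t) \<le> ln (real N)" using \<open>81 \<le> s * t\<close> by simp
  qed
  have main: "norm (\<Sum>m\<in>{a..<R}. expi (h * Li (real k * real m) - h * Li (real k' * real m))) \<le>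
      4 * (h * (real k - real k') + 2) / sqrt l"
  proof (rule second_derivative_test[where F = "\<lambda>t. h * Li (real k * t) - h * Li (real k' * t)"
        and F' = "\<lambda>t. h * (real k / ln (real k * t) - real k' / ln (real k' * t))"
        and F'' = "\<lambda>t. - (h / t * (real k / (ln (real k * t))\<^sup>2 - real k' / (ln (real k' * t))\<^sup>2))"])
    show "0 < l" using kN k lnN by (simp add: l_def)
    have "4 * real k \<le> real k * (2 * (ln (real N))\<^sup>2)"
    proof -
      have "4\<^sup>2 \<le> (ln (real N))\<^sup>2" using lnN by (intro power_mono) auto
      then have "real k * 4 \<le> real k * (2 * (ln (real N))\<^sup>2)" by (intro mult_left_mono) auto
      then show ?thesis by simp
    qed
    also have "\<dots> \<le> real N * (2 * (ln (real N))\<^sup>2)" using kN by (intro mult_right_mono) auto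
    finally show "l \<le> 1 / 4" using kN k lnN by (simp add: l_def field_simps)
    show "0 \<le> h * (real k - real k')" using h k by simp
    fix t assume t: "real a \<le> t" "t \<le> real R"
    note st1 = st[OF t, of "real k"] and st2 = st[OF t, of "real k'"]
    have kk: "real k' \<le> real k" using k by simp
    have D: "((\<lambda>t. h * Li (real q * t)) has_real_derivative h * (real q / ln (real q * t))) (at t)"
      if q: "q = k \<or> q = k'" for q
    proof -
      have "((\<lambda>t. Li (real q * t)) has_real_derivative 1 / ln (real q * t) * real q) (at t)"
        by (rule DERIV_chain2[where f = Li], rule Li_has_real_derivative)
           (use q st1 st2 k in \<open>auto intro!: derivative_eq_intros\<close>)
      from DERIV_cmult[OF this, of h] show ?thesis by simp
    qed
    show "((\<lambda>t. h * Li (real k * t) - h * Li (real k' * t)) has_real_derivative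
         h * (real k / ln (real k * t) - real k' / ln (real k' * t))) (at t)"
      using DERIV_diff[OF D D] by (simp add: right_diff_distrib)
    have D': "((\<lambda>t. real q / ln (real q * t)) has_real_derivative - (real q / (ln (real q * t))\<^sup>2) / t) (at t)"
      if q: "q = k \<or> q = k'" for q
    proof -
      have "real q * t > 0" "ln (real q * t) \<noteq> 0" "t > 0" "real q > 0" using q st1 st2 kk by auto
      then show ?thesis
        by (auto intro!: derivative_eq_intros simp: power2_eq_square)
    qed
    show "((\<lambda>t. h * (real k / ln (real k * t) - real k' / ln (real k' * t))) has_real_derivative
        - (h / t * (real k / (ln (real k * t))\<^sup>2 - real k' / (ln (real k' * t))\<^sup>2))) (at t)"
      by (rule DERIV_cong[OF DERIV_cmult[OF DERIV_diff[OF D' D']]])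
         (auto simp: diff_divide_distrib right_diff_distrib mult_ac)
    have "\<exists>z. real k' < z \<and> z < real k \<and> real k / ln (real k * t) - real k' / ln (real k' * t) =
        (real k - real k') * (1 / ln (z * t) - 1 / (ln (z * t))\<^sup>2)"
    proof (rule MVT2[where f = "\<lambda>s. s / ln (s * t)" and f' = "\<lambda>s. 1 / ln (s * t) - 1 / (ln (s * t))\<^sup>2"])
      show "real k' < real k" using k by simp
      fix s assume s: "real k' \<le> s" "s \<le> real k"
      have "s * t > 0" "ln (s * t) \<noteq> 0" "t > 0" "s > 0" using st[OF t s] by auto
      then show "((\<lambda>s. s / ln (s * t)) has_real_derivative 1 / ln (s * t) - 1 / (ln (s * t))\<^sup>2) (at s)"
        by (auto intro!: derivative_eq_intros simp: power2_eq_square diff_divide_distrib)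
    qed
    then obtain z where z: "real k' < z" "z < real k"
      "real k / ln (real k * t) - real k' / ln (real k' * t) = (real k - real k') * (1 / ln (z * t) - 1 / (ln (z * t))\<^sup>2)"
      by blast
    define x where "x = 1 / ln (z * t)"
    have x: "0 < x" "x \<le> 1" using st(5)[OF t, of z] z by (auto simp: x_def)
    have x2: "1 / ln (z * t) - 1 / (ln (z * t))\<^sup>2 = x * (1 - x)"
      by (simp add: x_def power2_eq_square right_diff_distrib)
    have "0 \<le> x * (1 - x)" using x by simp
    moreover have "x * (1 - x) \<le> 1 * 1" using x by (intro mult_mono) auto
    ultimately have "0 \<le> (real k - real k') * (x * (1 - x)) \<and> (real k - real k') * (x * (1 - x)) \<le> (real k - real k') * 1"
      using mult_nonneg_nonneg[of "real k - real k'" "x * (1 - x)"]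
        mult_left_mono[of "x * (1 - x)" 1 "real k - real k'"] kk by simp
    then show "0 \<le> h * (real k / ln (real k * t) - real k' / ln (real k' * t)) \<and>
       h * (real k / ln (real k * t) - real k' / ln (real k' * t)) \<le> h * (real k - real k')"
      unfolding z x2 using h by (intro conjI mult_nonneg_nonneg[of h] mult_left_mono[of _ _ h]) auto
    have "\<exists>z. real k' < z \<and> z < real k \<and> real k / (ln (real k * t))\<^sup>2 - real k' / (ln (real k' * t))\<^sup>2 =
        (real k - real k') * (1 / (ln (z * t))\<^sup>2 - 2 / (ln (z * t)) ^ 3)"
    proof (rule MVT2[where f = "\<lambda>s. s / (ln (s * t))\<^sup>2" and f' = "\<lambda>s. 1 / (ln (s * t))\<^sup>2 - 2 / (ln (s * t)) ^ 3"])
      show "real k' < real k" using k by simp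
      fix s assume s: "real k' \<le> s" "s \<le> real k"
      have "s * t > 0" "ln (s * t) \<noteq> 0" "t > 0" "s > 0" using st[OF t s] by auto
      then show "((\<lambda>s. s / (ln (s * t))\<^sup>2) has_real_derivative 1 / (ln (s * t))\<^sup>2 - 2 / (ln (s * t)) ^ 3) (at s)"
        by (auto intro!: derivative_eq_intros simp: power2_eq_square power3_eq_cube diff_divide_distrib)
    qed
    then obtain y where y: "real k' < y" "y < real k"
      "real k / (ln (real k * t))\<^sup>2 - real k' / (ln (real k' * t))\<^sup>2 = (real k - real k') * (1 / (ln (y * t))\<^sup>2 - 2 / (ln (y * t)) ^ 3)"
      by blast
    define w where "w = ln (y * t)"
    have w: "4 \<le> w" "w \<le> ln (real N)" using st(5,6)[OF t, of y] y by (auto simp: w_def)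
    have "1 / (2 * (ln (real N))\<^sup>2) \<le> 1 / (2 * w\<^sup>2)"
      using w by (intro divide_left_mono mult_left_mono power_mono) auto
    also have "\<dots> \<le> 1 / w\<^sup>2 - 2 / w ^ 3"
      using w by (simp add: field_simps power2_eq_square power3_eq_cube)
    finally have 1: "1 / (2 * (ln (real N))\<^sup>2) \<le> 1 / w\<^sup>2 - 2 / w ^ 3" .
    have "t * real k \<le> real N" using st1(2) kk by (simp add: mult.commute)
    then have 2: "real k / real N \<le> 1 / t" using st1(3) kk kN k by (simp add: field_simps)
    have "1 * 1 \<le> h * (real k - real k')" using h k by (intro mult_mono) auto
    then have 3: "1 / t * 1 \<le> 1 / t * (h * (real k - real k'))" using st1(3) kk by (intro mult_left_mono) auto
    have "l = (real k / real N) * (1 / (2 * (ln (real N))\<^sup>2))" by (simp add: l_def)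
    also have "\<dots> \<le> (1 / t * (h * (real k - real k'))) * (1 / w\<^sup>2 - 2 / w ^ 3)"
      using 1 2 3 st1(3) kk h k by (intro mult_mono) auto
    also have "\<dots> = h / t * (real k / (ln (real k * t))\<^sup>2 - real k' / (ln (real k' * t))\<^sup>2)"
      unfolding y w_def[symmetric] by simp
    finally show "- (h / t * (real k / (ln (real k * t))\<^sup>2 - real k' / (ln (real k' * t))\<^sup>2)) \<le> - l" by simp
  qed
  have "{a..R} = insert R {a..<R}" using True by auto
  then have "(\<Sum>m\<in>{a..R}. expi (h * Li (real (m * k)) - h * Li (real (m * k')))) =
      expi (h * Li (real (R * k)) - h * Li (real (R * k'))) +
      (\<Sum>m\<in>{a..<R}. expi (h * Li (real k * real m) - h * Li (real k' * real m)))"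
    by (simp add: mult.commute)
  also have "norm \<dots> \<le> 1 + 4 * (h * (real k - real k') + 2) / sqrt l"
    by (intro norm_triangle_le add_mono main) simp
  also have "sqrt l = 1 / (sqrt (2 * (real N / real k)) * ln (real N))"
    using lnN by (simp add: l_def real_sqrt_divide real_sqrt_mult)
  finally show ?thesis by simp
qed

lemma norm_sum_power2:
  fixes z :: "nat \<Rightarrow> complex"
  shows "complex_of_real ((norm (\<Sum>k\<in>K. z k))\<^sup>2) = (\<Sum>k\<in>K. \<Sum>k'\<in>K. z k * cnj (z k'))"
  unfolding complex_norm_square cnj_sum sum_product ..

text \<open>
  Cauchy-Schwarz over \<open>m\<close>; only the \<open>L\<close> diagonal pairs are estimated trivially. The blocks may be
  this short because the second derivative of \<open>Li (m * k) - Li (m * k')\<close> in \<open>m\<close> is already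
  non-negligible for \<open>k - k' = 1\<close>.
\<close>

lemma norm_bilinear_block_le:
  fixes a b :: "nat \<Rightarrow> real"
  assumes h: "1 \<le> h" and k0: "81 \<le> k0" and L: "1 \<le> L"
    and a: "\<And>m. \<bar>a m\<bar> \<le> 1" and b: "\<And>k. k \<le> N \<Longrightarrow> \<bar>b k\<bar> \<le> \<beta>"
    and V: "\<And>M. real V \<le> M \<Longrightarrow>
        real L * (1 + 4 * (h * real L + 2) * (sqrt (2 * M) * ln (real N))) \<le> M"
  shows "norm (\<Sum>m\<in>{V<..N}. a m * (\<Sum>k | k \<in> {k0..<k0+L} \<and> m * k \<le> N. b k * expi (h * Li (real (m * k)))))
       \<le> \<beta> * sqrt (2 * real L) * (real N / real k0)"
proof -
  define R where "R = N div k0"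
  define B where "B = {k0..<k0+L}"
  define E where "E m k = (if m * k \<le> N then complex_of_real (b k) * expi (h * Li (real (m * k))) else 0)" for m k
  have \<beta>: "0 \<le> \<beta>" using b[of 0] by simp
  have inner: "(\<Sum>k | k \<in> {k0..<k0+L} \<and> m * k \<le> N. b k * expi (h * Li (real (m * k)))) = (\<Sum>k\<in>B. E m k)" for m
    unfolding E_def B_def by (intro sum.mono_neutral_cong_left) auto
  have mR: "m \<le> R" if "k0 \<le> k" "m * k \<le> N" for m k
  proof -
    have "m * k0 \<le> m * k" using that by simp
    then have "m * k0 \<le> N" using that by linarith
    then show ?thesis using k0 by (simp add: R_def less_eq_div_iff_mult_less_eq)
  qed
  \<comment> \<open>With \<open>R <= V\<close> no pair satisfies \<open>V < m\<close>,
    \<open>k0 <= k\<close> and \<open>m * k <= N\<close>. Otherwise \<open>M\<close> is at least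
    \<open>V\<close>, which is what the hypothesis \<open>V\<close> asks; it is stated for all
    \<open>M\<close> because \<open>M = N / k0\<close> varies from block to block.\<close>
  show ?thesis
  proof (cases "V < R")
    case False
    have "(\<Sum>m\<in>{V<..N}. a m * (\<Sum>k\<in>B. E m k)) = 0"
    proof (intro sum.neutral ballI)
      fix m assume m: "m \<in> {V<..N}"
      have "E m k = 0" if "k \<in> B" for k
        using mR[of k m] that m False by (auto simp: E_def B_def)
      then show "a m * (\<Sum>k\<in>B. E m k) = 0" by simp
    qed
    then show ?thesis unfolding inner using \<beta> by simp
  next
    case True
    define M where "M = real N / real k0"
    have "R * k0 \<le> N" by (simp add: R_def)
    then have "real R * real k0 \<le> real N" by (metis of_nat_le_iff of_nat_mult)
    then have RM: "real R \<le> M" unfolding M_def using k0 by (simp add: pos_le_divide_eq)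
    have RN: "R \<le> N" by (simp add: R_def)
    \<comment> \<open>\<open>X\<close> bounds one off-diagonal correlation, up to the factor from
      \<open>b\<close>. The next fact says that a whole row of them costs no more than the bound
      \<open>M\<close> for the diagonal entry.\<close>
    define X where "X = 1 + 4 * (h * real L + 2) * (sqrt (2 * M) * ln (real N))"
    have XM: "real L * X \<le> M" unfolding X_def using RM True by (intro V) auto
    have N1: "N \<ge> 1" using True RN by simp
    have X0: "0 \<le> X" unfolding X_def M_def using h N1 by (intro add_nonneg_nonneg mult_nonneg_nonneg) auto
    have M0: "0 \<le> M" by (simp add: M_def)
    define C where "C k k' = (\<Sum>m\<in>{V<..R}. E m k * cnj (E m k'))" for k k'
    have Cd: "norm (C k k) \<le> \<beta>\<^sup>2 * M" if "k \<in> B" for k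
    proof -
      have "norm (C k k) \<le> (\<Sum>m\<in>{V<..R}. \<beta>\<^sup>2)"
        unfolding C_def
      proof (rule sum_norm_le)
        fix m assume m: "m \<in> {V<..R}"
        show "norm (E m k * cnj (E m k)) \<le> \<beta>\<^sup>2"
        proof (cases "m * k \<le> N")
          case True
          then have "k \<le> N" using m by (metis greaterThanAtMost_iff le_trans mult.commute mult_le_mono2 nat_mult_1_right Suc_leI zero_less_Suc le_less_trans One_nat_def gr_zeroI not_less0)
          then have "\<bar>b k\<bar>\<^sup>2 \<le> \<beta>\<^sup>2" using b by (intro power_mono) auto
          then show ?thesis using True by (simp add: E_def norm_mult power2_eq_square)
        qed (simp add: E_def)
      qed
      also have "\<dots> = real (R - V) * \<beta>\<^sup>2" by simp
      also have "\<dots> \<le> M * \<beta>\<^sup>2" using RM True by (intro mult_right_mono) auto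
      finally show ?thesis by (simp add: mult.commute)
    qed
    have Clt: "norm (C k k') \<le> \<beta>\<^sup>2 * X" if kk: "k \<in> B" "k' \<in> B" "k' < k" for k k'
    proof -
      \<comment> \<open>For \<open>k' < k\<close> the condition \<open>m * k <= N\<close> implies
        the one for \<open>k'\<close>, so in the correlation \<open>m\<close> runs over an interval
        ending at \<open>N div k\<close>.\<close>
      define R' where "R' = N div k"
      have kR: "k * R' \<le> N" by (simp add: R'_def)
      have R'R: "R' \<le> R" unfolding R'_def R_def using kk k0 by (intro div_le_mono2) (auto simp: B_def)
      have k'0: "81 \<le> k'" "81 \<le> k" using kk k0 by (auto simp: B_def)
      have iff: "m * k \<le> N \<longleftrightarrow> m \<le> R'" for m
        using k'0 by (simp add: R'_def less_eq_div_iff_mult_less_eq)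
      have imp: "m \<le> R' \<Longrightarrow> m * k' \<le> N" for m
        using kk iff[of m] by (metis le_trans less_imp_le_nat mult_le_mono2)
      show ?thesis
      proof (cases "R' \<ge> 1")
        case False
        then have "C k k' = 0" unfolding C_def by (intro sum.neutral) (auto simp: E_def iff)
        then show ?thesis using X0 by simp
      next
        case R'1: True
        then have kN: "k \<le> N" using kR by (metis dual_order.trans mult_le_mono2 nat_mult_1_right)
        have "C k k' = (\<Sum>m\<in>{Suc V..R'}. complex_of_real (b k * b k') * expi (h * Li (real (m * k)) - h * Li (real (m * k'))))"
          unfolding C_def
        proof (rule sum.mono_neutral_cong_right)
          show "{Suc V..R'} \<subseteq> {V<..R}" using R'R by auto
          fix m assume "m \<in> {Suc V..R'}"
          then have "m * k \<le> N" "m * k' \<le> N" using iff imp by auto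
          moreover have "expi (h * Li (real (m * k)) - h * Li (real (m * k'))) =
             expi (h * Li (real (m * k))) * cnj (expi (h * Li (real (m * k'))))"
            by (simp add: expi_add[symmetric] expi_uminus[symmetric])
          ultimately show "E m k * cnj (E m k') = complex_of_real (b k * b k') * expi (h * Li (real (m * k)) - h * Li (real (m * k')))"
            by (simp add: E_def mult_ac)
        qed (auto simp: E_def iff)
        also have "norm \<dots> = \<bar>b k\<bar> * \<bar>b k'\<bar> * norm (\<Sum>m\<in>{Suc V..R'}. expi (h * Li (real (m * k)) - h * Li (real (m * k'))))"
          unfolding sum_distrib_left[symmetric] norm_mult norm_of_real abs_mult ..
        also have "\<dots> \<le> \<beta> * \<beta> * X"
        proof (intro mult_mono)
          show "\<bar>b k\<bar> \<le> \<beta>" "\<bar>b k'\<bar> \<le> \<beta>" using b kN kk by auto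
          have "norm (\<Sum>m\<in>{Suc V..R'}. expi (h * Li (real (m * k)) - h * Li (real (m * k')))) \<le>
              1 + 4 * (h * (real k - real k') + 2) * (sqrt (2 * (real N / real k)) * ln (real N))"
            by (rule norm_Li_correlation_le[OF h k'0(1) kk(3) _ kR]) simp
          also have "\<dots> \<le> X" unfolding X_def
          proof (intro add_left_mono mult_mono mult_left_mono add_right_mono real_sqrt_le_mono)
            show "real k - real k' \<le> real L" using kk by (auto simp: B_def)
            show "real N / real k \<le> M" unfolding M_def using kk k0 by (intro divide_left_mono) (auto simp: B_def)
          qed (use h kk M0 N1 in auto)
          finally show "norm (\<Sum>m\<in>{Suc V..R'}. expi (h * Li (real (m * k)) - h * Li (real (m * k')))) \<le> X" .
        qed (use \<beta> in auto)
        finally show ?thesis by (simp add: power2_eq_square)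
      qed
    qed
    have Cne: "norm (C k k') \<le> \<beta>\<^sup>2 * X" if kk: "k \<in> B" "k' \<in> B" "k' \<noteq> k" for k k'
    proof (cases "k' < k")
      case False
      have "C k k' = cnj (C k' k)" by (simp add: C_def mult.commute)
      then have "norm (C k k') = norm (C k' k)" by simp
      then show ?thesis using Clt[of k' k] kk False by simp
    qed (use Clt kk in blast)
    have cardB: "card B = L" by (simp add: B_def)
    have sumC: "norm (\<Sum>k\<in>B. \<Sum>k'\<in>B. C k k') \<le> real L * (\<beta>\<^sup>2 * (2 * M))"
    proof -
      have "norm (\<Sum>k\<in>B. \<Sum>k'\<in>B. C k k') \<le> (\<Sum>k\<in>B. \<beta>\<^sup>2 * (2 * M))"
      proof (rule sum_norm_le)
        fix k assume k: "k \<in> B"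
        have "norm (\<Sum>k'\<in>B. C k k') \<le> norm (C k k) + norm (\<Sum>k'\<in>B-{k}. C k k')"
          using k by (subst sum.remove[of B k]) (auto simp: B_def intro: norm_triangle_ineq)
        also have "\<dots> \<le> \<beta>\<^sup>2 * M + (\<Sum>k'\<in>B-{k}. \<beta>\<^sup>2 * X)"
          using Cd Cne k by (intro add_mono sum_norm_le) auto
        also have "(\<Sum>k'\<in>B-{k}. \<beta>\<^sup>2 * X) \<le> (\<Sum>k'\<in>B. \<beta>\<^sup>2 * X)"
          using X0 by (intro sum_mono2) (auto simp: B_def)
        also have "\<dots> = \<beta>\<^sup>2 * (real L * X)" by (simp add: cardB)
        also have "\<dots> \<le> \<beta>\<^sup>2 * M" using XM by (intro mult_left_mono) auto
        finally show "norm (\<Sum>k'\<in>B. C k k') \<le> \<beta>\<^sup>2 * (2 * M)" by (simp add: mult_ac)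
      qed
      then show ?thesis by (simp add: cardB)
    qed
    define T where "T = (\<Sum>m\<in>{V<..R}. norm (\<Sum>k\<in>B. E m k))"
    define S2 where "S2 = (\<Sum>m\<in>{V<..R}. (norm (\<Sum>k\<in>B. E m k))\<^sup>2)"
    have S20: "0 \<le> S2" unfolding S2_def by (intro sum_nonneg) simp
    have "complex_of_real S2 = (\<Sum>m\<in>{V<..R}. \<Sum>k\<in>B. \<Sum>k'\<in>B. E m k * cnj (E m k'))"
      unfolding S2_def of_real_sum norm_sum_power2 ..
    also have "\<dots> = (\<Sum>k\<in>B. \<Sum>m\<in>{V<..R}. \<Sum>k'\<in>B. E m k * cnj (E m k'))" by (rule sum.swap)
    also have "\<dots> = (\<Sum>k\<in>B. \<Sum>k'\<in>B. C k k')"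
      unfolding C_def by (intro sum.cong refl sum.swap)
    finally have "S2 = norm (\<Sum>k\<in>B. \<Sum>k'\<in>B. C k k')"
      using S20 by (metis abs_of_nonneg norm_of_real)
    then have sq: "S2 \<le> real L * (\<beta>\<^sup>2 * (2 * M))"
      using sumC by simp
    have "real (card {V<..R}) \<le> real R" by simp
    then have card_le: "real (card {V<..R}) \<le> M" using RM by linarith
    have "T\<^sup>2 \<le> real (card {V<..R}) * S2"
      using Cauchy_Schwarz_ineq_sum[of "\<lambda>_. 1" "\<lambda>m. norm (\<Sum>k\<in>B. E m k)" "{V<..R}"] unfolding T_def S2_def by simp
    also have "\<dots> \<le> M * (real L * (\<beta>\<^sup>2 * (2 * M)))"
      using card_le sq M0 S20
      by (intro mult_mono) simp_all
    also have "\<dots> = (\<beta> * sqrt (2 * real L) * M)\<^sup>2"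
      by (simp add: power_mult_distrib power2_eq_square[of M] mult_ac)
    finally have T: "T \<le> \<beta> * sqrt (2 * real L) * M"
      by (rule power2_le_imp_le) (use \<beta> M0 in simp)
    have "(\<Sum>m\<in>{V<..N}. a m * (\<Sum>k\<in>B. E m k)) = (\<Sum>m\<in>{V<..R}. a m * (\<Sum>k\<in>B. E m k))"
    proof (rule sum.mono_neutral_right)
      show "\<forall>m\<in>{V<..N} - {V<..R}. a m * (\<Sum>k\<in>B. E m k) = 0"
      proof
        fix m assume m: "m \<in> {V<..N} - {V<..R}"
        have "E m k = 0" if "k \<in> B" for k
        proof -
          have "\<not> m * k \<le> N"
          proof
            assume mk: "m * k \<le> N"
            have "k0 \<le> k" using that by (simp add: B_def)
            from mR[OF this mk] show False using m by auto
          qed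
          then show ?thesis by (simp add: E_def)
        qed
        then show "a m * (\<Sum>k\<in>B. E m k) = 0" by simp
      qed
    qed (use RN in auto)
    also have "norm \<dots> \<le> T" unfolding T_def
    proof (rule sum_norm_le)
      fix m assume "m \<in> {V<..R}"
      show "norm (a m * (\<Sum>k\<in>B. E m k)) \<le> norm (\<Sum>k\<in>B. E m k)"
        using mult_right_mono[OF a[of m], of "norm (\<Sum>k\<in>B. E m k)"] by (simp add: norm_mult)
    qed
    finally show ?thesis using T unfolding inner M_def by (rule order.trans)
  qed
qed

lemma sum_inverse_le_ln:
  "1 \<le> K \<Longrightarrow> (\<Sum>i\<in>{1..K}. 1 / real i) \<le> 1 + ln (real K)"
proof (induction K rule: dec_induct)
  case (step n)
  have "ln (real n / real (Suc n)) \<le> real n / real (Suc n) - 1"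
    using step by (intro ln_le_minus_one) auto
  also have "\<dots> = - (1 / real (Suc n))" by (simp add: field_simps)
  finally have "1 / real (Suc n) \<le> ln (real (Suc n)) - ln (real n)"
    using step by (simp add: ln_div)
  then show ?case using step by simp
qed simp

text \<open>The range of \<open>k\<close> is cut into blocks from \<open>i * L\<close> to
  \<open>i * L + L\<close>, where \<open>i >= 1\<close> because the coefficients vanish below
  \<open>L\<close>. The bound for block \<open>i\<close> is \<open>1 / i\<close> times that for the
  first, and the harmonic sum costs the factor \<open>1 + ln N\<close>.\<close>

lemma norm_type_II_le:
  fixes a b :: "nat \<Rightarrow> real"
  assumes h: "1 \<le> h" and L: "81 \<le> L" "L \<le> N"
    and a: "\<And>m. \<bar>a m\<bar> \<le> 1" and b: "\<And>k. k \<le> N \<Longrightarrow> \<bar>b k\<bar> \<le> \<beta>" and b0: "\<And>k. 1 \<le> k \<Longrightarrow> k < L \<Longrightarrow> b k = 0"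
    and V: "\<And>M. real V \<le> M \<Longrightarrow>
        real L * (1 + 4 * (h * real L + 2) * (sqrt (2 * M) * ln (real N))) \<le> M"
  shows "norm (\<Sum>m\<in>{V<..N}. a m * (\<Sum>k\<in>{1..N div m}. b k * expi (h * Li (real (m * k)))))
       \<le> \<beta> * sqrt (2 * real L) * (real N / real L) * (1 + ln (real N))"
proof -
  define K where "K = N div L"
  have K: "1 \<le> K" using L by (simp add: K_def Suc_le_eq div_greater_zero_iff)
  have KN: "K \<le> N" by (simp add: K_def)
  have \<beta>: "0 \<le> \<beta>" using b[of 0] by simp
  define G where "G i m = (\<Sum>k | k \<in> {i*L..<i*L+L} \<and> m * k \<le> N. b k * expi (h * Li (real (m * k))))" for i m
  have G: "(\<Sum>k\<in>{1..N div m}. b k * expi (h * Li (real (m * k)))) = (\<Sum>i\<in>{1..K}. G i m)" if m: "m \<in> {V<..N}" for m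
  proof -
    define f where "f k = (if m * k \<le> N then b k * expi (h * Li (real (m * k))) else 0)" for k
    have m0: "m > 0" using m by simp
    have NK: "N < Suc K * L" using L unfolding K_def
      by (metis dividend_less_times_div mult.commute mult_Suc_right add.commute not_numeral_le_zero gr_zeroI)
    have le: "k \<le> N" if "m * k \<le> N" for k
      using that m0 by (metis Suc_leI le_trans mult_le_mono1 nat_mult_1 One_nat_def)
    have "(\<Sum>k\<in>{1..N div m}. b k * expi (h * Li (real (m * k)))) = sum f {L..<Suc K * L}"
    proof (rule sum.mono_neutral_cong)
      show "\<And>k. k \<in> {L..<Suc K * L} - {1..N div m} \<Longrightarrow> f k = 0"
        using m0 L by (auto simp: f_def less_eq_div_iff_mult_less_eq mult.commute)
      fix k assume k: "k \<in> {1..N div m} - {L..<Suc K * L}"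
      then have "m * k \<le> N" using m0 by (auto simp: less_eq_div_iff_mult_less_eq mult.commute)
      then have "k < L" using le[of k] NK k by auto
      then show "b k * expi (h * Li (real (m * k))) = 0" using b0[of k] k by simp
    next
      fix k assume "k \<in> {1..N div m} \<inter> {L..<Suc K * L}"
      then show "b k * expi (h * Li (real (m * k))) = f k"
        using m0 by (auto simp: f_def less_eq_div_iff_mult_less_eq mult.commute)
    qed auto
    \<comment> \<open>Splitting into blocks is available for initial segments, so block 0 is added
      and subtracted. It contains the index 0, where \<open>b\<close> need not vanish.\<close>
    also have "\<dots> = sum f {..<Suc K * L} - sum f {..<1 * L}"
    proof -
      have "{..<Suc K * L} = {..<1 * L} \<union> {L..<Suc K * L}" by auto
      moreover have "{..<1 * L} \<inter> {L..<Suc K * L} = {}" by auto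
      ultimately show ?thesis by (simp add: sum.union_disjoint)
    qed
    also have "\<dots> = (\<Sum>i<Suc K. sum f {i*L..<i*L+L}) - (\<Sum>i<1. sum f {i*L..<i*L+L})"
      unfolding sum.nat_group ..
    also have "\<dots> = (\<Sum>i\<in>{1..K}. sum f {i*L..<i*L+L})"
    proof -
      have "{..<Suc K} = insert 0 {1..K}" by auto
      then show ?thesis by simp
    qed
    also have "\<dots> = (\<Sum>i\<in>{1..K}. G i m)"
      unfolding G_def f_def by (intro sum.cong refl sum.mono_neutral_cong_right) auto
    finally show ?thesis .
  qed
  have "(\<Sum>m\<in>{V<..N}. a m * (\<Sum>k\<in>{1..N div m}. b k * expi (h * Li (real (m * k))))) =
        (\<Sum>m\<in>{V<..N}. \<Sum>i\<in>{1..K}. a m * G i m)"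
    using G by (simp add: sum_distrib_left)
  also have "\<dots> = (\<Sum>i\<in>{1..K}. \<Sum>m\<in>{V<..N}. a m * G i m)" by (rule sum.swap)
  also have "norm \<dots> \<le> (\<Sum>i\<in>{1..K}. \<beta> * sqrt (2 * real L) * (real N / real L) * (1 / real i))"
  proof (rule sum_norm_le)
    fix i assume i: "i \<in> {1..K}"
    have "81 * 1 \<le> i * L" using i L by (metis atLeastAtMost_iff mult.commute mult_le_mono)
    then have "norm (\<Sum>m\<in>{V<..N}. a m * G i m) \<le> \<beta> * sqrt (2 * real L) * (real N / real (i * L))"
      unfolding G_def using L by (intro norm_bilinear_block_le h a b V) auto
    then show "norm (\<Sum>m\<in>{V<..N}. a m * G i m) \<le> \<beta> * sqrt (2 * real L) * (real N / real L) * (1 / real i)"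
      by (simp add: mult.commute)
  qed
  also have "\<dots> = \<beta> * sqrt (2 * real L) * (real N / real L) * (\<Sum>i\<in>{1..K}. 1 / real i)"
    by (simp add: sum_distrib_left)
  also have "\<dots> \<le> \<beta> * sqrt (2 * real L) * (real N / real L) * (1 + ln (real N))"
  proof (intro mult_left_mono)
    have "ln (real K) \<le> ln (real N)" using K KN by simp
    then show "(\<Sum>i\<in>{1..K}. 1 / real i) \<le> 1 + ln (real N)" using sum_inverse_le_ln[OF K] by linarith
  qed (use \<beta> in auto)
  finally show ?thesis .
qed

text \<open>Summation by parts: \<open>ln\<close> starts at 0 and increases, so its differences add
  up to \<open>ln R\<close>, and the boundary term contributes another \<open>ln R\<close>.\<close>

lemma norm_sum_ln_mult_le:
  fixes e :: "nat \<Rightarrow> complex"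
  assumes P: "\<And>R'. R' \<le> R \<Longrightarrow> norm (\<Sum>j\<in>{1..R'}. e j) \<le> P" and R: "1 \<le> R"
  shows "norm (\<Sum>j\<in>{1..R}. ln (real j) * e j) \<le> 2 * ln (real R) * P"
proof -
  define S where "S r = (\<Sum>j\<in>{1..r}. e j)" for r
  have id: "(\<Sum>j\<in>{1..r}. ln (real j) * e j) = ln (real r) * S r - (\<Sum>j\<in>{1..<r}. (ln (real (Suc j)) - ln (real j)) * S j)"
    if "1 \<le> r" for r
    using that by (induction r rule: dec_induct) (auto simp: S_def algebra_simps)
  have tel: "(\<Sum>j\<in>{1..<r}. ln (real (Suc j)) - ln (real j)) = ln (real r)" if "1 \<le> r" for r
    using that by (induction r rule: dec_induct) auto
  have "norm (\<Sum>j\<in>{1..R}. ln (real j) * e j) \<le>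
      norm (ln (real R) * S R) + norm (\<Sum>j\<in>{1..<R}. (ln (real (Suc j)) - ln (real j)) * S j)"
    unfolding id[OF R] by (rule norm_triangle_ineq4)
  also have "\<dots> \<le> ln (real R) * P + (\<Sum>j\<in>{1..<R}. (ln (real (Suc j)) - ln (real j)) * P)"
  proof (intro add_mono sum_norm_le)
    show "norm (ln (real R) * S R) \<le> ln (real R) * P"
      using P[of R] R by (auto simp: norm_mult S_def intro!: mult_left_mono)
    fix j assume j: "j \<in> {1..<R}"
    then have "ln (real j) \<le> ln (real (Suc j))" by simp
    then show "norm ((ln (real (Suc j)) - ln (real j)) * S j) \<le> (ln (real (Suc j)) - ln (real j)) * P"
      unfolding norm_mult norm_of_real S_def using P[of j] j by (auto intro!: mult_mono)
  qed
  also have "\<dots> = 2 * ln (real R) * P"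
    unfolding sum_distrib_right[symmetric] tel[OF R] by simp
  finally show ?thesis .
qed

section \<open>Vaughan's identity applied to the phases h Li\<close>

lemma mangoldt_le_ln:
  assumes "1 \<le> n" shows "mangoldt n \<le> ln (real n)"
  using mangoldt_le[of n] assms by simp

text \<open>\<open>P\<close> bounds every smooth sum that occurs, since the multipliers
  \<open>d\<close> and \<open>d * c\<close> are at most \<open>V * L\<close>. The four summands
  match the four parts of Vaughan's identity: the first is trivial, the next two are smooth, the
  last is bilinear.\<close>

lemma norm_mangoldt_Li_sum_le:
  assumes h: "1 \<le> h" and L: "81 \<le> L" "L \<le> N" and V': "1 \<le> V" "V \<le> N"
    and V: "\<And>M. real V \<le> M \<Longrightarrow>
        real L * (1 + 4 * (h * real L + 2) * (sqrt (2 * M) * ln (real N))) \<le> M"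
  defines "P \<equiv> 3 + 4 * (h * real V * real L + 2) * (sqrt (real N) * ln (real N))"
  shows "norm (\<Sum>n\<in>{1..N}. mangoldt n * expi (h * Li (real n))) \<le>
     real L * ln (real N) + real V * (2 * ln (real N) * P) + real V * (real L * (ln (real N) * P)) +
     ln (real N) * sqrt (2 * real L) * (real N / real L) * (1 + ln (real N))"
proof -
  define E where "E n = expi (h * Li (real n))" for n
  have lnN: "0 \<le> ln (real N)" using L by simp
  have P0: "0 \<le> P" unfolding P_def using h lnN by simp
  have I: "norm (\<Sum>r\<in>{1..R}. E (q * r)) \<le> P" if "1 \<le> q" "q \<le> V * L" "q * R \<le> N" for q R
  proof -
    have "norm (\<Sum>r\<in>{1..R}. E (q * r)) \<le> 3 + 4 * (h * real q + 2) * (sqrt (real N) * ln (real N))"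
      unfolding E_def by (rule norm_Li_sum_le[OF h that(1,3)])
    also have "\<dots> \<le> P"
    proof -
      have "real q \<le> real V * real L" using that(2) by (metis of_nat_le_iff of_nat_mult)
      then have "h * real q \<le> h * real V * real L" using h by (simp add: mult.assoc)
      then show ?thesis unfolding P_def using lnN
        by (intro add_left_mono mult_right_mono mult_left_mono add_right_mono) auto
    qed
    finally show ?thesis .
  qed
  have "norm (\<Sum>n\<in>{1..N}. mangoldt n * E n) \<le>
      norm (\<Sum>n\<in>{1..<L}. mangoldt n * E n)
    + norm (\<Sum>d\<in>{1..V}. mu d * (\<Sum>j\<in>{1..N div d}. ln (real j) * E (d * j)))
    + norm (\<Sum>d\<in>{1..V}. mu d * (\<Sum>c\<in>{1..<L}. mangoldt c * (\<Sum>r\<in>{1..N div d div c}. E (d * (c * r)))))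
    + norm (\<Sum>d\<in>{V<..N}. mu d * (\<Sum>j\<in>{1..N div d}. mangoldt_above L j * E (d * j)))"
    unfolding vaughan_identity[OF V'(2) L(2)]
    by (intro norm_triangle_le add_mono norm_triangle_le_diff order.refl)
  also have "\<dots> \<le> real L * ln (real N) + real V * (2 * ln (real N) * P) + real V * (real L * (ln (real N) * P)) +
     ln (real N) * sqrt (2 * real L) * (real N / real L) * (1 + ln (real N))"
  proof (intro add_mono)
    have "norm (\<Sum>n\<in>{1..<L}. mangoldt n * E n) \<le> (\<Sum>n\<in>{1..<L}. ln (real N))"
    proof (rule sum_norm_le)
      fix n assume n: "n \<in> {1..<L}"
      have "mangoldt n \<le> ln (real n)" using n by (intro mangoldt_le_ln) auto
      also have "\<dots> \<le> ln (real N)" using n L by simp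
      finally show "norm (mangoldt n * E n) \<le> ln (real N)" by (simp add: norm_mult E_def)
    qed
    also have "\<dots> \<le> real L * ln (real N)" using lnN by (simp add: mult_right_mono)
    finally show "norm (\<Sum>n\<in>{1..<L}. mangoldt n * E n) \<le> real L * ln (real N)" .
  next
    have "norm (\<Sum>d\<in>{1..V}. mu d * (\<Sum>j\<in>{1..N div d}. ln (real j) * E (d * j))) \<le> (\<Sum>d\<in>{1..V}. 2 * ln (real N) * P)"
    proof (rule sum_norm_le)
      fix d assume d: "d \<in> {1..V}"
      have dN: "1 \<le> N div d" using d V' by (simp add: Suc_le_eq div_greater_zero_iff)
      have "norm (\<Sum>j\<in>{1..N div d}. ln (real j) * E (d * j)) \<le> 2 * ln (real (N div d)) * P"
      proof (rule norm_sum_ln_mult_le[OF _ dN])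
        fix R' assume "R' \<le> N div d"
        then have "d * R' \<le> N" using d by (simp add: less_eq_div_iff_mult_less_eq mult.commute)
        moreover have "d * 1 \<le> V * L" using d L by (intro mult_le_mono) auto
        ultimately show "norm (\<Sum>j\<in>{1..R'}. E (d * j)) \<le> P" using d by (intro I) auto
      qed
      also have "\<dots> \<le> 2 * ln (real N) * P"
      proof -
        have "real (N div d) \<le> real N" by simp
        then have "ln (real (N div d)) \<le> ln (real N)" using dN by (intro ln_mono) auto
        then show ?thesis using P0 by (intro mult_right_mono mult_left_mono) auto
      qed
      finally have *: "norm (\<Sum>j\<in>{1..N div d}. ln (real j) * E (d * j)) \<le> 2 * ln (real N) * P" .
      show "norm (mu d * (\<Sum>j\<in>{1..N div d}. ln (real j) * E (d * j))) \<le> 2 * ln (real N) * P"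
        using mult_mono[OF abs_mu_le[of d] *] by (simp add: norm_mult)
    qed
    then show "norm (\<Sum>d\<in>{1..V}. mu d * (\<Sum>j\<in>{1..N div d}. ln (real j) * E (d * j))) \<le> real V * (2 * ln (real N) * P)"
      by simp
  next
    have "norm (\<Sum>d\<in>{1..V}. mu d * (\<Sum>c\<in>{1..<L}. mangoldt c * (\<Sum>r\<in>{1..N div d div c}. E (d * (c * r)))))
        \<le> (\<Sum>d\<in>{1..V}. real L * (ln (real N) * P))"
    proof (rule sum_norm_le)
      fix d assume d: "d \<in> {1..V}"
      have "norm (\<Sum>c\<in>{1..<L}. mangoldt c * (\<Sum>r\<in>{1..N div d div c}. E (d * (c * r)))) \<le> (\<Sum>c\<in>{1..<L}. ln (real N) * P)"
      proof (rule sum_norm_le)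
        fix c assume c: "c \<in> {1..<L}"
        have "mangoldt c \<le> ln (real c)" using c by (intro mangoldt_le_ln) auto
        also have "\<dots> \<le> ln (real N)" using c L by simp
        finally have m: "mangoldt c \<le> ln (real N)" .
        have "(d * c) * (N div d div c) \<le> N"
          unfolding div_mult2_eq[symmetric] by (rule times_div_less_eq_dividend)
        moreover have "d * c \<le> V * L" using d c by (intro mult_le_mono) auto
        moreover have "1 \<le> d * c" using d c by auto
        ultimately have "norm (\<Sum>r\<in>{1..N div d div c}. E ((d * c) * r)) \<le> P" by (intro I)
        then show "norm (mangoldt c * (\<Sum>r\<in>{1..N div d div c}. E (d * (c * r)))) \<le> ln (real N) * P"
          using mult_mono[OF m] lnN by (simp add: norm_mult mult.assoc)
      qed
      also have "\<dots> \<le> real L * (ln (real N) * P)" using lnN P0 by (simp add: mult_right_mono)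
      finally have *: "norm (\<Sum>c\<in>{1..<L}. mangoldt c * (\<Sum>r\<in>{1..N div d div c}. E (d * (c * r)))) \<le> real L * (ln (real N) * P)" .
      show "norm (mu d * (\<Sum>c\<in>{1..<L}. mangoldt c * (\<Sum>r\<in>{1..N div d div c}. E (d * (c * r))))) \<le> real L * (ln (real N) * P)"
        using mult_mono[OF abs_mu_le[of d] *] by (simp add: norm_mult)
    qed
    then show "norm (\<Sum>d\<in>{1..V}. mu d * (\<Sum>c\<in>{1..<L}. mangoldt c * (\<Sum>r\<in>{1..N div d div c}. E (d * (c * r)))))
       \<le> real V * (real L * (ln (real N) * P))" by simp
  next
    show "norm (\<Sum>d\<in>{V<..N}. mu d * (\<Sum>j\<in>{1..N div d}. mangoldt_above L j * E (d * j))) \<le>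
        ln (real N) * sqrt (2 * real L) * (real N / real L) * (1 + ln (real N))"
      unfolding E_def
    proof (rule norm_type_II_le[OF h L abs_mu_le _ _ V])
      fix k assume k: "k \<le> N"
      show "\<bar>mangoldt_above L k\<bar> \<le> ln (real N)"
      proof (cases "k = 0")
        case False
        then have "mangoldt_above L k \<le> ln (real k)" by (intro mangoldt_above_le) auto
        also have "\<dots> \<le> ln (real N)" using k False by simp
        finally show ?thesis using mangoldt_above_nonneg[of L k] by simp
      next
        case True
        \<comment> \<open>every number divides 0, so \<open>mangoldt_above L 0\<close> is a sum over an infinite set, i.e. 0\<close>
        have "infinite {c :: nat. L \<le> c}" using infinite_Ici by (simp add: atLeast_def[symmetric])
        then show ?thesis using True lnN by (simp add: mangoldt_above_def)
      qed
    qed (auto intro: mangoldt_above_eq_0)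
  qed
  finally show ?thesis by (simp add: E_def)
qed

text \<open>With x = ln N and blocks of length about \<open>x ^ 16\<close>, the bilinear part is of
  order N times \<open>x * x ^ 8 / x ^ 16 * x\<close>, a saving of \<open>x ^ 6\<close>, which
  leaves room for the constant in the exponent 5. The factor 2 in the range of \<open>h\<close>
  allows for rounding up the degree \<open>x ^ 4\<close> of the Fejer kernel.\<close>

lemma eventually_norm_mangoldt_Li_sum_le:
  "\<forall>\<^sub>F N in sequentially. \<forall>h::real. 1 \<le> h \<longrightarrow> h \<le> 2 * ln (real N) ^ 4 \<longrightarrow>
     norm (\<Sum>n\<in>{1..N}. mangoldt n * expi (h * Li (real n))) \<le> real N / ln (real N) ^ 5"
proof -
  \<comment> \<open>Majorants depending on \<open>N\<close> alone: rounding up at most doubles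
    \<open>x ^ 16\<close> and \<open>x ^ 76\<close>, so the doubled values and the largest
    \<open>h\<close> are inserted, and in the denominator the unrounded
    \<open>x ^ 16\<close>.\<close>
  define Q where "Q N = 3 + 4 * (2 * ln N ^ 4 * (2 * ln N ^ 76) * (2 * ln N ^ 16) + 2) * (sqrt N * ln N)" for N :: real
  define B where "B N = 2 * ln N ^ 16 * ln N + 2 * ln N ^ 76 * (2 * ln N * Q N) + 2 * ln N ^ 76 * (2 * ln N ^ 16 * (ln N * Q N)) +
     ln N * sqrt (2 * (2 * ln N ^ 16)) * (N / ln N ^ 16) * (1 + ln N)" for N :: real
  have ev: "\<forall>\<^sub>F N in sequentially. B (real N) \<le> real N / ln (real N) ^ 5"
    unfolding B_def Q_def by real_asymp
  have ev2: "\<forall>\<^sub>F N in sequentially. 100 \<le> ln (real N)" by real_asymp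
  have ev3: "\<forall>\<^sub>F N in sequentially. 2 * ln (real N) ^ 76 \<le> real N" by real_asymp
  show ?thesis
    using ev ev2 ev3
  proof eventually_elim
    case (elim N)
    show ?case
    proof (intro allI impI)
      fix h :: real assume h: "1 \<le> h" "h \<le> 2 * ln (real N) ^ 4"
      define x where "x = ln (real N)"
      have x: "100 \<le> x" using elim by (simp add: x_def)
      define L where "L = nat \<lceil>x ^ 16\<rceil>"
      define V where "V = nat \<lceil>x ^ 76\<rceil>"
      have x1: "1 \<le> x ^ k" for k using x by (intro one_le_power) auto
      have xx: "x \<le> x ^ 16" "x ^ 16 \<le> x ^ 76" using x by (auto intro!: power_increasing self_le_power)
      have L: "x ^ 16 \<le> real L" "real L \<le> 2 * x ^ 16" using x1[of 16] unfolding L_def by linarith+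
      have V: "x ^ 76 \<le> real V" "real V \<le> 2 * x ^ 76" using x1[of 76] unfolding V_def by linarith+
      have V': "1 \<le> V" "V \<le> N" using V x1[of 76] elim(3) by (auto simp: x_def simp flip: of_nat_le_iff)
      have L': "81 \<le> L" "L \<le> N"
      proof -
        have "81 \<le> real L" using L xx x by linarith
        then show "81 \<le> L" by simp
        have "real L \<le> real N" using L xx elim(3) by (simp add: x_def)
        then show "L \<le> N" by simp
      qed
      have h2: "h \<le> 2 * x ^ 4" using h by (simp add: x_def)
      \<comment> \<open>The left side is of order \<open>L * h * L * x * sqrt M\<close>; the
        exponents \<open>16 + 4 + 16 + 1\<close> lead to \<open>98 * x ^ 37 * sqrt M\<close>. As
        \<open>98 <= x\<close>, it suffices that \<open>x ^ 38 <= sqrt M\<close>. This is the origin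
        of 76 and of the threshold 100.\<close>
      have key: "real L * (1 + 4 * (h * real L + 2) * (sqrt (2 * M) * x)) \<le> M" if M: "real V \<le> M" for M
      proof -
        have M1: "x ^ 76 \<le> M" using M V by linarith
        have "x ^ 38 = sqrt (x ^ 76)" using x by (intro real_sqrt_unique[symmetric]) (auto simp flip: power_mult)
        also have "\<dots> \<le> sqrt M" using M1 by (rule real_sqrt_le_mono)
        finally have sM: "x ^ 38 \<le> sqrt M" .
        then have sM1: "1 \<le> sqrt M" using x1[of 38] by linarith
        have "h * real L \<le> (2 * x ^ 4) * (2 * x ^ 16)" using h h2 L x by (intro mult_mono) auto
        also have "\<dots> = 4 * x ^ 20" by (simp flip: power_add)
        finally have hL: "h * real L + 2 \<le> 6 * x ^ 20" using x1[of 20] by linarith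
        have s2: "sqrt (2 * M) \<le> 2 * sqrt M"
        proof -
          have "sqrt (2 * M) \<le> sqrt (4 * M)" using M1 x1[of 76] by (intro real_sqrt_le_mono) auto
          then show ?thesis by (simp add: real_sqrt_mult)
        qed
        have "4 * (h * real L + 2) * (sqrt (2 * M) * x) \<le> 4 * (6 * x ^ 20) * ((2 * sqrt M) * x)"
          using hL s2 h x sM1 by (intro mult_mono) auto
        also have "\<dots> = 48 * (x ^ 21 * sqrt M)" by (simp add: power_Suc eval_nat_numeral mult_ac)
        finally have 1: "4 * (h * real L + 2) * (sqrt (2 * M) * x) \<le> 48 * (x ^ 21 * sqrt M)" .
        have "1 * 1 \<le> x ^ 21 * sqrt M" using x1[of 21] sM1 x by (intro mult_mono) auto
        have M0: "0 \<le> M" using M1 x1[of 76] by linarith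
        have "1 + 4 * (h * real L + 2) * (sqrt (2 * M) * x) \<le> 49 * (x ^ 21 * sqrt M)" using 1 \<open>1 * 1 \<le> x ^ 21 * sqrt M\<close> by linarith
        then have "real L * (1 + 4 * (h * real L + 2) * (sqrt (2 * M) * x)) \<le> (2 * x ^ 16) * (49 * (x ^ 21 * sqrt M))"
          using L x sM1 M0 h by (intro mult_mono add_nonneg_nonneg mult_nonneg_nonneg) auto
        also have "\<dots> = 98 * x ^ 37 * sqrt M" by (simp add: eval_nat_numeral mult_ac)
        also have "\<dots> \<le> x * x ^ 37 * sqrt M" using x sM1 by (intro mult_right_mono) auto
        also have "\<dots> = x ^ 38 * sqrt M" by (simp add: eval_nat_numeral mult_ac)
        also have "\<dots> \<le> sqrt M * sqrt M" using sM sM1 by (intro mult_right_mono) auto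
        also have "\<dots> = M" using M1 x1[of 76] by simp
        finally show ?thesis .
      qed
      define P where "P = 3 + 4 * (h * real V * real L + 2) * (sqrt (real N) * x)"
      have "norm (\<Sum>n\<in>{1..N}. mangoldt n * expi (h * Li (real n))) \<le>
         real L * x + real V * (2 * x * P) + real V * (real L * (x * P)) +
         x * sqrt (2 * real L) * (real N / real L) * (1 + x)"
        unfolding P_def x_def by (rule norm_mangoldt_Li_sum_le[OF h(1) L' V' key[unfolded x_def]])
      also have "\<dots> \<le> B (real N)"
      proof -
        have P0: "0 \<le> P" unfolding P_def using h x by (intro add_nonneg_nonneg mult_nonneg_nonneg) auto
        have PQ: "P \<le> Q (real N)" unfolding P_def Q_def x_def[symmetric]
          using h h2 L V x x1[of 76] x1[of 16]
          by (intro add_left_mono mult_right_mono mult_left_mono add_right_mono mult_mono) auto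
        have "0 < real L * x ^ 16" using L x1[of 16] by (intro mult_pos_pos) linarith+
        then have "real N / real L \<le> real N / x ^ 16" using L x1[of 16] by (intro divide_left_mono) auto
        then show ?thesis
          unfolding B_def x_def[symmetric] using L V PQ P0 x
          by (intro add_mono mult_mono mult_right_mono real_sqrt_le_mono mult_nonneg_nonneg) auto
      qed
      also have "\<dots> \<le> real N / ln (real N) ^ 5" by (rule elim)
      finally show "norm (\<Sum>n\<in>{1..N}. mangoldt n * expi (h * Li (real n))) \<le> real N / ln (real N) ^ 5" .
    qed
  qed
qed

section \<open>Detecting integers with the Fejer kernel\<close>

definition fejer :: "nat \<Rightarrow> real \<Rightarrow> real" where
  "fejer H s = 1 + 2 * (\<Sum>k\<in>{1..<H}. (1 - real k / real H) * cos (2 * pi * real k * s))"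

text \<open>When the square is expanded, a difference \<open>k\<close> of two exponents occurs
  \<open>H - k\<close> times in each direction. The induction adds one exponential at a time, which
  meets the \<open>n\<close> earlier ones at the differences from 1 to \<open>n\<close>.\<close>

lemma fejer_conv_norm:
  assumes "0 < H"
  shows "fejer H s = (norm (\<Sum>j<H. expi (real j * s)))\<^sup>2 / real H"
proof -
  define c where "c k = cos (2 * pi * real k * s)" for k :: nat
  have G: "real n + 2 * (\<Sum>k\<in>{1..<n}. (real n - real k) * c k) = (norm (\<Sum>j<n. expi (real j * s)))\<^sup>2" for n
  proof (induction n)
    case (Suc n)
    define D where "D = (\<Sum>j<n. expi (real j * s))"
    have "(norm (D + expi (real n * s)))\<^sup>2 = (norm D)\<^sup>2 + 1 + 2 * Re (expi (real n * s) * cnj D)"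
    proof -
      have "(norm (expi (real n * s)))\<^sup>2 = 1" by simp
      then have "(Re (expi (real n * s)))\<^sup>2 + (Im (expi (real n * s)))\<^sup>2 = 1" by (simp only: cmod_power2)
      then show ?thesis unfolding cmod_power2 by (simp add: power2_eq_square algebra_simps)
    qed
    also have "Re (expi (real n * s) * cnj D) = (\<Sum>j<n. c (n - j))"
    proof -
      have "expi (real n * s) * cnj D = (\<Sum>j<n. expi (real n * s) * cnj (expi (real j * s)))"
        by (simp add: D_def sum_distrib_left)
      also have "\<dots> = (\<Sum>j<n. expi (real (n - j) * s))"
        by (intro sum.cong refl) (simp add: expi_add[symmetric] expi_uminus[symmetric] of_nat_diff algebra_simps)
      finally show ?thesis by (simp add: c_def expi_def mult_ac)
    qed
    also have "(\<Sum>j<n. c (n - j)) = (\<Sum>k\<in>{1..<Suc n}. c k)"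
      by (rule sum.reindex_bij_witness[of _ "\<lambda>k. n - k" "\<lambda>j. n - j"]) auto
    finally have 1: "(norm (\<Sum>j<Suc n. expi (real j * s)))\<^sup>2 = (norm D)\<^sup>2 + 1 + 2 * (\<Sum>k\<in>{1..<Suc n}. c k)"
      by (simp add: D_def)
    have "(\<Sum>k\<in>{1..<Suc n}. (real (Suc n) - real k) * c k) = (\<Sum>k\<in>{1..<Suc n}. (real n - real k) * c k) + (\<Sum>k\<in>{1..<Suc n}. c k)"
      by (simp add: sum.distrib[symmetric] algebra_simps)
    also have "(\<Sum>k\<in>{1..<Suc n}. (real n - real k) * c k) = (\<Sum>k\<in>{1..<n}. (real n - real k) * c k)"
      by (cases "n = 0") (auto simp: atLeastLessThanSuc)
    finally show ?case using Suc 1 by (simp add: D_def)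
  qed simp
  have "(\<Sum>k\<in>{1..<H}. (1 - real k / real H) * c k) * real H = (\<Sum>k\<in>{1..<H}. (real H - real k) * c k)"
    unfolding sum_distrib_right using assms by (intro sum.cong refl) (simp add: field_simps)
  then have "fejer H s * real H = real H + 2 * (\<Sum>k\<in>{1..<H}. (real H - real k) * c k)"
    unfolding fejer_def c_def by (simp add: ring_distribs)
  then show ?thesis using G[of H] assms by (simp add: field_simps)
qed

lemma fejer_nonneg: "0 < H \<Longrightarrow> 0 \<le> fejer H s"
  by (simp add: fejer_conv_norm)

text \<open>The geometric sum has norm at most \<open>2 / norm (1 - expi s)\<close>, and at distance
  at least \<eta> from the integers this denominator is at least \<open>4 * \<eta>\<close>.\<close>

lemma fejer_le:
  assumes H: "0 < H" and \<eta>: "0 < \<eta>" and s: "of_int m + \<eta> \<le> s" "s \<le> of_int m + 1 - \<eta>"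
  shows "fejer H s \<le> 1 / (4 * real H * \<eta>\<^sup>2)"
proof -
  define D where "D = (\<Sum>j<H. expi (real j * s))"
  have "D * (1 - expi s) = 1 - expi (real H * s)"
    unfolding D_def
  proof (induction H)
    case (Suc H)
    have "expi (real (Suc H) * s) = expi (real H * s) * expi s"
      by (simp add: expi_add[symmetric] distrib_right add.commute)
    moreover have "(\<Sum>j<Suc H. expi (real j * s)) * (1 - expi s) =
       (\<Sum>j<H. expi (real j * s)) * (1 - expi s) + expi (real H * s) * (1 - expi s)"
      by (simp add: distrib_right)
    ultimately show ?case unfolding Suc by (simp add: right_diff_distrib)
  qed (simp add: expi_def)
  moreover have "norm (1 - expi (real H * s)) \<le> 2"
    using norm_triangle_ineq4[of 1 "expi (real H * s)"] by simp
  ultimately have "norm D * norm (1 - expi s) \<le> 2" by (metis norm_mult)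
  moreover have "4 * \<eta> \<le> norm (1 - expi s)"
  proof -
    have "2 * \<eta> \<le> sin (pi * (s - of_int m))" using s by (intro sin_pi_ge_dist \<eta>) auto
    then have "4 * \<eta> \<le> norm (1 - expi (s - of_int m))"
      unfolding norm_one_minus_expi by linarith
    then show ?thesis by (simp add: expi_diff_int)
  qed
  ultimately have "norm D * (4 * \<eta>) \<le> 2"
    by (meson mult_left_mono norm_ge_zero order_trans)
  then have "norm D \<le> 1 / (2 * \<eta>)" using \<eta> by (simp add: field_simps)
  then have "(norm D)\<^sup>2 \<le> (1 / (2 * \<eta>))\<^sup>2" by (intro power_mono) auto
  then have "(norm D)\<^sup>2 / real H \<le> (1 / (2 * \<eta>))\<^sup>2 / real H" by (intro divide_right_mono) auto
  also have "\<dots> = 1 / (4 * real H * \<eta>\<^sup>2)" by (simp add: power_divide power_mult_distrib mult_ac)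
  finally show ?thesis using H by (simp add: fejer_conv_norm D_def)
qed

lemma continuous_on_fejer: "continuous_on A (\<lambda>s. fejer H (s + \<theta>))"
  unfolding fejer_def by (intro continuous_intros)

lemma integrable_fejer: "(\<lambda>s. fejer H (s + \<theta>)) integrable_on {a..b}"
  by (intro integrable_continuous_real continuous_on_fejer)

lemma integral_fejer: "integral {a..a+1} (\<lambda>s. fejer H (s + \<theta>)) = 1"
proof -
  define F where "F s = s + 2 * (\<Sum>k\<in>{1..<H}. (1 - real k / real H) * (sin (2 * pi * real k * (s + \<theta>)) / (2 * pi * real k)))" for s
  have "((\<lambda>s. fejer H (s + \<theta>)) has_integral F (a + 1) - F a) {a..a+1}"
  proof (rule fundamental_theorem_of_calculus)
    fix x
    have "(F has_real_derivative fejer H (x + \<theta>)) (at x)"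
    proof -
      have "((\<lambda>s. (1 - real k / real H) * (sin (2 * pi * real k * (s + \<theta>)) / (2 * pi * real k))) has_real_derivative
         (1 - real k / real H) * cos (2 * pi * real k * (x + \<theta>))) (at x)" if "k \<in> {1..<H}" for k
        by (rule DERIV_cmult) (use that in \<open>auto intro!: derivative_eq_intros\<close>)
      from DERIV_add[OF DERIV_ident DERIV_cmult[OF DERIV_sum[OF this]]]
      show ?thesis unfolding F_def fejer_def .
    qed
    then show "(F has_vector_derivative fejer H (x + \<theta>)) (at x within {a..a+1})"
      by (simp add: has_real_derivative_iff_has_vector_derivative has_vector_derivative_at_within)
  qed simp
  moreover have "F (a + 1) - F a = 1"
  proof -
    have "sin (2 * pi * real k * (a + 1 + \<theta>)) = sin (2 * pi * real k * (a + \<theta>))" for k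
    proof -
      have "2 * pi * real k * (a + 1 + \<theta>) = 2 * pi * real k * (a + \<theta>) + 2 * pi * of_int (int k)"
        by (simp add: algebra_simps)
      also have "sin \<dots> = sin (2 * pi * real k * (a + \<theta>))"
        by (simp only: sin_add sin_int_2pin cos_int_2pin mult_zero_right add_0_right mult_1_right)
      finally show ?thesis .
    qed
    then show ?thesis by (simp add: F_def)
  qed
  ultimately show ?thesis by (simp add: integral_unique)
qed

lemma integral_fejer_subset_le:
  assumes "0 < H" "{c..d} \<subseteq> {a..b}"
  shows "integral {c..d} (\<lambda>s. fejer H (s + \<theta>)) \<le> integral {a..b} (\<lambda>s. fejer H (s + \<theta>))"
  using assms by (intro integral_subset_le integrable_fejer ballI fejer_nonneg)

lemma integral_fejer_le:
  assumes "0 < H" "0 < \<eta>" "c \<le> d" "d - c \<le> l"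
    and "\<And>s. c \<le> s \<Longrightarrow> s \<le> d \<Longrightarrow> \<exists>m::int. of_int m + \<eta> \<le> s + \<theta> \<and> s + \<theta> \<le> of_int m + 1 - \<eta>"
  shows "integral {c..d} (\<lambda>s. fejer H (s + \<theta>)) \<le> 1 / (4 * real H * \<eta>\<^sup>2) * l"
proof -
  have "integral {c..d} (\<lambda>s. fejer H (s + \<theta>)) \<le> integral {c..d} (\<lambda>_. 1 / (4 * real H * \<eta>\<^sup>2))"
  proof (intro integral_le integrable_fejer)
    fix s assume "s \<in> {c..d}"
    then obtain m :: int where "of_int m + \<eta> \<le> s + \<theta>" "s + \<theta> \<le> of_int m + 1 - \<eta>"
      using assms(5)[of s] by auto
    then show "fejer H (s + \<theta>) \<le> 1 / (4 * real H * \<eta>\<^sup>2)" by (rule fejer_le[OF assms(1,2)])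
  qed auto
  also have "\<dots> = (1 / (4 * real H * \<eta>\<^sup>2)) * (d - c)" using assms(3) by simp
  also have "\<dots> \<le> (1 / (4 * real H * \<eta>\<^sup>2)) * l" using assms by (intro mult_left_mono) auto
  finally show ?thesis .
qed

text \<open>In a full period beginning at \<open>m - \<theta> - \<eta>\<close>, the part within
  \<eta> of \<open>m - \<theta>\<close> lies in the window; on the rest \<open>s + \<theta>\<close>
  keeps distance \<eta> from the integers, so it carries little mass.\<close>

lemma integral_fejer_ge:
  assumes H: "0 < H" and \<eta>: "0 < \<eta>" "\<eta> \<le> 1/2" and m: "\<theta> \<le> of_int m" "of_int m < \<theta> + \<delta>"
  shows "1 - 1 / (4 * real H * \<eta>\<^sup>2) \<le> integral {-\<eta>..\<delta>+\<eta>} (\<lambda>s. fejer H (s + \<theta>))"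
proof -
  define t where "t = of_int m - \<theta>"
  have t: "0 \<le> t" "t < \<delta>" using m by (auto simp: t_def)
  have "1 = integral {t-\<eta>..t-\<eta>+1} (\<lambda>s. fejer H (s + \<theta>))" by (rule integral_fejer[symmetric])
  also have "\<dots> = integral {t-\<eta>..t+\<eta>} (\<lambda>s. fejer H (s + \<theta>)) + integral {t+\<eta>..t-\<eta>+1} (\<lambda>s. fejer H (s + \<theta>))"
    using \<eta> by (intro Henstock_Kurzweil_Integration.integral_combine[symmetric] integrable_fejer) auto
  also have "integral {t-\<eta>..t+\<eta>} (\<lambda>s. fejer H (s + \<theta>)) \<le> integral {-\<eta>..\<delta>+\<eta>} (\<lambda>s. fejer H (s + \<theta>))"
    using t by (intro integral_fejer_subset_le H) auto
  also have "integral {t+\<eta>..t-\<eta>+1} (\<lambda>s. fejer H (s + \<theta>)) \<le> 1 / (4 * real H * \<eta>\<^sup>2) * 1"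
    using \<eta> by (intro integral_fejer_le H exI[of _ m]) (auto simp: t_def)
  finally show ?thesis by simp
qed

text \<open>The constant term of the kernel reproduces the total weight. Each of the fewer than
  \<open>H\<close> other frequencies has a coefficient at most 2 and enters only through a sum
  bounded by \<open>S\<close>; the shift \<open>s\<close> merely rotates that sum.\<close>

lemma weighted_fejer_sum:
  fixes w \<theta> :: "nat \<Rightarrow> real"
  assumes S: "\<And>k. 1 \<le> k \<Longrightarrow> k < H \<Longrightarrow> norm (\<Sum>n\<in>A. w n * expi (real k * \<theta> n)) \<le> S" and "0 \<le> S"
  shows "\<bar>(\<Sum>n\<in>A. w n * fejer H (s + \<theta> n)) - (\<Sum>n\<in>A. w n)\<bar> \<le> 2 * real H * S"
proof -
  have "(\<Sum>n\<in>A. w n * fejer H (s + \<theta> n)) - (\<Sum>n\<in>A. w n) =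
     (\<Sum>n\<in>A. \<Sum>k\<in>{1..<H}. 2 * (1 - real k / real H) * (w n * cos (2 * pi * real k * (s + \<theta> n))))"
    unfolding sum_subtractf[symmetric] fejer_def
    by (intro sum.cong refl) (simp add: sum_distrib_left algebra_simps)
  also have "\<dots> = (\<Sum>k\<in>{1..<H}. \<Sum>n\<in>A. 2 * (1 - real k / real H) * (w n * cos (2 * pi * real k * (s + \<theta> n))))"
    by (rule sum.swap)
  also have "\<dots> = (\<Sum>k\<in>{1..<H}. 2 * (1 - real k / real H) * Re (expi (real k * s) * (\<Sum>n\<in>A. w n * expi (real k * \<theta> n))))"
  proof (intro sum.cong refl)
    fix k
    have "expi (real k * s) * (\<Sum>n\<in>A. w n * expi (real k * \<theta> n)) = (\<Sum>n\<in>A. w n * expi (real k * (s + \<theta> n)))"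
      unfolding sum_distrib_left by (intro sum.cong refl) (simp add: distrib_left expi_add)
    then show "(\<Sum>n\<in>A. 2 * (1 - real k / real H) * (w n * cos (2 * pi * real k * (s + \<theta> n)))) =
       2 * (1 - real k / real H) * Re (expi (real k * s) * (\<Sum>n\<in>A. w n * expi (real k * \<theta> n)))"
      unfolding sum_distrib_left[symmetric] by (simp add: expi_def mult.assoc)
  qed
  also have "\<bar>\<dots>\<bar> \<le> (\<Sum>k\<in>{1..<H}. 2 * S)"
  proof (intro order.trans[OF sum_abs] sum_mono)
    fix k assume k: "k \<in> {1..<H}"
    have "\<bar>Re (expi (real k * s) * (\<Sum>n\<in>A. w n * expi (real k * \<theta> n)))\<bar> \<le> S"
      using order.trans[OF abs_Re_le_cmod[of "expi (real k * s) * (\<Sum>n\<in>A. w n * expi (real k * \<theta> n))"]] S[of k] k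
      by (simp add: norm_mult)
    moreover have "\<bar>2 * (1 - real k / real H)\<bar> \<le> 2" using k by (auto simp: field_simps)
    ultimately show "\<bar>2 * (1 - real k / real H) * Re (expi (real k * s) * (\<Sum>n\<in>A. w n * expi (real k * \<theta> n)))\<bar> \<le> 2 * S"
      unfolding abs_mult by (intro mult_mono) auto
  qed
  also have "\<dots> \<le> 2 * real H * S" using assms(2) by (simp add: mult_right_mono)
  finally show ?thesis .
qed

lemma integral_weighted_fejer_sum:
  fixes w \<theta> :: "nat \<Rightarrow> real"
  assumes "finite A" "c \<le> d"
    and S: "\<And>k. 1 \<le> k \<Longrightarrow> k < H \<Longrightarrow> norm (\<Sum>n\<in>A. w n * expi (real k * \<theta> n)) \<le> S" and "0 \<le> S"
  shows "\<bar>(\<Sum>n\<in>A. w n * integral {c..d} (\<lambda>s. fejer H (s + \<theta> n))) - (d - c) * (\<Sum>n\<in>A. w n)\<bar> \<le> (d - c) * (2 * real H * S)"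
proof -
  define f where "f s = (\<Sum>n\<in>A. w n * fejer H (s + \<theta> n)) - (\<Sum>n\<in>A. w n)" for s
  have int: "(\<lambda>s. \<Sum>n\<in>A. w n * fejer H (s + \<theta> n)) integrable_on {c..d}"
    by (intro integrable_sum integrable_on_mult_right integrable_fejer assms)
  have "integral {c..d} f = (\<Sum>n\<in>A. w n * integral {c..d} (\<lambda>s. fejer H (s + \<theta> n))) - (d - c) * (\<Sum>n\<in>A. w n)"
    unfolding f_def using assms(2) int
    by (subst integral_diff)
       (auto simp: assms(1) intro!: trans[OF integral_sum] integrable_on_mult_right integrable_fejer)
  moreover have "norm (integral {c..d} f) \<le> (2 * real H * S) * (d - c)"
    using weighted_fejer_sum[where H = H and A = A and w = w and \<theta> = \<theta> and S = S] S assms(4) assms(2)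
    by (intro integral_bound) (auto simp: f_def intro!: continuous_intros continuous_on_fejer)
  ultimately show ?thesis by (simp add: mult.commute)
qed

text \<open>The window is widened by \<eta> on both sides, so that each counted \<open>n\<close> has
  kernel mass close to 1 in it; for the other \<open>n\<close> nonnegativity suffices.\<close>

lemma sum_weights_near_int_le:
  fixes w \<theta> :: "nat \<Rightarrow> real"
  assumes A: "finite A" and H: "0 < H" and \<eta>: "0 < \<eta>" "\<eta> \<le> 1/2" and \<delta>: "0 \<le> \<delta>" and w: "\<And>n. n \<in> A \<Longrightarrow> 0 \<le> w n"
    and S: "\<And>k. 1 \<le> k \<Longrightarrow> k < H \<Longrightarrow> norm (\<Sum>n\<in>A. w n * expi (real k * \<theta> n)) \<le> S" and S0: "0 \<le> S"
  shows "(1 - 1 / (4 * real H * \<eta>\<^sup>2)) * (\<Sum>n | n \<in> A \<and> (\<exists>m::int. \<theta> n \<le> of_int m \<and> of_int m < \<theta> n + \<delta>). w n)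
     \<le> (\<delta> + 2 * \<eta>) * ((\<Sum>n\<in>A. w n) + 2 * real H * S)"
proof -
  let ?B = "{n. n \<in> A \<and> (\<exists>m::int. \<theta> n \<le> of_int m \<and> of_int m < \<theta> n + \<delta>)}"
  let ?I = "\<lambda>n. integral {-\<eta>..\<delta>+\<eta>} (\<lambda>s. fejer H (s + \<theta> n))"
  have I0: "0 \<le> ?I n" for n by (intro integral_nonneg integrable_fejer fejer_nonneg H)
  have "(1 - 1 / (4 * real H * \<eta>\<^sup>2)) * (\<Sum>n\<in>?B. w n) = (\<Sum>n\<in>?B. w n * (1 - 1 / (4 * real H * \<eta>\<^sup>2)))"
    by (simp add: sum_distrib_left mult.commute)
  also have "\<dots> \<le> (\<Sum>n\<in>?B. w n * ?I n)"
    using w integral_fejer_ge[OF H \<eta>] by (intro sum_mono mult_left_mono) auto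
  also have "\<dots> \<le> (\<Sum>n\<in>A. w n * ?I n)"
    using A w I0 by (intro sum_mono2) auto
  also have "\<dots> \<le> (\<delta> + \<eta> - - \<eta>) * (\<Sum>n\<in>A. w n) + (\<delta> + \<eta> - - \<eta>) * (2 * real H * S)"
  proof -
    have "\<bar>(\<Sum>n\<in>A. w n * ?I n) - (\<delta> + \<eta> - - \<eta>) * (\<Sum>n\<in>A. w n)\<bar> \<le> (\<delta> + \<eta> - - \<eta>) * (2 * real H * S)"
      using \<delta> \<eta> by (intro integral_weighted_fejer_sum A S S0) auto
    then show ?thesis by linarith
  qed
  finally show ?thesis by (simp add: algebra_simps)
qed

text \<open>Here the window is narrowed by \<eta> on both sides. A counted \<open>n\<close> has
  kernel mass at most 1 in it, and for any other \<open>n\<close> the whole window stays \<eta> away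
  from the integers, which costs the last term.\<close>

lemma sum_weights_near_int_ge:
  fixes w \<theta> :: "nat \<Rightarrow> real"
  assumes A: "finite A" and H: "0 < H" and \<eta>: "0 < \<eta>" "2 * \<eta> \<le> \<delta>" and \<delta>: "\<delta> \<le> 1" and w: "\<And>n. n \<in> A \<Longrightarrow> 0 \<le> w n"
    and S: "\<And>k. 1 \<le> k \<Longrightarrow> k < H \<Longrightarrow> norm (\<Sum>n\<in>A. w n * expi (real k * \<theta> n)) \<le> S" and S0: "0 \<le> S"
  shows "(\<delta> - 2 * \<eta>) * ((\<Sum>n\<in>A. w n) - 2 * real H * S)
     \<le> (\<Sum>n | n \<in> A \<and> (\<exists>m::int. \<theta> n \<le> of_int m \<and> of_int m < \<theta> n + \<delta>). w n) + 1 / (4 * real H * \<eta>\<^sup>2) * \<delta> * (\<Sum>n\<in>A. w n)"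
proof -
  let ?P = "\<lambda>n. \<exists>m::int. \<theta> n \<le> of_int m \<and> of_int m < \<theta> n + \<delta>"
  let ?I = "\<lambda>n. integral {\<eta>..\<delta>-\<eta>} (\<lambda>s. fejer H (s + \<theta> n))"
  define \<kappa> where "\<kappa> = 1 / (4 * real H * \<eta>\<^sup>2)"
  have \<kappa>0: "0 \<le> \<kappa>" by (simp add: \<kappa>_def)
  have "(\<delta> - 2 * \<eta>) * ((\<Sum>n\<in>A. w n) - 2 * real H * S) = (\<delta> - \<eta> - \<eta>) * (\<Sum>n\<in>A. w n) - (\<delta> - \<eta> - \<eta>) * (2 * real H * S)"
    by (simp add: algebra_simps)
  also have "\<dots> \<le> (\<Sum>n\<in>A. w n * ?I n)"
  proof -
    have "\<bar>(\<Sum>n\<in>A. w n * ?I n) - (\<delta> - \<eta> - \<eta>) * (\<Sum>n\<in>A. w n)\<bar> \<le> (\<delta> - \<eta> - \<eta>) * (2 * real H * S)"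
      using \<delta> \<eta> by (intro integral_weighted_fejer_sum A S S0) auto
    then show ?thesis by linarith
  qed
  also have "\<dots> \<le> (\<Sum>n\<in>A. (if ?P n then w n else 0) + \<kappa> * \<delta> * w n)"
  proof (intro sum_mono)
    fix n assume n: "n \<in> A"
    show "w n * ?I n \<le> (if ?P n then w n else 0) + \<kappa> * \<delta> * w n"
    proof (cases "?P n")
      case True
      have "?I n \<le> integral {\<eta>..\<eta>+1} (\<lambda>s. fejer H (s + \<theta> n))"
        using \<delta> \<eta> by (intro integral_fejer_subset_le H) auto
      also have "\<dots> = 1" by (rule integral_fejer)
      finally have "w n * ?I n \<le> w n * 1" using w[OF n] by (intro mult_left_mono) auto
      moreover have "0 \<le> \<kappa> * \<delta> * w n" using \<kappa>0 \<eta> w[OF n] by auto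
      ultimately show ?thesis using True by simp
    next
      case False
      have "?I n \<le> \<kappa> * \<delta>" unfolding \<kappa>_def
      proof (intro integral_fejer_le H)
        fix s assume s: "\<eta> \<le> s" "s \<le> \<delta> - \<eta>"
        \<comment> \<open>The largest integer below \<open>\<theta> n\<close>. Since no integer lies
          in the half-open interval from \<open>\<theta> n\<close> to
          \<open>\<theta> n + \<delta>\<close>, that interval ends no later than
          \<open>m + 1\<close>.\<close>
        define m where "m = \<lceil>\<theta> n\<rceil> - 1"
        have "\<theta> n \<le> of_int \<lceil>\<theta> n\<rceil>" by simp
        then have "\<theta> n + \<delta> \<le> of_int \<lceil>\<theta> n\<rceil>" using False by (meson not_le)
        moreover have "of_int m < \<theta> n" unfolding m_def by linarith
        ultimately have "of_int m + \<eta> \<le> s + \<theta> n \<and> s + \<theta> n \<le> of_int m + 1 - \<eta>"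
          using s by (simp add: m_def)
        then show "\<exists>m::int. of_int m + \<eta> \<le> s + \<theta> n \<and> s + \<theta> n \<le> of_int m + 1 - \<eta>" ..
      qed (use \<eta> in auto)
      then have "w n * ?I n \<le> w n * (\<kappa> * \<delta>)" using w[OF n] by (intro mult_left_mono) auto
      then show ?thesis unfolding if_not_P[OF False] by (simp add: mult.commute)
    qed
  qed
  also have "\<dots> = (\<Sum>n | n \<in> A \<and> ?P n. w n) + \<kappa> * \<delta> * (\<Sum>n\<in>A. w n)"
    using A by (simp add: sum.distrib sum_distrib_left sum.inter_filter)
  finally show ?thesis by (simp add: \<kappa>_def)
qed

section \<open>The zeta function near the line Re s = 1\<close>

lemma holomorphic_suminf:
  fixes f :: "nat \<Rightarrow> complex \<Rightarrow> complex"
  assumes S: "open S" and f: "\<And>n. f n holomorphic_on S"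
    and dom: "\<And>x. x \<in> S \<Longrightarrow> \<exists>d h. 0 < d \<and> summable h \<and> (\<forall>n. \<forall>y\<in>ball x d \<inter> S. norm (f n y) \<le> h n)"
  shows "(\<lambda>s. \<Sum>n. f n s) holomorphic_on S"
    and "\<And>x. x \<in> S \<Longrightarrow> (\<lambda>n. deriv (f n) x) sums deriv (\<lambda>s. \<Sum>n. f n s) x"
proof -
  have "\<exists>g g'. \<forall>x\<in>S. ((\<lambda>n. f n x) sums g x) \<and> ((\<lambda>n. deriv (f n) x) sums g' x) \<and> (g has_field_derivative g' x) (at x)"
  proof (rule series_and_derivative_comparison_local[OF S])
    show "(f n has_field_derivative deriv (f n) x) (at x)" if "x \<in> S" for n x
      using holomorphic_derivI[OF f S that] by simp
    fix x assume "x \<in> S"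
    then obtain d h where "0 < d" "summable h" "\<forall>n. \<forall>y\<in>ball x d \<inter> S. norm (f n y) \<le> h n"
      using dom[of x] by blast
    then show "\<exists>d h. 0 < d \<and> summable h \<and> (\<forall>\<^sub>F n in sequentially. \<forall>y\<in>ball x d \<inter> S. norm (f n y) \<le> h n)"
      by (intro exI[of _ d] exI[of _ h]) auto
  qed
  then obtain g g' where g: "\<And>x. x \<in> S \<Longrightarrow> (\<lambda>n. f n x) sums g x" "\<And>x. x \<in> S \<Longrightarrow> (\<lambda>n. deriv (f n) x) sums g' x"
    "\<And>x. x \<in> S \<Longrightarrow> (g has_field_derivative g' x) (at x)"
    by blast
  have D: "((\<lambda>s. \<Sum>n. f n s) has_field_derivative g' x) (at x)" if x: "x \<in> S" for x
    using g(3)[OF x] S x by (rule has_field_derivative_transform_within_open) (use g(1) sums_unique in blast)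
  show "(\<lambda>s. \<Sum>n. f n s) holomorphic_on S"
    using D S by (auto simp: holomorphic_on_open)
  show "(\<lambda>n. deriv (f n) x) sums deriv (\<lambda>s. \<Sum>n. f n s) x" if "x \<in> S" for x
    using g(2)[OF that] DERIV_imp_deriv[OF D[OF that]] by simp
qed

lemma summable_Suc_powr:
  assumes "0 < b" shows "summable (\<lambda>n. real (Suc n) powr (-1 - b))"
proof -
  have "summable (\<lambda>n. real n powr (-1 - b))"
    using assms by (subst summable_real_powr_iff) simp
  then show ?thesis by (rule summable_Suc_iff[of "\<lambda>n. real n powr (-1 - b)", THEN iffD2])
qed

lemma norm_Suc_powr: "norm (of_nat (Suc n) powr s :: complex) = real (Suc n) powr Re s"
  by (subst norm_powr_real_powr) (auto simp: Reals_of_nat simp del: of_nat_Suc)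

definition zeta_term :: "nat \<Rightarrow> complex \<Rightarrow> complex" where
  "zeta_term n s = (s - 1) * of_nat (Suc n) powr (-s) - of_nat (Suc n) powr (1 - s) + of_nat (Suc (Suc n)) powr (1 - s)"

text \<open>The term is the increment of \<open>G\<close> from \<open>m\<close> to
  \<open>m + 1\<close>, and \<open>G\<close> has derivative
  \<open>(s - 1) * (m powr (-s) - z powr (-s))\<close>. Applying the derivative bound once more to
  this difference of powers gains the decay of order \<open>-1 - Re s\<close>.\<close>

lemma norm_zeta_term_le:
  assumes s: "0 \<le> Re s"
  shows "norm (zeta_term n s) \<le> norm (s - 1) * norm s * real (Suc n) powr (-1 - Re s)"
proof -
  define m where "m = complex_of_nat (Suc n)"
  define sg where "sg = closed_segment m (m + 1)"
  have cs: "convex sg" by (simp add: sg_def)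
  have seg: "\<exists>u. 0 \<le> u \<and> u \<le> 1 \<and> z = of_real (real (Suc n) + u)" if "z \<in> sg" for z
    using that unfolding sg_def m_def by (auto simp: in_segment scaleR_conv_of_real algebra_simps intro!: exI)
  have nr: "z \<notin> \<real>\<^sub>\<le>\<^sub>0" if "z \<in> sg" for z
  proof -
    from seg[OF that] obtain u where u: "0 \<le> u" "z = of_real (real (Suc n) + u)" by blast
    then have "Re z > 0" by simp
    then show ?thesis by (auto simp: complex_nonpos_Reals_iff)
  qed
  have msg: "m \<in> sg" "m + 1 \<in> sg" unfolding sg_def by (rule ends_in_segment)+
  have inner: "norm (m powr (-s) - z powr (-s)) \<le> norm s * real (Suc n) powr (-1 - Re s)" if z: "z \<in> sg" for z
  proof -
    have "norm (m powr (-s) - z powr (-s)) \<le> (norm s * real (Suc n) powr (-1 - Re s)) * norm (m - z)"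
    proof (rule field_differentiable_bound[OF cs _ _ msg(1) z])
      fix w assume w: "w \<in> sg"
      show "((\<lambda>w. w powr (-s)) has_field_derivative (-s) * w powr (-s - 1)) (at w within sg)"
        using has_field_derivative_powr[OF nr[OF w]] by (rule has_field_derivative_at_within)
      from seg[OF w] obtain u where u: "0 \<le> u" "w = of_real (real (Suc n) + u)" by blast
      have "norm (w powr (-s - 1)) = Re w powr Re (-s - 1)"
        by (rule norm_powr_real_powr) (use u in \<open>simp_all del: of_nat_Suc\<close>)
      also have "Re w = real (Suc n) + u" using u by simp
      also have "Re (-s - 1) = -1 - Re s" by simp
      also have "(real (Suc n) + u) powr (-1 - Re s) \<le> real (Suc n) powr (-1 - Re s)" using u s by (intro powr_mono2') auto
      finally show "norm ((-s) * w powr (-s - 1)) \<le> norm s * real (Suc n) powr (-1 - Re s)"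
        by (simp add: norm_mult mult_left_mono)
    qed
    also have "\<dots> \<le> (norm s * real (Suc n) powr (-1 - Re s)) * 1"
    proof (rule mult_left_mono)
      from seg[OF z] obtain u where u: "0 \<le> u" "u \<le> 1" "z = of_real (real (Suc n) + u)" by blast
      have "m - z = - of_real u" using u by (simp add: m_def del: of_nat_Suc)
      then have "norm (m - z) = \<bar>u\<bar>" by (simp only: norm_minus_cancel norm_of_real)
      then show "norm (m - z) \<le> 1" using u by simp
    qed simp
    finally show ?thesis by simp
  qed
  define G where "G z = (s - 1) * m powr (-s) * z + z powr (1 - s)" for z
  have "norm (G (m + 1) - G m) \<le> (norm (s - 1) * (norm s * real (Suc n) powr (-1 - Re s))) * norm (m + 1 - m)"
  proof (rule field_differentiable_bound[OF cs _ _ msg(2,1)])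
    fix z assume z: "z \<in> sg"
    have "((\<lambda>w. w powr (1 - s)) has_field_derivative (1 - s) * z powr (1 - s - 1)) (at z within sg)"
      using has_field_derivative_powr[OF nr[OF z]] by (rule has_field_derivative_at_within)
    from DERIV_add[OF DERIV_cmult[OF DERIV_ident, of "(s - 1) * m powr (-s)"] this]
    show "(G has_field_derivative (s - 1) * (m powr (-s) - z powr (-s))) (at z within sg)"
      unfolding G_def by (rule DERIV_cong) (simp add: algebra_simps)
    show "norm ((s - 1) * (m powr (-s) - z powr (-s))) \<le> norm (s - 1) * (norm s * real (Suc n) powr (-1 - Re s))"
      unfolding norm_mult by (intro mult_left_mono inner z) auto
  qed
  moreover have "G (m + 1) - G m = zeta_term n s"
    by (simp add: G_def zeta_term_def m_def algebra_simps)
  ultimately show ?thesis by (simp add: mult.assoc)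
qed

text \<open>
  This is \<open>(s - 1) \<zeta>(s)\<close>: multiplying the series of \<open>n powr -s - integral {n..n+1} (\<lambda>x. x powr -s)\<close> by
  \<open>s - 1\<close> makes every term entire, so there is no removable singularity to treat at \<open>s = 1\<close>.
\<close>

definition zeta_reg :: "complex \<Rightarrow> complex" where
  "zeta_reg s = 1 + (\<Sum>n. zeta_term n s)"

lemma open_Re_gt: "open {s. a < Re s}"
  by (simp add: open_halfspace_Re_gt)

lemma ball_Re_norm:
  assumes "y \<in> ball x d"
  shows "Re x - d \<le> Re y" "norm y \<le> norm x + d"
proof -
  have *: "norm (x - y) < d" using assms by (simp add: dist_norm)
  show "Re x - d \<le> Re y" using abs_Re_le_cmod[of "x - y"] * by simp
  show "norm y \<le> norm x + d" using norm_triangle_ineq2[of y x] * by (simp add: norm_minus_commute)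
qed

lemma zeta_term_dominated:
  assumes x: "0 < Re x"
  obtains d h where "0 < d" "summable h" "\<And>n y. y \<in> ball x d \<Longrightarrow> norm (zeta_term n y) \<le> h n"
proof
  define d where "d = Re x / 2"
  define h where "h n = (norm x + d + 1)\<^sup>2 * real (Suc n) powr (-1 - d)" for n
  show d: "0 < d" using x by (simp add: d_def)
  show "summable h" unfolding h_def using d by (intro summable_mult summable_Suc_powr)
  fix n y assume y: "y \<in> ball x d"
  have ry: "d \<le> Re y" "norm y \<le> norm x + d" using ball_Re_norm[OF y] by (auto simp: d_def)
  have "norm (zeta_term n y) \<le> norm (y - 1) * norm y * real (Suc n) powr (-1 - Re y)"
    using ry d by (intro norm_zeta_term_le) auto
  also have "\<dots> \<le> (norm x + d + 1) * (norm x + d + 1) * real (Suc n) powr (-1 - d)"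
  proof (intro mult_mono)
    show "norm (y - 1) \<le> norm x + d + 1" using norm_triangle_ineq4[of y 1] ry by simp
    show "real (Suc n) powr (-1 - Re y) \<le> real (Suc n) powr (-1 - d)" using ry by (intro powr_mono) auto
  qed (use ry d in auto)
  finally show "norm (zeta_term n y) \<le> h n" by (simp add: h_def power2_eq_square)
qed

lemma holomorphic_zeta_term: "zeta_term n holomorphic_on A"
  unfolding zeta_term_def by (intro holomorphic_intros)

lemma holomorphic_zeta_reg: "zeta_reg holomorphic_on {s. 0 < Re s}"
proof -
  have "(\<lambda>s. \<Sum>n. zeta_term n s) holomorphic_on {s. 0 < Re s}"
  proof (rule holomorphic_suminf(1)[OF open_Re_gt holomorphic_zeta_term])
    fix x :: complex assume "x \<in> {s. 0 < Re s}"
    then obtain d h where "0 < d" "summable h" "\<And>n y. y \<in> ball x d \<Longrightarrow> norm (zeta_term n y) \<le> h n"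
      using zeta_term_dominated[of x] by auto
    then show "\<exists>d h. 0 < d \<and> summable h \<and> (\<forall>n. \<forall>y\<in>ball x d \<inter> {s. 0 < Re s}. norm (zeta_term n y) \<le> h n)"
      by blast
  qed
  then show ?thesis unfolding zeta_reg_def[abs_def] by (intro holomorphic_intros)
qed

lemma zeta_reg_1: "zeta_reg 1 = 1"
proof -
  have "zeta_term n 1 = 0" for n by (simp add: zeta_term_def powr_0 del: of_nat_Suc)
  then show ?thesis by (simp add: zeta_reg_def)
qed

section \<open>Dirichlet series with logarithmically bounded coefficients\<close>

definition dirichlet_sum :: "(nat \<Rightarrow> real) \<Rightarrow> complex \<Rightarrow> complex" where
  "dirichlet_sum a s = (\<Sum>n. of_real (a (Suc n)) * of_nat (Suc n) powr (-s))"

text \<open>A common growth condition for the coefficient sequences 1, \<open>mu\<close>,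
  \<open>mangoldt\<close> and \<open>ln\<close>. It gives absolute convergence for Re s > 1, so that
  one product lemma serves all of them.\<close>

definition log_bounded :: "(nat \<Rightarrow> real) \<Rightarrow> bool" where
  "log_bounded a \<longleftrightarrow> (\<forall>n\<ge>1. \<bar>a n\<bar> \<le> 1 + ln (real n))"

lemma norm_dirichlet_term_le:
  assumes a: "log_bounded a" and e: "0 < e" and s: "1 + 2 * e \<le> Re s"
  shows "norm (of_real (a (Suc n)) * of_nat (Suc n) powr (-s) :: complex) \<le> (1 + 1 / e) * real (Suc n) powr (-1 - e)"
proof -
  define x where "x = real (Suc n)"
  have x: "1 \<le> x" by (simp add: x_def)
  have "ln x \<le> x powr e / e" using x e by (rule ln_powr_bound)
  moreover have "1 \<le> x powr e" using x e by (simp add: ge_one_powr_ge_zero)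
  ultimately have "1 + ln x \<le> (1 + 1 / e) * x powr e" by (simp add: distrib_right)
  moreover have "\<bar>a (Suc n)\<bar> \<le> 1 + ln x"
    using a[unfolded log_bounded_def, rule_format, of "Suc n"] by (simp add: x_def)
  ultimately have 1: "\<bar>a (Suc n)\<bar> \<le> (1 + 1 / e) * x powr e" by linarith
  have "norm (of_real (a (Suc n)) * of_nat (Suc n) powr (-s) :: complex) = \<bar>a (Suc n)\<bar> * x powr (- Re s)"
    by (simp add: norm_mult norm_Suc_powr x_def del: of_nat_Suc)
  also have "\<dots> \<le> ((1 + 1 / e) * x powr e) * x powr (- 1 - 2 * e)"
    using 1 x s e by (intro mult_mono powr_mono) auto
  also have "\<dots> = (1 + 1 / e) * (x powr e * x powr (- 1 - 2 * e))" by simp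
  also have "x powr e * x powr (- 1 - 2 * e) = x powr (e + (- 1 - 2 * e))" by (simp only: powr_add)
  also have "e + (- 1 - 2 * e) = -1 - e" by simp
  finally show ?thesis by (simp add: x_def)
qed

lemma summable_norm_dirichlet:
  assumes "log_bounded a" "1 < Re s"
  shows "summable (\<lambda>n. norm (of_real (a (Suc n)) * of_nat (Suc n) powr (-s) :: complex))"
proof (rule summable_comparison_test')
  define e where "e = (Re s - 1) / 2"
  have e: "0 < e" using assms by (simp add: e_def)
  show "summable (\<lambda>n. (1 + 1 / e) * real (Suc n) powr (-1 - e))"
    by (intro summable_mult summable_Suc_powr e)
  show "norm (norm (of_real (a (Suc n)) * of_nat (Suc n) powr (-s) :: complex)) \<le> (1 + 1 / e) * real (Suc n) powr (-1 - e)"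
    if "n \<ge> 0" for n
    using norm_dirichlet_term_le[OF assms(1) e, of s n] by (simp add: e_def field_simps)
qed

lemma sums_dirichlet:
  assumes "log_bounded a" "1 < Re s"
  shows "(\<lambda>n. of_real (a (Suc n)) * of_nat (Suc n) powr (-s)) sums dirichlet_sum a s"
  unfolding dirichlet_sum_def
  by (rule summable_sums, rule summable_norm_cancel, rule summable_norm_dirichlet[OF assms])

lemma dirichlet_has_sum:
  assumes "log_bounded a" "1 < Re s"
  shows "((\<lambda>n. of_real (a n) * of_nat n powr (-s)) has_sum dirichlet_sum a s) {1..}"
    and "(\<lambda>n. norm (of_real (a n) * of_nat n powr (-s) :: complex)) summable_on {1..}"
proof -
  have b: "bij_betw Suc UNIV {1..}"
    by (rule bij_betwI[where g = "\<lambda>n. n - 1"]) auto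
  have "((\<lambda>n. of_real (a (Suc n)) * of_nat (Suc n) powr (-s)) has_sum dirichlet_sum a s) UNIV"
    by (rule norm_summable_imp_has_sum[OF summable_norm_dirichlet sums_dirichlet]) (use assms in auto)
  then show "((\<lambda>n. of_real (a n) * of_nat n powr (-s)) has_sum dirichlet_sum a s) {1..}"
    by (subst (asm) has_sum_reindex_bij_betw[OF b])
  have "(\<lambda>n. norm (of_real (a (Suc n)) * of_nat (Suc n) powr (-s) :: complex)) summable_on UNIV"
    using summable_norm_dirichlet[OF assms] by (subst summable_on_UNIV_nonneg_real_iff) auto
  then show "(\<lambda>n. norm (of_real (a n) * of_nat n powr (-s) :: complex)) summable_on {1..}"
    by (subst (asm) summable_on_reindex_bij_betw[OF b])
qed

text \<open>Absolute convergence makes the products summable over all pairs, so they may be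
  regrouped along \<open>n = d * m\<close>. Unordered sums carry out the regrouping, and the result
  is turned back into an ordinary series at the end.\<close>

lemma dirichlet_sum_mult:
  assumes a: "log_bounded a" and b: "log_bounded b" and s: "1 < Re s"
    and c: "\<And>n. 1 \<le> n \<Longrightarrow> c n = (\<Sum>d | d dvd n. a d * b (n div d))"
  shows "dirichlet_sum a s * dirichlet_sum b s = dirichlet_sum c s"
proof -
  define f where "f n = complex_of_real (a n) * of_nat n powr (-s)" for n
  define g where "g n = complex_of_real (b n) * of_nat n powr (-s)" for n
  define A where "A = {1::nat..}"
  have f: "(f has_sum dirichlet_sum a s) A" "(\<lambda>x. norm (f x)) summable_on A"
    using dirichlet_has_sum[OF a s] by (simp_all add: f_def[abs_def] A_def)
  have g: "(g has_sum dirichlet_sum b s) A" "(\<lambda>x. norm (g x)) summable_on A"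
    using dirichlet_has_sum[OF b s] by (simp_all add: g_def[abs_def] A_def)
  define h where "h p = f (fst p) * g (snd p)" for p
  have "(\<lambda>p. norm (h p)) summable_on A \<times> A"
  proof (rule summable_on_SigmaI[where g = "\<lambda>x. norm (f x) * infsum (\<lambda>y. norm (g y)) A"])
    show "((\<lambda>y. norm (h (x, y))) has_sum norm (f x) * infsum (\<lambda>y. norm (g y)) A) A" for x
      using has_sum_cmult_right[OF has_sum_infsum[OF g(2)], of "norm (f x)"] by (simp add: h_def norm_mult)
    show "(\<lambda>x. norm (f x) * infsum (\<lambda>y. norm (g y)) A) summable_on A"
      by (rule summable_on_cmult_left[OF f(2)])
  qed auto
  then have "h summable_on A \<times> A" by (rule abs_summable_summable)
  then have "(\<lambda>(x, y). f x * g y) summable_on A \<times> A" by (simp add: h_def[abs_def] case_prod_unfold)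
  then obtain T where T: "((\<lambda>(x, y). f x * g y) has_sum T) (A \<times> A)"
    unfolding summable_on_def by blast
  have "((\<lambda>y. (\<lambda>(x, y). f x * g y) (x, y)) has_sum f x * dirichlet_sum b s) A" for x
    unfolding prod.case by (rule has_sum_cmult_right[OF g(1)])
  from has_sum_SigmaD[OF T this] have "((\<lambda>x. f x * dirichlet_sum b s) has_sum T) A" .
  moreover have "((\<lambda>x. f x * dirichlet_sum b s) has_sum dirichlet_sum a s * dirichlet_sum b s) A"
    by (rule has_sum_cmult_left[OF f(1)])
  ultimately have TT: "T = dirichlet_sum a s * dirichlet_sum b s" by (rule has_sum_unique)
  have bij: "bij_betw (\<lambda>(n, d). (d, n div d)) (SIGMA n:A. {d. d dvd n}) (A \<times> A)"
  proof (rule bij_betwI[where g = "\<lambda>(d, m). (d * m, d)"])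
    have *: "d \<in> A \<and> n div d \<in> A" if "n \<in> A" "d dvd n" for n d
    proof -
      from that(2) obtain m where "n = d * m" by (rule dvdE)
      then show ?thesis using that(1) by (cases "d = 0") (simp_all add: A_def)
    qed
    show "(\<lambda>(n, d). (d, n div d)) \<in> (SIGMA n:A. {d. d dvd n}) \<rightarrow> A \<times> A"
    proof (rule funcsetI)
      fix p assume p: "p \<in> (SIGMA n:A. {d. d dvd n})"
      obtain n d where "p = (n, d)" by (cases p)
      then show "(\<lambda>(n, d). (d, n div d)) p \<in> A \<times> A" using p *[of n d] by simp
    qed
    show "(\<lambda>(d, m). (d * m, d)) \<in> A \<times> A \<rightarrow> (SIGMA n:A. {d. d dvd n})"
      by (rule funcsetI) (auto simp: A_def)
    fix p :: "nat \<times> nat"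
    obtain x y where p: "p = (x, y)" by (cases p)
    show "(\<lambda>(d, m). (d * m, d)) ((\<lambda>(n, d). (d, n div d)) p) = p" if "p \<in> (SIGMA n:A. {d. d dvd n})"
      using that by (simp add: p)
    show "(\<lambda>(n, d). (d, n div d)) ((\<lambda>(d, m). (d * m, d)) p) = p" if "p \<in> A \<times> A"
      using that by (simp add: p A_def)
  qed
  have "((\<lambda>(n, d). f d * g (n div d)) has_sum T) (SIGMA n:A. {d. d dvd n})"
  proof -
    have e: "(\<lambda>p. (\<lambda>(x, y). f x * g y) ((\<lambda>(n, d). (d, n div d)) p)) = (\<lambda>(n, d). f d * g (n div d))"
      by (rule ext) (simp split: prod.splits)
    from has_sum_reindex_bij_betw[OF bij, of "\<lambda>(x, y). f x * g y" T, THEN iffD2, OF T]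
    show ?thesis unfolding e .
  qed
  then have "((\<lambda>n. \<Sum>d | d dvd n. f d * g (n div d)) has_sum T) A"
  proof (rule has_sum_SigmaD)
    fix n assume "n \<in> A"
    then have "finite {d. d dvd n}" by (simp add: A_def)
    then show "((\<lambda>d. case (n, d) of (n, d) \<Rightarrow> f d * g (n div d)) has_sum (\<Sum>d | d dvd n. f d * g (n div d))) {d. d dvd n}"
      unfolding prod.case by (rule has_sum_finite)
  qed
  also have "((\<lambda>n. \<Sum>d | d dvd n. f d * g (n div d)) has_sum T) A = ((\<lambda>n. of_real (c n) * of_nat n powr (-s)) has_sum T) A"
  proof (rule has_sum_cong)
    fix n assume n: "n \<in> A"
    have "f d * g (n div d) = of_real (a d * b (n div d)) * of_nat n powr (-s)" if d: "d dvd n" for d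
    proof -
      from d obtain m where m: "n = d * m" by (rule dvdE)
      have "of_nat d powr (-s) * of_nat m powr (-s) = (of_nat n powr (-s) :: complex)"
        unfolding m of_nat_mult by (subst powr_times_real) (auto simp: Reals_of_nat)
      moreover have "n div d = m" using n m by (auto simp: A_def)
      ultimately show ?thesis by (simp add: f_def g_def mult_ac)
    qed
    then show "(\<Sum>d | d dvd n. f d * g (n div d)) = of_real (c n) * of_nat n powr (-s)"
      using n by (simp add: c A_def of_real_sum sum_distrib_right)
  qed
  also have "\<dots> = ((\<lambda>n. of_real (c (Suc n)) * of_nat (Suc n) powr (-s)) has_sum T) UNIV"
    unfolding A_def
    by (rule has_sum_reindex_bij_betw[symmetric], rule bij_betwI[where g = "\<lambda>n. n - 1"]) auto
  finally have "(\<lambda>n. of_real (c (Suc n)) * of_nat (Suc n) powr (-s)) sums T"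
    by (rule has_sum_imp_sums)
  then have "dirichlet_sum c s = T" unfolding dirichlet_sum_def by (rule sums_unique[symmetric])
  then show ?thesis using TT by simp
qed

lemma log_bounded_const: "log_bounded (\<lambda>_. 1)"
  by (simp add: log_bounded_def)

lemma log_bounded_mu: "log_bounded mu"
  unfolding log_bounded_def
proof (intro allI impI)
  fix n :: nat assume "1 \<le> n"
  then have "0 \<le> ln (real n)" by simp
  then show "\<bar>mu n\<bar> \<le> 1 + ln (real n)" using abs_mu_le[of n] by linarith
qed

lemma log_bounded_mangoldt: "log_bounded mangoldt"
  unfolding log_bounded_def
proof (intro allI impI)
  fix n :: nat assume "1 \<le> n"
  then show "\<bar>mangoldt n :: real\<bar> \<le> 1 + ln (real n)" using mangoldt_le[of n] by simp
qed

lemma log_bounded_ln: "log_bounded (\<lambda>n. ln (real n))"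
  by (simp add: log_bounded_def)

abbreviation zeta :: "complex \<Rightarrow> complex" where
  "zeta \<equiv> dirichlet_sum (\<lambda>_. 1)"

text \<open>The last two summands of \<open>zeta_term\<close> telescope to -1, which cancels the 1
  in \<open>zeta_reg\<close>; what remains is \<open>s - 1\<close> times the series of
  \<open>zeta\<close>.\<close>

lemma zeta_reg_conv_zeta:
  assumes s: "1 < Re s"
  shows "zeta_reg s = (s - 1) * zeta s"
proof -
  have "(\<lambda>n. real (Suc n) powr (1 - Re s)) \<longlonglongrightarrow> 0"
    using s by (intro LIMSEQ_Suc[of "\<lambda>n. real n powr (1 - Re s)"] tendsto_neg_powr filterlim_real_sequentially) auto
  then have "(\<lambda>n. norm (of_nat (Suc n) powr (1 - s) :: complex)) \<longlonglongrightarrow> 0"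
    by (simp add: norm_Suc_powr del: of_nat_Suc)
  then have "(\<lambda>n. of_nat (Suc n) powr (1 - s) :: complex) \<longlonglongrightarrow> 0" by (rule tendsto_norm_zero_cancel)
  from telescope_sums[OF this]
  have "(\<lambda>n. of_nat (Suc (Suc n)) powr (1 - s) - of_nat (Suc n) powr (1 - s) :: complex) sums (- 1)"
    by (simp del: of_nat_Suc add: of_nat_1[unfolded One_nat_def])
  from sums_add[OF sums_mult[OF sums_dirichlet[OF log_bounded_const s], of "s - 1"] this]
  have "(\<lambda>n. zeta_term n s) sums ((s - 1) * zeta s + - 1)"
    by (simp add: zeta_term_def algebra_simps del: of_nat_Suc)
  then show ?thesis by (simp add: zeta_reg_def sums_iff)
qed

text \<open>The Dirichlet series of \<open>mu\<close> is an explicit inverse, because the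
  convolution of \<open>mu\<close> with 1 is the unit sequence.\<close>

lemma zeta_nonzero:
  assumes s: "1 < Re s"
  shows "zeta s \<noteq> 0"
proof -
  have "dirichlet_sum mu s * zeta s = dirichlet_sum (\<lambda>n. if n = 1 then 1 else 0) s"
    by (rule dirichlet_sum_mult[OF log_bounded_mu log_bounded_const s]) (simp add: sum_mu_divisors)
  also have "\<dots> = (\<Sum>n. if n = 0 then 1 else 0)"
    unfolding dirichlet_sum_def by (rule suminf_cong) simp
  also have "\<dots> = 1" using sums_single[of 0 "\<lambda>_. 1 :: complex"] by (simp add: sums_iff)
  finally show ?thesis by auto
qed

lemma deriv_zeta:
  assumes s: "1 < Re s"
  shows "zeta holomorphic_on {s. 1 < Re s}" and "deriv zeta s = - dirichlet_sum (\<lambda>n. ln (real n)) s"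
proof -
  define f where "f n s = complex_of_real 1 * of_nat (Suc n) powr (-s)" for n s
  have eq: "zeta = (\<lambda>s. \<Sum>n. f n s)" unfolding dirichlet_sum_def[abs_def] f_def ..
  have hol: "f n holomorphic_on A" for n A unfolding f_def by (intro holomorphic_intros)
  have dom: "\<exists>d h. 0 < d \<and> summable h \<and> (\<forall>n. \<forall>y\<in>ball x d \<inter> {s. 1 < Re s}. norm (f n y) \<le> h n)"
    if x: "x \<in> {s. 1 < Re s}" for x
  proof -
    define e where "e = (Re x - 1) / 4"
    have e: "0 < e" using x by (simp add: e_def)
    show ?thesis
    proof (intro exI conjI allI ballI)
      show "0 < 2 * e" using e by simp
      show "summable (\<lambda>n. (1 + 1 / e) * real (Suc n) powr (-1 - e))" by (intro summable_mult summable_Suc_powr e)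
      fix n y assume "y \<in> ball x (2 * e) \<inter> {s. 1 < Re s}"
      then have "Re x - 2 * e \<le> Re y" using ball_Re_norm by blast
      then have "1 + 2 * e \<le> Re y" by (simp add: e_def field_simps)
      then show "norm (f n y) \<le> (1 + 1 / e) * real (Suc n) powr (-1 - e)"
        unfolding f_def by (rule norm_dirichlet_term_le[OF log_bounded_const e])
    qed
  qed
  show "zeta holomorphic_on {s. 1 < Re s}"
    unfolding eq by (rule holomorphic_suminf(1)[OF open_Re_gt hol dom])
  have "(\<lambda>n. deriv (f n) s) sums deriv zeta s"
    unfolding eq by (rule holomorphic_suminf(2)[OF open_Re_gt hol dom]) (use s in auto)
  moreover have "deriv (f n) s = - (of_real (ln (real (Suc n))) * of_nat (Suc n) powr (-s))" for n
  proof (rule DERIV_imp_deriv)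
    have "((\<lambda>s. of_nat (Suc n) powr (-s)) has_field_derivative Ln (of_nat (Suc n)) * of_nat (Suc n) powr (-s) * (- 1)) (at s)"
      by (rule DERIV_chain2[where f = "\<lambda>z. of_nat (Suc n) powr z"])
         (auto intro!: has_field_derivative_powr_right derivative_eq_intros simp del: of_nat_Suc)
    moreover have "Ln (of_nat (Suc n)) = of_real (ln (real (Suc n)))"
      using Ln_of_real[of "real (Suc n)"] by simp
    ultimately show "(f n has_field_derivative - (of_real (ln (real (Suc n))) * of_nat (Suc n) powr (-s))) (at s)"
      unfolding f_def[abs_def] by simp
  qed
  ultimately have "(\<lambda>n. - (of_real (ln (real (Suc n))) * of_nat (Suc n) powr (-s))) sums deriv zeta s" by simp
  moreover have "(\<lambda>n. - (of_real (ln (real (Suc n))) * of_nat (Suc n) powr (-s))) sums (- dirichlet_sum (\<lambda>n. ln (real n)) s)"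
    by (intro sums_minus sums_dirichlet[OF log_bounded_ln s])
  ultimately show "deriv zeta s = - dirichlet_sum (\<lambda>n. ln (real n)) s" by (rule sums_unique2)
qed

text \<open>The convolution of \<open>mangoldt\<close> with 1 is \<open>ln\<close>, so the series is
  the negative logarithmic derivative of \<open>zeta\<close>. In terms of \<open>zeta_reg\<close>
  the pole at 1 is split off explicitly, and the rest makes sense at every point with Re s > 0 where
  \<open>zeta_reg\<close> does not vanish.\<close>

lemma dirichlet_sum_mangoldt:
  assumes s: "1 < Re s"
  shows "zeta_reg s \<noteq> 0" and "dirichlet_sum mangoldt s = 1 / (s - 1) - deriv zeta_reg s / zeta_reg s"
proof -
  have s1: "s - 1 \<noteq> 0" using s by auto
  show nz: "zeta_reg s \<noteq> 0" using zeta_reg_conv_zeta[OF s] zeta_nonzero[OF s] s1 by simp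
  have "dirichlet_sum mangoldt s * zeta s = dirichlet_sum (\<lambda>n. ln (real n)) s"
    by (rule dirichlet_sum_mult[OF log_bounded_mangoldt log_bounded_const s])
       (use mangoldt_sum[where 'a = real] in simp)
  then have F: "dirichlet_sum mangoldt s * zeta s = - deriv zeta s" using deriv_zeta(2)[OF s] by simp
  have "(zeta has_field_derivative deriv zeta s) (at s)"
    by (rule holomorphic_derivI[OF deriv_zeta(1)[OF s] open_Re_gt]) (use s in simp)
  from DERIV_mult[OF DERIV_diff[OF DERIV_ident DERIV_const] this]
  have "((\<lambda>s. (s - 1) * zeta s) has_field_derivative zeta s + (s - 1) * deriv zeta s) (at s)"
    by (rule DERIV_cong) simp
  then have "(zeta_reg has_field_derivative zeta s + (s - 1) * deriv zeta s) (at s)"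
    by (rule has_field_derivative_transform_within_open[OF _ open_Re_gt[of 1]]) (use s in \<open>auto simp: zeta_reg_conv_zeta\<close>)
  then have D: "deriv zeta_reg s = zeta s + (s - 1) * deriv zeta s" by (rule DERIV_imp_deriv)
  have "dirichlet_sum mangoldt s = - deriv zeta s / zeta s"
    using F zeta_nonzero[OF s] by (metis nonzero_eq_divide_eq)
  also have "\<dots> = 1 / (s - 1) - (zeta s + (s - 1) * deriv zeta s) / ((s - 1) * zeta s)"
    using s1 zeta_nonzero[OF s] by (simp add: divide_simps)
  finally show "dirichlet_sum mangoldt s = 1 / (s - 1) - deriv zeta_reg s / zeta_reg s"
    unfolding D zeta_reg_conv_zeta[OF s] .
qed

section \<open>Nonvanishing on the line Re s = 1\<close>

text \<open>The limit is the multiplicity of the zero of \<open>f\<close> at \<open>a\<close>, with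
  0 for a nonzero value. This common form allows three points to be treated alike without knowing
  which of them are zeros.\<close>

lemma log_deriv_limit:
  assumes f: "f holomorphic_on S" and S: "open S" "connected S" and a: "a \<in> S" and nc: "\<not> f constant_on S"
  shows "\<exists>m::nat. (f a = 0 \<longrightarrow> 1 \<le> m) \<and>
     ((\<lambda>x. of_real x * (deriv f (a + of_real x) / f (a + of_real x))) \<longlongrightarrow> of_nat m) (at_right 0)"
proof (cases "f a = 0")
  case False
  have c: "isCont (\<lambda>z. deriv f z / f z) a"
    using holomorphic_on_imp_continuous_on[OF f] holomorphic_on_imp_continuous_on[OF holomorphic_deriv[OF f S(1)]] S(1) a False
    by (intro continuous_divide) (auto simp: continuous_on_eq_continuous_at)
  have t: "((\<lambda>x. a + of_real x) \<longlongrightarrow> a + of_real 0) (at_right 0)" by (intro tendsto_intros)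
  have "((\<lambda>x. of_real x * (deriv f (a + of_real x) / f (a + of_real x))) \<longlongrightarrow> of_real 0 * (deriv f a / f a)) (at_right 0)"
    using t by (intro tendsto_mult tendsto_of_real tendsto_ident_at isCont_tendsto_compose[OF c]) auto
  then show ?thesis using False by (intro exI[of _ 0]) auto
next
  case True
  obtain g r n where g: "0 < n" "0 < r" "ball a r \<subseteq> S" "g holomorphic_on ball a r"
      "\<And>w. w \<in> ball a r \<Longrightarrow> f w = (w - a) ^ n * g w" "\<And>w. w \<in> ball a r \<Longrightarrow> g w \<noteq> 0"
    using holomorphic_factor_zero_nonconstant[OF f S a True nc] by metis
  have c: "isCont (\<lambda>z. deriv g z / g z) a"
    using holomorphic_on_imp_continuous_on[OF g(4)] holomorphic_on_imp_continuous_on[OF holomorphic_deriv[OF g(4) open_ball]] g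
    by (intro continuous_divide) (auto simp: continuous_on_eq_continuous_at)
  have t: "((\<lambda>x. a + of_real x) \<longlongrightarrow> a + of_real 0) (at_right 0)" by (intro tendsto_intros)
  have "((\<lambda>x. of_nat n + of_real x * (deriv g (a + of_real x) / g (a + of_real x))) \<longlongrightarrow> of_nat n + of_real 0 * (deriv g a / g a)) (at_right 0)"
    using t by (intro tendsto_add tendsto_const tendsto_mult tendsto_of_real tendsto_ident_at isCont_tendsto_compose[OF c]) auto
  moreover have "\<forall>\<^sub>F x in at_right 0. of_nat n + of_real x * (deriv g (a + of_real x) / g (a + of_real x)) =
      of_real x * (deriv f (a + of_real x) / f (a + of_real x))"
  proof -
    have "\<forall>\<^sub>F x in at_right 0. x \<in> {0<..<r}" using g(2) by (rule eventually_at_right_real)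
    then show ?thesis
    proof eventually_elim
      case (elim x)
      define w where "w = a + of_real x"
      have w: "w \<in> ball a r" "w - a = of_real x" using elim by (auto simp: w_def dist_norm)
      obtain k where k: "n = Suc k" using g(1) by (cases n) auto
      have gd: "(g has_field_derivative deriv g w) (at w)" by (rule holomorphic_derivI[OF g(4) open_ball w(1)])
      have pd: "((\<lambda>w. (w - a) ^ n) has_field_derivative of_nat n * (w - a) ^ k) (at w)"
        by (rule DERIV_cong[OF DERIV_power[OF DERIV_diff[OF DERIV_ident DERIV_const], where n = n]]) (simp add: k)
      have "((\<lambda>w. (w - a) ^ n * g w) has_field_derivative of_nat n * (w - a) ^ k * g w + deriv g w * (w - a) ^ n) (at w)"
        by (rule DERIV_mult[OF pd gd])
      then have "(f has_field_derivative of_nat n * (w - a) ^ k * g w + deriv g w * (w - a) ^ n) (at w)"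
        by (rule has_field_derivative_transform_within_open[OF _ open_ball w(1)]) (simp add: g)
      then have "deriv f w = of_nat n * of_real x ^ k * g w + deriv g w * of_real x ^ n"
        unfolding w(2) by (rule DERIV_imp_deriv)
      moreover have "f w = of_real x ^ n * g w" using g(5)[OF w(1)] w(2) by simp
      ultimately have "of_real x * (deriv f w / f w) = of_nat n + of_real x * (deriv g w / g w)"
        using elim g(6)[OF w(1)] by (simp add: k field_simps)
      then show ?case by (simp add: w_def)
    qed
  qed
  ultimately have "((\<lambda>x. of_real x * (deriv f (a + of_real x) / f (a + of_real x))) \<longlongrightarrow> of_nat n + of_real 0 * (deriv g a / g a)) (at_right 0)"
    by (rule Lim_transform_eventually)
  then show ?thesis using g(1) by (intro exI[of _ n]) auto
qed

lemma Re_dirichlet_term: "Re (of_nat (Suc n) powr - (of_real \<sigma> + \<i> * of_real t)) =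
    real (Suc n) powr (- \<sigma>) * cos (t * ln (real (Suc n)))"
proof -
  have "Ln (of_nat (Suc n)) = of_real (ln (real (Suc n)))"
    using Ln_of_real[of "real (Suc n)"] by simp
  then have "of_nat (Suc n) powr - (of_real \<sigma> + \<i> * of_real t) = exp (- (of_real \<sigma> + \<i> * of_real t) * of_real (ln (real (Suc n))))"
    by (simp add: powr_def del: of_nat_Suc)
  then show ?thesis by (simp add: Re_exp powr_def mult_ac del: of_nat_Suc)
qed

text \<open>Termwise this is \<open>3 + 4 * cos y + cos (2 * y) = 2 * (1 + cos y)\<^sup>2\<close>
  with nonnegative weights.\<close>

lemma mangoldt_three_four_one:
  assumes \<sigma>: "1 < \<sigma>"
  shows "0 \<le> 3 * Re (dirichlet_sum mangoldt (of_real \<sigma>)) + 4 * Re (dirichlet_sum mangoldt (of_real \<sigma> + \<i> * of_real t)) +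
     Re (dirichlet_sum mangoldt (of_real \<sigma> + \<i> * of_real (2 * t)))"
proof -
  have S: "(\<lambda>n. mangoldt (Suc n) * (real (Suc n) powr (- \<sigma>) * cos (\<tau> * ln (real (Suc n))))) sums Re (dirichlet_sum mangoldt (of_real \<sigma> + \<i> * of_real \<tau>))" for \<tau>
  proof -
    have "(\<lambda>n. of_real (mangoldt (Suc n)) * of_nat (Suc n) powr - (of_real \<sigma> + \<i> * of_real \<tau>)) sums dirichlet_sum mangoldt (of_real \<sigma> + \<i> * of_real \<tau>)"
      using \<sigma> by (intro sums_dirichlet log_bounded_mangoldt) simp
    from sums_Re[OF this] have "(\<lambda>n. Re (of_real (mangoldt (Suc n)) * of_nat (Suc n) powr - (of_real \<sigma> + \<i> * of_real \<tau>)))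
        sums Re (dirichlet_sum mangoldt (of_real \<sigma> + \<i> * of_real \<tau>))" .
    moreover have re: "Re (of_real m * z) = m * Re z" for m z by simp
    ultimately show ?thesis unfolding re Re_dirichlet_term by simp
  qed
  have "(\<lambda>n. 3 * (mangoldt (Suc n) * (real (Suc n) powr (- \<sigma>) * cos (0 * ln (real (Suc n)))))
      + 4 * (mangoldt (Suc n) * (real (Suc n) powr (- \<sigma>) * cos (t * ln (real (Suc n)))))
      + mangoldt (Suc n) * (real (Suc n) powr (- \<sigma>) * cos (2 * t * ln (real (Suc n))))) sums
    (3 * Re (dirichlet_sum mangoldt (of_real \<sigma> + \<i> * of_real 0)) + 4 * Re (dirichlet_sum mangoldt (of_real \<sigma> + \<i> * of_real t)) +
     Re (dirichlet_sum mangoldt (of_real \<sigma> + \<i> * of_real (2 * t))))"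
    by (intro sums_add sums_mult S)
  then have "0 \<le> 3 * Re (dirichlet_sum mangoldt (of_real \<sigma> + \<i> * of_real 0)) + 4 * Re (dirichlet_sum mangoldt (of_real \<sigma> + \<i> * of_real t)) +
     Re (dirichlet_sum mangoldt (of_real \<sigma> + \<i> * of_real (2 * t)))"
  proof (rule sums_le[OF _ sums_zero, rotated])
    fix n
    define c where "c = cos (t * ln (real (Suc n)))"
    have c2: "cos (2 * t * ln (real (Suc n))) = 2 * c\<^sup>2 - 1"
      unfolding c_def by (subst cos_double_cos[symmetric]) (simp add: mult.assoc)
    have "3 * (mangoldt (Suc n) * (real (Suc n) powr (- \<sigma>) * cos (0 * ln (real (Suc n)))))
      + 4 * (mangoldt (Suc n) * (real (Suc n) powr (- \<sigma>) * cos (t * ln (real (Suc n)))))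
      + mangoldt (Suc n) * (real (Suc n) powr (- \<sigma>) * cos (2 * t * ln (real (Suc n)))) =
      mangoldt (Suc n) * real (Suc n) powr (- \<sigma>) * (2 * (1 + c)\<^sup>2)"
      unfolding c2 c_def[symmetric] by (simp add: power2_eq_square algebra_simps del: of_nat_Suc)
    then show "0 \<le> 3 * (mangoldt (Suc n) * (real (Suc n) powr (- \<sigma>) * cos (0 * ln (real (Suc n)))))
      + 4 * (mangoldt (Suc n) * (real (Suc n) powr (- \<sigma>) * cos (t * ln (real (Suc n)))))
      + mangoldt (Suc n) * (real (Suc n) powr (- \<sigma>) * cos (2 * t * ln (real (Suc n))))"
      by (simp add: mangoldt_nonneg del: of_nat_Suc)
  qed
  then show ?thesis by simp
qed

text \<open>Multiply the 3-4-1 inequality at real part \<open>1 + x\<close> by \<open>x\<close> and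
  let \<open>x\<close> decrease to 0. The pole at 1 contributes 3, and the multiplicities at 1, 1 +
  i t and 1 + 2 i t are subtracted with weights 3, 4 and 1; a zero at 1 + i t would leave at most 3
  - 4 < 0.\<close>

lemma zeta_reg_nonzero:
  assumes s: "1 \<le> Re s"
  shows "zeta_reg s \<noteq> 0"
proof (cases "1 < Re s")
  case True
  then show ?thesis by (rule dirichlet_sum_mangoldt)
next
  case False
  define t where "t = Im s"
  have s1: "s = 1 + \<i> * of_real t" using False s by (simp add: complex_eq_iff t_def)
  show ?thesis
  proof
    assume zero: "zeta_reg s = 0"
    have t0: "t \<noteq> 0" using zero zeta_reg_1 s1 by auto
    let ?S = "{s. 0 < Re s}"
    have nc: "\<not> zeta_reg constant_on ?S"
    proof
      assume "zeta_reg constant_on ?S"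
      then obtain c where "\<And>x. x \<in> ?S \<Longrightarrow> zeta_reg x = c" by (auto simp: constant_on_def)
      from this[of s] this[of 1] show False using zero zeta_reg_1 s by simp
    qed
    have con: "connected ?S" by (intro convex_connected convex_halfspace_Re_gt)
    have lim: "\<exists>m::nat. (zeta_reg (1 + \<i> * of_real \<tau>) = 0 \<longrightarrow> 1 \<le> m) \<and>
       ((\<lambda>x. x * Re (dirichlet_sum mangoldt (of_real (1 + x) + \<i> * of_real \<tau>))) \<longlongrightarrow> (if \<tau> = 0 then 1 else 0) - real m) (at_right 0)" for \<tau>
    proof -
      define a where "a = 1 + \<i> * complex_of_real \<tau>"
      have "a \<in> ?S" by (simp add: a_def)
      from log_deriv_limit[OF holomorphic_zeta_reg open_Re_gt con this nc]
      obtain m :: nat where m: "zeta_reg a = 0 \<longrightarrow> 1 \<le> m"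
        "((\<lambda>x. of_real x * (deriv zeta_reg (a + of_real x) / zeta_reg (a + of_real x))) \<longlongrightarrow> of_nat m) (at_right 0)"
        by blast
      have L: "((\<lambda>x. of_real x / (\<i> * complex_of_real \<tau> + of_real x)) \<longlongrightarrow> (if \<tau> = 0 then 1 else 0)) (at_right 0)"
      proof (cases "\<tau> = 0")
        case True
        have "\<forall>\<^sub>F x in at_right (0::real). 1 = of_real x / (\<i> * complex_of_real \<tau> + of_real x)"
          using eventually_at_right_less[of 0] by eventually_elim (simp add: True)
        from Lim_transform_eventually[OF tendsto_const this] show ?thesis using True by simp
      next
        case False
        have "((\<lambda>x. of_real x / (\<i> * complex_of_real \<tau> + of_real x)) \<longlongrightarrow> of_real 0 / (\<i> * complex_of_real \<tau> + of_real 0)) (at_right 0)"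
          by (intro tendsto_intros) (use False in simp)
        then show ?thesis using False by simp
      qed
      have "((\<lambda>x. Re (of_real x / (\<i> * complex_of_real \<tau> + of_real x) - of_real x * (deriv zeta_reg (a + of_real x) / zeta_reg (a + of_real x))))
          \<longlongrightarrow> Re ((if \<tau> = 0 then 1 else 0) - of_nat m)) (at_right 0)"
        by (intro tendsto_Re tendsto_diff L m)
      moreover have "\<forall>\<^sub>F x in at_right (0::real). Re (of_real x / (\<i> * complex_of_real \<tau> + of_real x) - of_real x * (deriv zeta_reg (a + of_real x) / zeta_reg (a + of_real x)))
         = x * Re (dirichlet_sum mangoldt (of_real (1 + x) + \<i> * of_real \<tau>))"
        using eventually_at_right_less[of 0]
      proof eventually_elim
        case (elim x)
        have e: "of_real (1 + x) + \<i> * of_real \<tau> = a + of_real x" by (simp add: a_def)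
        have "dirichlet_sum mangoldt (a + of_real x) = 1 / (a + of_real x - 1) - deriv zeta_reg (a + of_real x) / zeta_reg (a + of_real x)"
          by (rule dirichlet_sum_mangoldt) (use elim in \<open>simp add: a_def\<close>)
        also have "a + of_real x - 1 = \<i> * complex_of_real \<tau> + of_real x" by (simp add: a_def)
        finally have "of_real x * dirichlet_sum mangoldt (a + of_real x) =
           of_real x / (\<i> * complex_of_real \<tau> + of_real x) - of_real x * (deriv zeta_reg (a + of_real x) / zeta_reg (a + of_real x))"
          by (simp add: right_diff_distrib)
        then show ?case unfolding e by (metis Re_complex_of_real times_complex.sel(1) Im_complex_of_real mult_zero_left diff_zero)
      qed
      ultimately have "((\<lambda>x. x * Re (dirichlet_sum mangoldt (of_real (1 + x) + \<i> * of_real \<tau>))) \<longlongrightarrow> Re ((if \<tau> = 0 then 1 else 0) - of_nat m)) (at_right 0)"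
        by (rule Lim_transform_eventually)
      moreover have "Re ((if \<tau> = 0 then 1 else 0) - of_nat m) = (if \<tau> = 0 then 1 else 0) - real m" by simp
      ultimately show ?thesis using m(1) by (intro exI[of _ m]) (simp add: a_def)
    qed
    obtain m0 m1 m2 :: nat where m1: "1 \<le> m1" and
      l0: "((\<lambda>x. x * Re (dirichlet_sum mangoldt (of_real (1 + x) + \<i> * of_real 0))) \<longlongrightarrow> 1 - real m0) (at_right 0)" and
      l1: "((\<lambda>x. x * Re (dirichlet_sum mangoldt (of_real (1 + x) + \<i> * of_real t))) \<longlongrightarrow> 0 - real m1) (at_right 0)" and
      l2: "((\<lambda>x. x * Re (dirichlet_sum mangoldt (of_real (1 + x) + \<i> * of_real (2 * t)))) \<longlongrightarrow> 0 - real m2) (at_right 0)"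
      using lim[of 0] lim[of t] lim[of "2 * t"] t0 zero s1 by auto
    have "0 \<le> 3 * (1 - real m0) + 4 * (0 - real m1) + (0 - real m2)"
    proof (rule tendsto_lowerbound)
      show "((\<lambda>x. 3 * (x * Re (dirichlet_sum mangoldt (of_real (1 + x) + \<i> * of_real 0))) + 4 * (x * Re (dirichlet_sum mangoldt (of_real (1 + x) + \<i> * of_real t)))
         + x * Re (dirichlet_sum mangoldt (of_real (1 + x) + \<i> * of_real (2 * t)))) \<longlongrightarrow> 3 * (1 - real m0) + 4 * (0 - real m1) + (0 - real m2)) (at_right 0)"
        by (intro tendsto_add tendsto_mult tendsto_const l0 l1 l2)
      show "\<forall>\<^sub>F x in at_right 0. 0 \<le> 3 * (x * Re (dirichlet_sum mangoldt (of_real (1 + x) + \<i> * of_real 0))) + 4 * (x * Re (dirichlet_sum mangoldt (of_real (1 + x) + \<i> * of_real t)))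
         + x * Re (dirichlet_sum mangoldt (of_real (1 + x) + \<i> * of_real (2 * t)))"
        using eventually_at_right_less[of 0]
      proof eventually_elim
        case (elim x)
        have "0 \<le> x * (3 * Re (dirichlet_sum mangoldt (of_real (1 + x))) + 4 * Re (dirichlet_sum mangoldt (of_real (1 + x) + \<i> * of_real t)) +
          Re (dirichlet_sum mangoldt (of_real (1 + x) + \<i> * of_real (2 * t))))"
          using elim by (intro mult_nonneg_nonneg mangoldt_three_four_one) auto
        then show ?case by (simp add: algebra_simps)
      qed
    qed simp
    then show False using m1 by simp
  qed
qed

section \<open>Newman's Tauberian theorem\<close>

lemma sum_powr_tail_le:
  assumes a: "0 < a" and N: "1 \<le> N"
  shows "(\<Sum>n\<in>{N..<M}. real (Suc n) powr (-1 - a)) \<le> real N powr (-a) / a"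
proof -
  have step: "real (Suc n) powr (-1 - a) \<le> (real n powr (-a) - real (Suc n) powr (-a)) / a" if n: "1 \<le> n" for n
  proof -
    have "\<exists>z. real n < z \<and> z < real (Suc n) \<and> real (Suc n) powr (-a) - real n powr (-a) = (real (Suc n) - real n) * (- a * z powr (- a - 1))"
      using n by (intro MVT2[where f = "\<lambda>x. x powr (-a)" and f' = "\<lambda>x. - a * x powr (-a - 1)"])
        (auto intro!: derivative_eq_intros)
    then obtain z where z: "real n < z" "z < real (Suc n)" "real (Suc n) powr (-a) - real n powr (-a) = - a * z powr (- a - 1)"
      by auto
    have "real (Suc n) powr (-1 - a) \<le> z powr (-1 - a)" using z n a by (intro powr_mono2') auto
    also have "\<dots> = (real n powr (-a) - real (Suc n) powr (-a)) / a"
    proof -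
      have e: "- a - 1 = -1 - a" by simp
      show ?thesis using z(3)[unfolded e] a by (simp add: nonzero_eq_divide_eq mult.commute)
    qed
    finally show ?thesis .
  qed
  have "(\<Sum>n\<in>{N..<M}. real (Suc n) powr (-1 - a)) \<le> (real N powr (-a) - real (max N M) powr (-a)) / a"
  proof (induction M)
    case (Suc M)
    show ?case
    proof (cases "N \<le> M")
      case True
      then show ?thesis using Suc step[of M] N by (simp add: max_def diff_divide_distrib)
    next
      case False
      then show ?thesis by (cases "N = Suc M") (auto simp: max_def)
    qed
  qed simp
  also have "\<dots> \<le> real N powr (-a) / a" using a by (intro divide_right_mono) auto
  finally show ?thesis .
qed

text \<open>The summand decreases for \<open>a <= 1\<close> and increases for \<open>a > 1\<close>,
  so the comparison with the integral differs. In the second case the last summand,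
  \<open>N powr a / N\<close>, is what the term \<open>1 / N\<close> pays for.\<close>

lemma sum_powr_le:
  assumes a: "0 < a" and N: "1 \<le> N"
  shows "(\<Sum>n<N. real (Suc n) powr (a - 1)) \<le> real N powr a * (1 / a + 1 / real N)"
proof -
  have mvt: "\<exists>z. real n < z \<and> z < real (Suc n) \<and> (real (Suc n) powr a - real n powr a) / a = z powr (a - 1)"
    if n: "1 \<le> n" for n
  proof -
    have "\<exists>z. real n < z \<and> z < real (Suc n) \<and> real (Suc n) powr a - real n powr a = (real (Suc n) - real n) * (a * z powr (a - 1))"
      using n by (intro MVT2[where f = "\<lambda>x. x powr a" and f' = "\<lambda>x. a * x powr (a - 1)"])
        (auto intro!: derivative_eq_intros)
    then obtain z where "real n < z" "z < real (Suc n)" "real (Suc n) powr a - real n powr a = a * z powr (a - 1)"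
      by auto
    then show ?thesis using a by (intro exI[of _ z]) auto
  qed
  have NN: "real N powr a * (1 / real N) = real N powr (a - 1)"
    using N by (simp add: powr_diff)
  show ?thesis
  proof (cases "a \<le> 1")
    case True
    have "(\<Sum>n<N. real (Suc n) powr (a - 1)) \<le> real N powr a / a"
    proof (induction N)
      case (Suc n)
      show ?case
      proof (cases "n = 0")
        case True
        then show ?thesis using a \<open>a \<le> 1\<close> by simp
      next
        case False
        then obtain z where z: "real n < z" "z < real (Suc n)" "(real (Suc n) powr a - real n powr a) / a = z powr (a - 1)"
          using mvt[of n] by auto
        have "real (Suc n) powr (a - 1) \<le> z powr (a - 1)" using z \<open>a \<le> 1\<close> False by (intro powr_mono2') auto
        then show ?thesis using Suc z by (simp add: diff_divide_distrib)
      qed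
    qed simp
    also have "\<dots> \<le> real N powr a / a + real N powr (a - 1)" by simp
    finally show ?thesis using NN by (simp add: distrib_left)
  next
    case False
    have "(\<Sum>n<Suc k. real (Suc n) powr (a - 1)) \<le> real (Suc k) powr a / a + real (Suc k) powr (a - 1)" for k
    proof (induction k)
      case (Suc k)
      obtain z where z: "real (Suc k) < z" "z < real (Suc (Suc k))"
        "(real (Suc (Suc k)) powr a - real (Suc k) powr a) / a = z powr (a - 1)"
        using mvt[of "Suc k"] by auto
      have "real (Suc k) powr (a - 1) \<le> z powr (a - 1)" using z False by (intro powr_mono2) auto
      then have "real (Suc k) powr a / a + real (Suc k) powr (a - 1) \<le> real (Suc (Suc k)) powr a / a"
        using z(3) by (simp add: diff_divide_distrib)
      then show ?case using Suc by (subst sum.lessThan_Suc) linarith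
    qed (use a in simp)
    from this[of "N - 1"] show ?thesis using N NN by (simp add: distrib_left)
  qed
qed

text \<open>On the circle \<open>R\<^sup>2 = z * cnj z\<close>, so the kernel equals
  \<open>(z + cnj z) / R\<^sup>2\<close>.\<close>

lemma newman_kernel_norm:
  assumes "norm z = R" "0 < R"
  shows "norm ((1 + z\<^sup>2 / of_real R ^ 2) / z) = 2 * \<bar>Re z\<bar> / R\<^sup>2"
proof -
  have z: "z \<noteq> 0" using assms by auto
  have "of_real R ^ 2 = z * cnj z" using assms by (simp add: complex_norm_square[symmetric])
  then have "(1 + z\<^sup>2 / of_real R ^ 2) / z = (cnj z + z) / of_real R ^ 2"
    using z by (simp add: field_simps power2_eq_square)
  also have "cnj z + z = of_real (2 * Re z)" by (simp add: complex_add_cnj add.commute)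
  finally show ?thesis by (simp add: norm_divide norm_power)
qed

text \<open>
  With \<open>g 0 = 0\<close> the kernel \<open>(1 + z\<^sup>2 / R\<^sup>2) / z\<close> has no pole against \<open>g\<close>, so the contour can run along the
  imaginary axis itself, where one integration by parts gains the factor \<open>1 / ln N\<close>. On the two arcs
  the kernel has norm \<open>2 \<bar>Re z\<bar> / R\<^sup>2\<close>, which cancels the growth of the tail and of the partial sum.
\<close>

lemma newman_bound:
  fixes a :: "nat \<Rightarrow> complex"
  assumes C: "\<And>n. norm (a n) \<le> C" and S: "open S" "{z. 0 \<le> Re z} \<subseteq> S" and g: "g holomorphic_on S" "g 0 = 0"
    and sums: "\<And>z. 0 < Re z \<Longrightarrow> (\<lambda>n. a n * of_nat (Suc n) powr (-1 - z)) sums g z"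
    and R: "0 < R"
  shows "\<exists>K. \<forall>N\<ge>2. 2 * pi * norm (\<Sum>n<N. a n / of_nat (Suc n)) \<le> 4 * pi * C / R + 2 * pi * C / real N + K / ln (real N)"
proof -
  have C0: "0 \<le> C" using C[of 0] norm_ge_zero order_trans by blast
  define h where "h z = (if z = 0 then deriv g 0 else g z / z)" for z
  have h: "h holomorphic_on S"
    by (rule pole_theorem_open_0[OF g(1) S(1), of 0]) (auto simp: h_def g)
  define k where "k z = 1 + z\<^sup>2 / complex_of_real R ^ 2" for z
  have k: "k holomorphic_on A" for A unfolding k_def by (intro holomorphic_intros) (use R in auto)
  define H where "H z = h z * k z" for z
  have H: "H holomorphic_on S" unfolding H_def by (intro holomorphic_intros h k)
  have H': "deriv H holomorphic_on S" by (rule holomorphic_deriv[OF H S(1)])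
  define HP where "HP = {z::complex. 0 \<le> Re z}"
  have cHP: "convex HP" unfolding HP_def by (rule convex_halfspace_Re_ge)
  have HPS: "HP \<subseteq> S" using S by (simp add: HP_def)
  define sg where "sg = closed_segment (- (\<i> * of_real R)) (\<i> * of_real R)"
  have sgHP: "sg \<subseteq> HP" unfolding sg_def
    by (rule closed_segment_subset[OF _ _ cHP]) (auto simp: HP_def)
  have sgre: "Re z = 0" if "z \<in> sg" for z
    using that by (auto simp: sg_def in_segment)
  have csg: "compact sg" by (simp add: sg_def)
  have "sg \<subseteq> S" using sgHP HPS by blast
  then have "compact (H ` sg)" "compact (deriv H ` sg)"
    by (intro compact_continuous_image csg holomorphic_on_imp_continuous_on
       holomorphic_on_subset[OF H] holomorphic_on_subset[OF H']; assumption)+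
  then have "bounded (H ` sg)" "bounded (deriv H ` sg)" by (simp_all add: compact_imp_bounded)
  then obtain M0 M1 where "\<forall>x\<in>H ` sg. norm x \<le> M0" "\<forall>x\<in>deriv H ` sg. norm x \<le> M1"
    unfolding bounded_iff by blast
  then have M: "\<And>z. z \<in> sg \<Longrightarrow> norm (H z) \<le> M0" "\<And>z. z \<in> sg \<Longrightarrow> norm (deriv H z) \<le> M1"
    by simp_all
  have ends: "\<i> * of_real R \<in> sg" "- (\<i> * of_real R) \<in> sg" unfolding sg_def by (rule ends_in_segment)+
  define K where "K = 2 * M0 + M1 * (2 * R)"
  have "2 * pi * norm (\<Sum>n<N. a n / of_nat (Suc n)) \<le> 4 * pi * C / R + 2 * pi * C / real N + K / ln (real N)"
    if N: "2 \<le> N" for N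
  proof -
    define L where "L = ln (real N)"
    have L: "0 < L" using N by (simp add: L_def)
    define G where "G z = H z * exp (of_real L * z)" for z
    have Ghol: "G holomorphic_on S" unfolding G_def by (intro holomorphic_intros H)
    \<comment> \<open>A primitive on the closed half-plane, which is convex, turns the integrals of
      \<open>G\<close> over the segment and over the right arcs into differences of values of
      \<open>P\<close>, so that these contours need not be joined explicitly.\<close>
    obtain P where P: "\<And>x. x \<in> HP \<Longrightarrow> (P has_field_derivative G x) (at x within HP)"
    proof (rule holomorphic_convex_primitive[OF cHP finite.emptyI])
      show "continuous_on HP G" using holomorphic_on_subset[OF Ghol HPS] by (rule holomorphic_on_imp_continuous_on)
      fix x assume "x \<in> interior HP - {}"
      then have "x \<in> S" using HPS interior_subset by blast
      then show "G field_differentiable at x" using Ghol S(1) by (rule holomorphic_on_imp_differentiable_at[rotated 2])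
    qed blast
    define z1 where "z1 = \<i> * complex_of_real R"
    \<comment> \<open>Integration by parts in primitive form: the derivative of \<open>Q\<close>
      carries the factor \<open>1 / L\<close>, and along the imaginary axis the exponential has norm
      1.\<close>
    define Q where "Q z = H z * exp (of_real L * z) / of_real L - P z" for z
    have Q': "(Q has_field_derivative deriv H z * exp (of_real L * z) / of_real L) (at z within sg)" if z: "z \<in> sg" for z
    proof -
      have zS: "z \<in> S" "z \<in> HP" using z sgHP HPS by auto
      have 1: "(H has_field_derivative deriv H z) (at z within sg)"
        using holomorphic_derivI[OF H S(1) zS(1)] by (rule has_field_derivative_at_within)
      have 2: "(P has_field_derivative G z) (at z within sg)"
        using P[OF zS(2)] sgHP by (rule DERIV_subset)
      have 3: "((\<lambda>z. exp (of_real L * z)) has_field_derivative of_real L * exp (of_real L * z)) (at z within sg)"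
        by (auto intro!: derivative_eq_intros)
      from DERIV_diff[OF DERIV_cdivide[OF DERIV_mult[OF 1 3]] 2] show ?thesis unfolding Q_def
        by (rule DERIV_cong) (use L in \<open>simp add: G_def add_divide_distrib\<close>)
    qed
    have Qb: "norm (Q z1 - Q (- z1)) \<le> M1 / L * norm (z1 - (- z1))"
    proof (rule field_differentiable_bound[OF _ Q'])
      fix z assume z: "z \<in> sg"
      have "norm (deriv H z * exp (of_real L * z) / of_real L) = norm (deriv H z) / L"
        using L sgre[OF z] by (simp add: norm_mult norm_divide)
      also have "\<dots> \<le> M1 / L" using M(2)[OF z] L by (intro divide_right_mono) auto
      finally show "norm (deriv H z * exp (of_real L * z) / of_real L) \<le> M1 / L" .
    qed (use ends in \<open>auto simp: sg_def z1_def\<close>)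
    have HL: "norm (H z * exp (of_real L * z) / of_real L) \<le> M0 / L" if z: "z \<in> sg" for z
    proof -
      have "norm (H z * exp (of_real L * z) / of_real L) = norm (H z) / L"
        using L sgre[OF z] by (simp add: norm_mult norm_divide)
      also have "\<dots> \<le> M0 / L" using M(1)[OF z] L by (intro divide_right_mono) auto
      finally show ?thesis .
    qed
    have PP: "norm (P z1 - P (- z1)) \<le> K / L"
    proof -
      define A where "A z = H z * exp (of_real L * z) / of_real L" for z
      have "P z1 - P (- z1) = A z1 - A (- z1) - (Q z1 - Q (- z1))"
        by (simp add: Q_def A_def)
      also have "norm \<dots> \<le> norm (A z1) + norm (A (- z1)) + norm (Q z1 - Q (- z1))"
        by (intro norm_triangle_le_diff add_mono order.refl)
      also have "\<dots> \<le> M0 / L + M0 / L + M1 / L * norm (z1 - (- z1))"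
        unfolding A_def using ends by (intro add_mono HL Qb) (auto simp: z1_def)
      also have "norm (z1 - (- z1)) = 2 * R" using R by (simp add: z1_def norm_mult)
      also have "M0 / L + M0 / L + M1 / L * (2 * R) = K / L" by (simp add: K_def add_divide_distrib)
      finally show ?thesis .
    qed
    define s where "s z = (\<Sum>n<N. a n * of_nat (Suc n) powr (-1 - z))" for z
    have s: "s holomorphic_on A" for A unfolding s_def
      by (intro holomorphic_intros)
    \<comment> \<open>Cauchy's formula over the full circle is applied to the partial sum
      \<open>s\<close>, which is entire; \<open>s\<close> is compared with \<open>g\<close> only on
      the right half.\<close>
    define \<Phi> where "\<Phi> z = s z * exp (of_real L * z) * k z / z" for z
    have "((\<lambda>u. s u * exp (of_real L * u) * k u / (u - 0)) has_contour_integral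
             2 * of_real pi * \<i> * (s 0 * exp (of_real L * 0) * k 0)) (circlepath 0 R)"
      using R by (intro Cauchy_integral_circlepath_simple holomorphic_intros s k) auto
    then have circ: "(\<Phi> has_contour_integral 2 * of_real pi * \<i> * s 0) (part_circlepath 0 R 0 (2 * pi))"
      unfolding \<Phi>_def[abs_def] circlepath_def by (simp add: k_def)
    have cont\<Phi>: "continuous_on (UNIV - {0}) \<Phi>"
      unfolding \<Phi>_def by (intro continuous_intros holomorphic_on_imp_continuous_on s k) auto
    have onsph: "norm z = R" if "z \<in> path_image (part_circlepath 0 R u v)" for z u v
      using path_image_part_circlepath_subset'[of R 0 u v] R that by auto
    have nz: "path_image (part_circlepath 0 R u v) \<subseteq> UNIV - {0}" for u v
      using onsph[of 0 u v] R by auto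
    have int: "\<Phi> contour_integrable_on part_circlepath 0 R u v" for u v
      using continuous_on_subset[OF cont\<Phi> nz] by (rule contour_integrable_continuous_part_circlepath)
    define I where "I u v = contour_integral (part_circlepath 0 R u v) \<Phi>" for u v
    have I: "(\<Phi> has_contour_integral I u v) (part_circlepath 0 R u v)" for u v
      unfolding I_def using int by (rule has_contour_integral_integral)
    have I': "((\<lambda>t. \<Phi> (0 + of_real R * cis t) * of_real R * \<i> * cis t) has_integral I u v) {u..v}" if "u < v" for u v
      using I[of u v] that by (subst (asm) has_contour_integral_part_circlepath_iff) auto
    have "((\<lambda>t. \<Phi> (0 + of_real R * cis t) * of_real R * \<i> * cis t) has_integral I 0 (pi/2) + I (pi/2) (3*pi/2) + I (3*pi/2) (2*pi)) {0..2*pi}"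
      by (rule has_integral_combine[OF _ _ has_integral_combine[OF _ _ I' I'] I']) auto
    then have "(\<Phi> has_contour_integral I 0 (pi/2) + I (pi/2) (3*pi/2) + I (3*pi/2) (2*pi)) (part_circlepath 0 R 0 (2 * pi))"
      by (subst has_contour_integral_part_circlepath_iff) auto
    with circ have total: "2 * of_real pi * \<i> * s 0 = I 0 (pi/2) + I (pi/2) (3*pi/2) + I (3*pi/2) (2*pi)"
      by (rule has_contour_integral_unique)
    have nexp: "norm (exp (of_real L * z)) = real N powr Re z" for z
      using N by (simp add: L_def powr_def mult.commute)
    \<comment> \<open>For \<open>Re z = - b\<close> the main growth of the partial sum is
      \<open>N powr b / b\<close>; the summand \<open>2 * C / (R * N)\<close> comes from the extra
      \<open>1 / N\<close> in \<open>sum_powr_le\<close>, using \<open>b <= R\<close>.\<close>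
    have left: "norm (I (pi/2) (3*pi/2)) \<le> (2 * C / R\<^sup>2 + 2 * C / (R * real N)) * R * \<bar>3*pi/2 - pi/2\<bar>"
      unfolding I_def
    proof (rule contour_integral_bound_part_circlepath[OF int])
      fix z assume z: "z \<in> path_image (part_circlepath 0 R (pi/2) (3*pi/2))"
      have nz: "norm z = R" by (rule onsph[OF z])
      have "\<exists>t. z = of_real R * cis t \<and> pi/2 \<le> t \<and> t \<le> 3*pi/2"
        using z by (subst (asm) path_image_part_circlepath) (auto simp: cis_conv_exp)
      then obtain t where t: "z = of_real R * cis t" "pi/2 \<le> t" "t \<le> 3*pi/2" by auto
      have "cos t = - cos (t - pi)" by simp
      also have "\<dots> \<le> 0" using cos_ge_zero[of "t - pi"] t by simp
      finally have x: "Re z \<le> 0" using R by (simp add: t mult_nonneg_nonpos)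
      show "norm (\<Phi> z) \<le> 2 * C / R\<^sup>2 + 2 * C / (R * real N)"
      proof (cases "Re z = 0")
        case True
        then have "norm (\<Phi> z) = 0"
          using newman_kernel_norm[OF nz R] by (simp add: \<Phi>_def k_def norm_divide norm_mult)
        then show ?thesis using C0 R by simp
      next
        case False
        define b where "b = - Re z"
        have b: "0 < b" "b \<le> R" using False x abs_Re_le_cmod[of z] nz by (auto simp: b_def)
        have "norm (s z) \<le> (\<Sum>n<N. C * real (Suc n) powr (b - 1))"
          unfolding s_def
        proof (rule sum_norm_le)
          fix n assume "n \<in> {..<N}"
          have e: "b - 1 = -1 - Re z" by (simp add: b_def)
          show "norm (a n * of_nat (Suc n) powr (- 1 - z)) \<le> C * real (Suc n) powr (b - 1)"
            unfolding e using C[of n] by (simp add: norm_mult norm_Suc_powr mult_right_mono del: of_nat_Suc)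
        qed
        also have "\<dots> = C * (\<Sum>n<N. real (Suc n) powr (b - 1))" by (simp add: sum_distrib_left)
        also have "\<dots> \<le> C * (real N powr b * (1 / b + 1 / real N))"
          using b C0 N by (intro mult_left_mono sum_powr_le) auto
        finally have ns: "norm (s z) \<le> C * (real N powr b * (1 / b + 1 / real N))" .
        have "norm (\<Phi> z) = norm (s z) * real N powr (- b) * (2 * b / R\<^sup>2)"
        proof -
          have "\<Phi> z = s z * exp (of_real L * z) * (k z / z)" by (simp add: \<Phi>_def)
          moreover have "norm (k z / z) = 2 * b / R\<^sup>2"
            using newman_kernel_norm[OF nz R] x by (simp add: k_def b_def)
          moreover have "- b = Re z" by (simp add: b_def)
          ultimately show ?thesis by (simp only: norm_mult nexp)
        qed
        also have "\<dots> \<le> C * (real N powr b * (1 / b + 1 / real N)) * real N powr (- b) * (2 * b / R\<^sup>2)"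
          using ns b by (intro mult_right_mono) auto
        also have "\<dots> = C * (1 / b + 1 / real N) * (2 * b / R\<^sup>2) * (real N powr b * real N powr (- b))"
          by (simp only: mult_ac)
        also have "real N powr b * real N powr (- b) = 1" using N by (simp flip: powr_add)
        also have "C * (1 / b + 1 / real N) * (2 * b / R\<^sup>2) * 1 = C * (1 / b + 1 / real N) * (2 * b / R\<^sup>2)" by simp
        also have "\<dots> = 2 * C / R\<^sup>2 + 2 * C * b / (R\<^sup>2 * real N)" using b by (simp add: field_simps)
        also have "2 * C * b / (R\<^sup>2 * real N) \<le> 2 * C * R / (R\<^sup>2 * real N)"
          using b C0 by (intro divide_right_mono mult_left_mono) auto
        also have "2 * C * R / (R\<^sup>2 * real N) = 2 * C / (R * real N)" using R by (simp add: power2_eq_square)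
        finally show ?thesis by simp
      qed
    qed (use C0 R in auto)
    \<comment> \<open>Subtracting the difference of \<open>P\<close> removes the contribution of
      \<open>g\<close>, so that only \<open>s - g\<close>, up to sign a tail of the series, is
      estimated on the right arcs.\<close>
    have right: "norm (I u v - (P (of_real R * cis v) - P (of_real R * cis u))) \<le> 2 * C / R\<^sup>2 * R * \<bar>v - u\<bar>"
      if uv: "u \<le> v" and pos: "\<And>t. u \<le> t \<Longrightarrow> t \<le> v \<Longrightarrow> 0 \<le> cos t" for u v
    proof -
      let ?\<gamma> = "part_circlepath 0 R u v"
      have path: "0 \<le> Re z" if z: "z \<in> path_image ?\<gamma>" for z
      proof -
        have "\<exists>t. z = of_real R * cis t \<and> u \<le> t \<and> t \<le> v"
          using z uv by (subst (asm) path_image_part_circlepath) (auto simp: cis_conv_exp)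
        then show ?thesis using pos R by auto
      qed
      have "(G has_contour_integral (P (pathfinish ?\<gamma>) - P (pathstart ?\<gamma>))) ?\<gamma>"
        using path by (intro contour_integral_primitive[OF P]) (auto simp: HP_def)
      then have GI: "(G has_contour_integral (P (of_real R * cis v) - P (of_real R * cis u))) ?\<gamma>"
        by (simp add: cis_conv_exp)
      have dI: "((\<lambda>z. \<Phi> z - G z) has_contour_integral (I u v - (P (of_real R * cis v) - P (of_real R * cis u)))) ?\<gamma>"
        by (rule has_contour_integral_diff[OF I GI])
      have "norm (contour_integral ?\<gamma> (\<lambda>z. \<Phi> z - G z)) \<le> 2 * C / R\<^sup>2 * R * \<bar>v - u\<bar>"
      proof (rule contour_integral_bound_part_circlepath)
        show "(\<lambda>z. \<Phi> z - G z) contour_integrable_on ?\<gamma>" using dI by (auto simp: contour_integrable_on_def)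
        fix z assume z: "z \<in> path_image ?\<gamma>"
        have nz: "norm z = R" by (rule onsph[OF z])
        have z0: "z \<noteq> 0" using nz R by auto
        have x: "0 \<le> Re z" by (rule path[OF z])
        have diff: "\<Phi> z - G z = (s z - g z) * exp (of_real L * z) * (k z / z)"
          using z0 by (simp add: \<Phi>_def G_def H_def h_def field_simps)
        have nk: "norm (k z / z) = 2 * Re z / R\<^sup>2"
          using newman_kernel_norm[OF nz R] x by (simp add: k_def)
        show "norm (\<Phi> z - G z) \<le> 2 * C / R\<^sup>2"
        proof (cases "Re z = 0")
          case True
          then show ?thesis unfolding diff norm_mult nk using C0 by simp
        next
          case False
          define b where "b = Re z"
          have b: "0 < b" using False x by (simp add: b_def)
          have lim: "(\<lambda>M. s z - (\<Sum>n<M. a n * of_nat (Suc n) powr (-1 - z))) \<longlonglongrightarrow> s z - g z"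
            using sums[of z] b by (intro tendsto_diff tendsto_const) (auto simp: sums_def b_def)
          have "norm (s z - g z) \<le> C * (real N powr (-b) / b)"
          proof (rule LIMSEQ_le_const2[OF tendsto_norm[OF lim]], intro exI allI impI)
            fix M assume M: "N \<le> M"
            have "{..<M} = {..<N} \<union> {N..<M}" using M by auto
            moreover have "{..<N} \<inter> {N..<M} = {}" by auto
            ultimately have "s z - (\<Sum>n<M. a n * of_nat (Suc n) powr (-1 - z)) = - (\<Sum>n\<in>{N..<M}. a n * of_nat (Suc n) powr (-1 - z))"
              unfolding s_def by (simp add: sum.union_disjoint)
            also have "norm \<dots> \<le> (\<Sum>n\<in>{N..<M}. C * real (Suc n) powr (-1 - b))"
              unfolding norm_minus_cancel
            proof (rule sum_norm_le)
              fix n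
              show "norm (a n * of_nat (Suc n) powr (- 1 - z)) \<le> C * real (Suc n) powr (-1 - b)"
                using C[of n] by (simp add: norm_mult norm_Suc_powr b_def mult_right_mono del: of_nat_Suc)
            qed
            also have "\<dots> = C * (\<Sum>n\<in>{N..<M}. real (Suc n) powr (-1 - b))" by (simp add: sum_distrib_left)
            also have "\<dots> \<le> C * (real N powr (-b) / b)"
              using b C0 N by (intro mult_left_mono sum_powr_tail_le) auto
            finally show "norm (s z - (\<Sum>n<M. a n * of_nat (Suc n) powr (-1 - z))) \<le> C * (real N powr (-b) / b)" .
          qed
          then have "norm (\<Phi> z - G z) \<le> C * (real N powr (-b) / b) * real N powr b * (2 * b / R\<^sup>2)"
            unfolding diff norm_mult nk nexp b_def[symmetric] using b by (intro mult_right_mono) auto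
          also have "\<dots> = C / b * (2 * b / R\<^sup>2) * (real N powr b * real N powr (- b))"
            by simp
          also have "real N powr b * real N powr (- b) = 1" using N by (simp flip: powr_add)
          also have "C / b * (2 * b / R\<^sup>2) * 1 = 2 * C / R\<^sup>2" using b by simp
          finally show ?thesis .
        qed
      qed (use C0 R in auto)
      then show ?thesis using contour_integral_unique[OF dI] by simp
    qed
    have r1: "norm (I 0 (pi/2) - (P z1 - P (of_real R))) \<le> 2 * C / R\<^sup>2 * R * (pi/2)"
      using right[of 0 "pi/2"] cos_ge_zero by (simp add: z1_def mult.commute)
    have r2: "norm (I (3*pi/2) (2*pi) - (P (of_real R) - P (- z1))) \<le> 2 * C / R\<^sup>2 * R * (pi/2)"
    proof -
      have "0 \<le> cos t" if "3*pi/2 \<le> t" "t \<le> 2*pi" for t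
      proof -
        have "cos t = cos (2*pi - t)" by simp
        then show ?thesis using cos_ge_zero[of "2*pi - t"] that by simp
      qed
      then have *: "norm (I (3*pi/2) (2*pi) - (P (of_real R * cis (2*pi)) - P (of_real R * cis (3*pi/2))))
          \<le> 2 * C / R\<^sup>2 * R * \<bar>2*pi - 3*pi/2\<bar>"
        by (intro right) auto
      have c1: "cis (3*pi/2) = - \<i>"
        using cos_3over2_pi sin_3over2_pi by (auto simp: complex_eq_iff field_simps)
      have c2: "cis (2*pi) = 1" by (simp add: complex_eq_iff)
      have c3: "\<bar>2*pi - 3*pi/2\<bar> = pi/2" "of_real R * - \<i> = - z1" by (simp_all add: z1_def)
      show ?thesis using * unfolding c1 c2 c3 by simp
    qed
    have "2 * pi * norm (s 0) = norm (2 * of_real pi * \<i> * s 0)" by (simp add: norm_mult)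
    \<comment> \<open>The values of \<open>P\<close> at \<open>R\<close> cancel, and only the
      difference between the two ends of the segment remains.\<close>
    also have "2 * of_real pi * \<i> * s 0 = (I 0 (pi/2) - (P z1 - P (of_real R))) + I (pi/2) (3*pi/2) +
         (I (3*pi/2) (2*pi) - (P (of_real R) - P (- z1))) + (P z1 - P (- z1))"
      unfolding total by simp
    also have "norm \<dots> \<le> 2 * C / R\<^sup>2 * R * (pi/2) + (2 * C / R\<^sup>2 + 2 * C / (R * real N)) * R * \<bar>3*pi/2 - pi/2\<bar>
        + 2 * C / R\<^sup>2 * R * (pi/2) + K / L"
      by (intro norm_triangle_le add_mono r1 r2 left PP)
    also have "\<dots> = 4 * pi * C / R + 2 * pi * C / real N + K / L"
      using R N by (simp add: field_simps power2_eq_square)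
    also have "s 0 = (\<Sum>n<N. a n / of_nat (Suc n))"
      unfolding s_def by (intro sum.cong refl) (simp add: powr_minus divide_inverse del: of_nat_Suc)
    finally show ?thesis by (simp add: L_def)
  qed
  then show ?thesis by blast
qed

text \<open>Subtracting \<open>g 0\<close> from the first coefficient makes the function vanish at
  0, as \<open>newman_bound\<close> requires, and shifts the sum by \<open>g 0\<close>. The radius
  \<open>R\<close> is fixed in terms of \<open>e\<close> before \<open>N\<close> tends to infinity,
  since the constant \<open>K\<close> depends on \<open>R\<close>.\<close>

theorem newman_ingham:
  fixes a :: "nat \<Rightarrow> complex"
  assumes C: "\<And>n. norm (a n) \<le> C" and S: "open S" "{z. 0 \<le> Re z} \<subseteq> S" and g: "g holomorphic_on S"
    and sums: "\<And>z. 0 < Re z \<Longrightarrow> (\<lambda>n. a n * of_nat (Suc n) powr (-1 - z)) sums g z"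
  shows "(\<lambda>n. a n / of_nat (Suc n)) sums g 0"
proof -
  define b where "b n = a n - (if n = 0 then g 0 else 0)" for n
  define D where "D = C + norm (g 0)"
  have D: "norm (b n) \<le> D" for n

  proof (cases "n = 0")
    case True
    then show ?thesis using C[of n] norm_triangle_ineq4[of "a n" "g 0"] by (simp add: b_def D_def)
  next
    case False
    then show ?thesis using add_mono[OF C[of n] norm_ge_zero[of "g 0"]] by (simp add: b_def D_def)
  qed
  have D0: "0 \<le> D" using D[of 0] norm_ge_zero order_trans by blast
  have S0: "(\<lambda>n. if n = 0 then g 0 else 0) sums g 0"
    using sums_single[of 0 "\<lambda>_. g 0"] by simp
  have bs: "(\<lambda>n. b n * of_nat (Suc n) powr (-1 - z)) sums (g z - g 0)" if "0 < Re z" for z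
    using sums_diff[OF sums[OF that] S0] by (rule sums_cong[THEN iffD1, rotated]) (simp add: b_def algebra_simps)
  have hol: "(\<lambda>z. g z - g 0) holomorphic_on S" by (intro holomorphic_intros g)
  have "(\<lambda>N. \<Sum>n<N. b n / of_nat (Suc n)) \<longlonglongrightarrow> 0"
  proof (rule LIMSEQ_I)
    fix e :: real assume e: "0 < e"
    \<comment> \<open>With this radius the arc term \<open>4 * pi * D / R\<close> stays below
      \<open>2 * pi * e\<close>; adding 1 keeps \<open>R\<close> positive when
      \<open>D = 0\<close>.\<close>
    define R where "R = 6 * (D + 1) / e"
    have R: "0 < R" using D0 e by (simp add: R_def)
    from newman_bound[OF D S hol _ bs R] obtain K where
      K: "\<And>N. 2 \<le> N \<Longrightarrow> 2 * pi * norm (\<Sum>n<N. b n / of_nat (Suc n)) \<le> 4 * pi * D / R + 2 * pi * D / real N + K / ln (real N)"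
      by auto
    have "(\<lambda>N. 4 * pi * D / R + 2 * pi * D / real N + K / ln (real N)) \<longlonglongrightarrow> 4 * pi * D / R + 0 + 0"
    proof (intro tendsto_add tendsto_const)
      show "(\<lambda>N. 2 * pi * D / real N) \<longlonglongrightarrow> 0" by (rule lim_const_over_n)
      have "filterlim (\<lambda>N. ln (real N)) at_top sequentially"
        by (rule filterlim_compose[OF ln_at_top filterlim_real_sequentially])
      then show "(\<lambda>N. K / ln (real N)) \<longlonglongrightarrow> 0" by (rule real_tendsto_divide_at_top[OF tendsto_const])
    qed
    moreover have "4 * pi * D / R + 0 + 0 < 2 * pi * e"
    proof -
      have "2 * D < 6 * (D + 1)" using D0 by simp
      then have "2 * D / R < e" using e D0 by (simp add: R_def field_simps add_pos_nonneg)
      then have "2 * pi * (2 * D / R) < 2 * pi * e" by (intro mult_strict_left_mono) auto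
      then show ?thesis by (simp add: mult.assoc)
    qed
    ultimately have "\<forall>\<^sub>F N in sequentially. 4 * pi * D / R + 2 * pi * D / real N + K / ln (real N) < 2 * pi * e"
      by (rule order_tendstoD)
    then obtain N0 where N0: "\<And>N. N0 \<le> N \<Longrightarrow> 4 * pi * D / R + 2 * pi * D / real N + K / ln (real N) < 2 * pi * e"
      by (auto simp: eventually_sequentially)
    have "norm ((\<Sum>n<N. b n / of_nat (Suc n)) - 0) < e" if "max 2 N0 \<le> N" for N
    proof -
      have "2 * pi * norm (\<Sum>n<N. b n / of_nat (Suc n)) < 2 * pi * e"
        using that by (intro le_less_trans[OF K N0]) auto
      then have "norm (\<Sum>n<N. b n / of_nat (Suc n)) < e"
        by (subst (asm) mult_less_cancel_left_pos) (use pi_gt_zero in auto)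
      then show ?thesis by simp
    qed
    then show "\<exists>no. \<forall>n\<ge>no. norm ((\<Sum>n<n. b n / of_nat (Suc n)) - 0) < e" by blast
  qed
  then have "(\<lambda>n. b n / of_nat (Suc n)) sums 0" by (simp add: sums_def)
  from sums_add[OF this S0] have "(\<lambda>n. b n / of_nat (Suc n) + (if n = 0 then g 0 else 0)) sums g 0" by simp
  moreover have "(\<lambda>n. b n / of_nat (Suc n) + (if n = 0 then g 0 else 0)) = (\<lambda>n. a n / of_nat (Suc n))"
    by (auto simp: b_def fun_eq_iff)
  ultimately show ?thesis by simp
qed

section \<open>The prime number theorem\<close>

definition psi :: "nat \<Rightarrow> real" where
  "psi n = (\<Sum>k\<in>{1..n}. mangoldt k)"

lemma psi_0 [simp]: "psi 0 = 0"
  by (simp add: psi_def)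

lemma psi_Suc: "psi (Suc n) = psi n + mangoldt (Suc n)"
  by (simp add: psi_def)

lemma psi_mono: "m \<le> n \<Longrightarrow> psi m \<le> psi n"
  unfolding psi_def by (intro sum_mono2) (auto intro: mangoldt_nonneg)

lemma psi_nonneg: "0 \<le> psi n"
  unfolding psi_def by (intro sum_nonneg mangoldt_nonneg)

section \<open>Chebyshev's upper bound\<close>

lemma ln_fact_conv_mangoldt: "ln (fact n) = (\<Sum>d\<in>{1..n}. mangoldt d * real (n div d))"
proof -
  have "ln (fact n :: real) = (\<Sum>k\<in>{1..n}. ln (real k))"
    by (induction n) (simp_all add: ln_mult del: of_nat_Suc)
  also have "\<dots> = (\<Sum>k\<in>{1..n}. \<Sum>d | d dvd k. mangoldt d)"
    using mangoldt_sum[where 'a = real] by (intro sum.cong) auto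
  also have "\<dots> = (\<Sum>d\<in>{1..n}. \<Sum>j\<in>{1..n div d}. mangoldt d)"
    by (rule sum_divisors_swap)
  finally show ?thesis by (simp add: mult.commute)
qed

text \<open>With \<open>m = n div 2\<close>, \<open>ln (fact n) - 2 * ln (fact m)\<close> is the sum
  of \<open>mangoldt d\<close> times \<open>n div d - 2 * (m div d)\<close>, a factor that is never
  negative and at least 1 for \<open>m < d <= n\<close>. The term \<open>ln (m + 1)\<close> accounts
  for odd \<open>n\<close>, where \<open>n - m\<close> is \<open>m + 1\<close>.\<close>

lemma psi_le_half: "psi n \<le> psi (n div 2) + real n * ln 2 + ln (real (n div 2) + 1)"
proof -
  define m where "m = n div 2"
  have m: "m \<le> n" "2 * m \<le> n" "n - m \<le> Suc m" by (auto simp: m_def)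
  have "psi n - psi m = (\<Sum>d\<in>{1..n}. mangoldt d) - (\<Sum>d\<in>{1..n}. if d \<le> m then mangoldt d else 0)"
  proof -
    have "psi m = (\<Sum>d\<in>{1..n}. if d \<le> m then mangoldt d else 0)"
      unfolding psi_def using m by (intro sum.mono_neutral_cong_left) auto
    then show ?thesis by (simp add: psi_def)
  qed
  also have "\<dots> \<le> (\<Sum>d\<in>{1..n}. mangoldt d * real (n div d)) - 2 * (\<Sum>d\<in>{1..n}. mangoldt d * real (m div d))"
    unfolding sum_distrib_left sum_subtractf[symmetric]
  proof (rule sum_mono)
    fix d assume d: "d \<in> {1..n}"
    show "mangoldt d - (if d \<le> m then mangoldt d else 0) \<le> mangoldt d * real (n div d) - 2 * (mangoldt d * real (m div d))"
    proof (cases "d \<le> m")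
      case True
      have "m div d * 2 \<le> n div d"
      proof -
        have "m div d * 2 * d \<le> 2 * m" by simp
        then have "m div d * 2 * d \<le> n" using m by linarith
        then show ?thesis using d by (simp add: less_eq_div_iff_mult_less_eq)
      qed
      then have "2 * real (m div d) \<le> real (n div d)" by linarith
      then have "mangoldt d * (2 * real (m div d)) \<le> mangoldt d * real (n div d)" by (intro mult_left_mono mangoldt_nonneg)
      then show ?thesis using True by simp
    next
      case False
      have "1 \<le> n div d" using d by (simp add: Suc_le_eq div_greater_zero_iff)
      then have "mangoldt d * 1 \<le> mangoldt d * real (n div d)" by (intro mult_left_mono mangoldt_nonneg) simp
      then show ?thesis using False by simp
    qed
  qed
  also have "(\<Sum>d\<in>{1..n}. mangoldt d * real (n div d)) = ln (fact n)" by (rule ln_fact_conv_mangoldt[symmetric])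
  also have "(\<Sum>d\<in>{1..n}. mangoldt d * real (m div d)) = ln (fact m)"
    unfolding ln_fact_conv_mangoldt using m by (intro sum.mono_neutral_right) auto
  also have "ln (fact n) - 2 * ln (fact m :: real) \<le> real n * ln 2 + ln (real m + 1)"
  proof -
    have "(fact (n - m) :: nat) \<le> fact (Suc m)" by (rule fact_mono_nat[OF m(3)])
    then have f: "fact (n - m) \<le> (real m + 1) * fact m"
      by (metis fact_Suc of_nat_Suc of_nat_fact of_nat_le_iff of_nat_mult add.commute)
    have "real (n choose m) \<le> 2 ^ n"
    proof -
      have "n choose m \<le> 2 ^ n" by (rule binomial_le_pow2)
      then show ?thesis by (metis of_nat_le_iff of_nat_numeral of_nat_power)
    qed
    then have "fact m * fact (n - m) * real (n choose m) \<le> fact m * ((real m + 1) * fact m) * 2 ^ n"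
      using f by (intro mult_mono mult_left_mono) auto
    moreover have "fact m * fact (n - m) * real (n choose m) = fact n"
      using binomial_fact_lemma[OF m(1)] by (metis of_nat_fact of_nat_mult)
    ultimately have "fact n \<le> fact m * ((real m + 1) * fact m) * 2 ^ n" by simp
    then have "ln (fact n) \<le> ln (fact m * ((real m + 1) * fact m) * 2 ^ n :: real)"
      by (intro ln_mono) auto
    also have "\<dots> = 2 * ln (fact m) + ln (real m + 1) + real n * ln 2"
      by (simp add: ln_mult ln_realpow add_pos_nonneg)
    finally show ?thesis by simp
  qed
  finally show ?thesis by (simp add: m_def)
qed

text \<open>The recursion is weakened to \<open>psi n <= psi (n div 2) + 2 * n\<close>, for which
  the constant 4 closes the induction: \<open>4 * (n / 2) + 2 * n = 4 * n\<close>.\<close>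

lemma psi_le: "psi n \<le> 4 * real n"
proof (induction n rule: less_induct)
  case (less n)
  show ?case
  proof (cases "n = 0")
    case False
    have "psi n \<le> psi (n div 2) + real n * ln 2 + ln (real (n div 2) + 1)" by (rule psi_le_half)
    also have "psi (n div 2) \<le> 4 * real (n div 2)" using False by (intro less) simp
    also have "4 * real (n div 2) \<le> 2 * real n" by linarith
    also have "real n * ln 2 \<le> real n * 1" using ln_2_less_1 by (intro mult_left_mono) auto
    also have "ln (real (n div 2) + 1) \<le> real (n div 2)" using ln_add_one_self_le_self[of "real (n div 2)"] by (simp add: add.commute)
    also have "real (n div 2) \<le> real n" by simp
    finally show ?thesis by simp
  qed simp
qed

section \<open>Continuation of the error series and passage to psi\<close>

definition psi_err :: "nat \<Rightarrow> real" where
  "psi_err n = psi n - real n"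

lemma abs_psi_err_le: "\<bar>psi_err n\<bar> \<le> 4 * real n"
  using psi_le[of n] psi_nonneg[of n] by (simp add: psi_err_def abs_le_iff)

text \<open>Summation by parts replaces the coefficients \<open>mangoldt n - 1\<close> by their
  partial sums \<open>psi_err n\<close>. By Chebyshev's bound the boundary term is of order
  \<open>K powr (1 - Re s)\<close>.\<close>

lemma sums_psi_err_diff:
  assumes s: "1 < Re s"
  shows "(\<lambda>n. of_real (psi_err (Suc n)) * (of_nat (Suc n) powr (-s) - of_nat (Suc (Suc n)) powr (-s))) sums
     (dirichlet_sum mangoldt s - zeta s)"
proof -
  define e where "e n = complex_of_real (psi_err n)" for n
  have e: "e (Suc n) = e n + of_real (mangoldt (Suc n)) - 1" for n
    by (simp add: e_def psi_err_def psi_Suc)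
  have part: "(\<Sum>n<K. e (Suc n) * (of_nat (Suc n) powr (-s) - of_nat (Suc (Suc n)) powr (-s))) =
     (\<Sum>n<K. of_real (mangoldt (Suc n)) * of_nat (Suc n) powr (-s) - of_real 1 * of_nat (Suc n) powr (-s)) - e K * of_nat (Suc K) powr (-s)" for K
  proof (induction K)
    case (Suc K)
    then show ?case by (simp add: e[of K] algebra_simps del: of_nat_Suc)
  qed (simp add: e_def psi_err_def)
  have "(\<lambda>K. e K * of_nat (Suc K) powr (-s)) \<longlonglongrightarrow> 0"
  proof (rule Lim_null_comparison)
    have "(\<lambda>n. real (Suc n) powr (1 - Re s)) \<longlonglongrightarrow> 0"
      using s by (intro LIMSEQ_Suc[of "\<lambda>n. real n powr (1 - Re s)"] tendsto_neg_powr filterlim_real_sequentially) auto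
    from tendsto_mult[OF tendsto_const this, of 4] show "(\<lambda>n. 4 * real (Suc n) powr (1 - Re s)) \<longlonglongrightarrow> 0" by simp
    show "\<forall>\<^sub>F K in sequentially. norm (e K * of_nat (Suc K) powr (-s)) \<le> 4 * real (Suc K) powr (1 - Re s)"
    proof (intro always_eventually allI)
      fix K
      have "norm (e K * of_nat (Suc K) powr (-s)) = \<bar>psi_err K\<bar> * real (Suc K) powr (- Re s)"
        by (simp add: e_def norm_mult norm_Suc_powr del: of_nat_Suc)
      also have "\<dots> \<le> (4 * real (Suc K)) * real (Suc K) powr (- Re s)"
        using abs_psi_err_le[of K] by (intro mult_right_mono) auto
      also have "real (Suc K) powr (1 - Re s) = real (Suc K) * real (Suc K) powr (- Re s)"
        using powr_add[of "real (Suc K)" 1 "- Re s"] by (simp del: of_nat_Suc)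
      then have "(4 * real (Suc K)) * real (Suc K) powr (- Re s) = 4 * real (Suc K) powr (1 - Re s)"
        by simp
      finally show "norm (e K * of_nat (Suc K) powr (-s)) \<le> 4 * real (Suc K) powr (1 - Re s)" .
    qed
  qed
  from tendsto_diff[OF sums_diff[OF sums_dirichlet[OF log_bounded_mangoldt s] sums_dirichlet[OF log_bounded_const s], unfolded sums_def] this]
  show ?thesis unfolding sums_def part[unfolded e_def] e_def by simp
qed

text \<open>With N for \<open>Suc n\<close>, \<open>zeta_term n (s + 1)\<close> is the gap between s
  N^(-1 - s) and N^(-s) - (N + 1)^(-s). It is of order N^(-2 - Re s), which beats the linear growth
  of \<open>psi_err\<close>, so the correction \<open>W\<close> is holomorphic well beyond the line
  Re s = 1.\<close>

lemma psi_err_zeta_term_sum: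
  defines "W \<equiv> \<lambda>s. \<Sum>n. of_real (psi_err (Suc n)) * zeta_term n (s + 1)"
  shows "W holomorphic_on {s. 0 < Re s}"
    and "0 < Re s \<Longrightarrow> (\<lambda>n. of_real (psi_err (Suc n)) * zeta_term n (s + 1)) sums W s"
proof -
  have hol: "(\<lambda>s. of_real (psi_err (Suc n)) * zeta_term n (s + 1)) holomorphic_on A" for n A
    unfolding zeta_term_def by (intro holomorphic_intros)
  have bnd: "norm (of_real (psi_err (Suc n)) * zeta_term n (y + 1)) \<le> 4 * (norm y * norm (y + 1)) * real (Suc n) powr (-1 - Re y)"
    if y: "0 < Re y" for y n
  proof -
    have "norm (of_real (psi_err (Suc n)) * zeta_term n (y + 1)) \<le> (4 * real (Suc n)) * (norm (y + 1 - 1) * norm (y + 1) * real (Suc n) powr (-1 - Re (y + 1)))"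
      unfolding norm_mult norm_of_real using y by (intro mult_mono abs_psi_err_le norm_zeta_term_le[unfolded norm_mult]) auto
    also have "real (Suc n) powr (-1 - Re y) = real (Suc n) * real (Suc n) powr (-1 - Re (y + 1))"
      using powr_add[of "real (Suc n)" 1 "-1 - Re (y + 1)"] by (simp del: of_nat_Suc)
    then have "(4 * real (Suc n)) * (norm (y + 1 - 1) * norm (y + 1) * real (Suc n) powr (-1 - Re (y + 1))) = 4 * (norm y * norm (y + 1)) * real (Suc n) powr (-1 - Re y)"
      by simp
    finally show ?thesis .
  qed
  have dom: "\<exists>d h. 0 < d \<and> summable h \<and> (\<forall>n. \<forall>y\<in>ball x d \<inter> {s. 0 < Re s}. norm (of_real (psi_err (Suc n)) * zeta_term n (y + 1)) \<le> h n)"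
    if x: "x \<in> {s. 0 < Re s}" for x
  proof -
    define d where "d = Re x / 2"
    have d: "0 < d" using x by (simp add: d_def)
    show ?thesis
    proof (intro exI conjI allI ballI)
      show "0 < d" by fact
      show "summable (\<lambda>n. 4 * ((norm x + d + 1) * (norm x + d + 1)) * real (Suc n) powr (-1 - d))"
        by (intro summable_mult summable_Suc_powr d)
      fix n y assume y: "y \<in> ball x d \<inter> {s. 0 < Re s}"
      have ry: "d \<le> Re y" "norm y \<le> norm x + d" using ball_Re_norm[of y x d] y by (auto simp: d_def)
      have "norm (of_real (psi_err (Suc n)) * zeta_term n (y + 1)) \<le> 4 * (norm y * norm (y + 1)) * real (Suc n) powr (-1 - Re y)"
        using y by (intro bnd) auto
      also have "\<dots> \<le> 4 * ((norm x + d + 1) * (norm x + d + 1)) * real (Suc n) powr (-1 - d)"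
      proof (intro mult_mono mult_left_mono)
        show "norm (y + 1) \<le> norm x + d + 1" using norm_triangle_ineq[of y 1] ry by simp
        show "real (Suc n) powr (-1 - Re y) \<le> real (Suc n) powr (-1 - d)" using ry by (intro powr_mono) auto
      qed (use ry d in auto)
      finally show "norm (of_real (psi_err (Suc n)) * zeta_term n (y + 1)) \<le> 4 * ((norm x + d + 1) * (norm x + d + 1)) * real (Suc n) powr (-1 - d)" .
    qed
  qed
  show "W holomorphic_on {s. 0 < Re s}"
    unfolding W_def by (rule holomorphic_suminf(1)[OF open_Re_gt hol dom])
  show "(\<lambda>n. of_real (psi_err (Suc n)) * zeta_term n (s + 1)) sums W s" if s: "0 < Re s"
  proof -
    have "summable (\<lambda>n. 4 * (norm s * norm (s + 1)) * real (Suc n) powr (-1 - Re s))"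
      by (intro summable_mult summable_Suc_powr s)
    then have "summable (\<lambda>n. of_real (psi_err (Suc n)) * zeta_term n (s + 1))"
      by (rule summable_comparison_test'[where N = 0]) (rule bnd[OF s])
    then show ?thesis unfolding W_def by (rule summable_sums)
  qed
qed

text \<open>Newman's theorem is applied to the coefficients \<open>psi_err n / n\<close>, bounded by
  4. Their generating series is \<open>(W s + (dirichlet_sum mangoldt s - zeta s)) / s\<close>; the
  poles of the two Dirichlet series at 1 cancel, and every other point with Re s >= 1 is regular
  because \<open>zeta_reg\<close> has no zero there.\<close>

lemma convergent_psi_err: "convergent (\<lambda>N. \<Sum>n<N. psi_err (Suc n) / (real (Suc n))\<^sup>2)"
proof -
  define W where "W s = (\<Sum>n. of_real (psi_err (Suc n)) * zeta_term n (s + 1))" for s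
  \<comment> \<open>This continues \<open>zeta s - 1 / (s - 1)\<close>; the singularity at 1 is
    removable because \<open>zeta_reg 1 = 1\<close>.\<close>
  define Y where "Y s = (if s = 1 then deriv zeta_reg 1 else (zeta_reg s - 1) / (s - 1))" for s
  let ?H = "{s. 0 < Re s}"
  define S' where "S' = {s. 0 < Re s \<and> zeta_reg s \<noteq> 0}"
  have S'H: "S' \<subseteq> ?H" by (auto simp: S'_def)
  have openS': "open S'"
  proof -
    have "open (?H \<inter> zeta_reg -` (- {0}))"
      by (rule continuous_open_preimage[OF holomorphic_on_imp_continuous_on[OF holomorphic_zeta_reg] open_Re_gt]) auto
    moreover have "?H \<inter> zeta_reg -` (- {0}) = S'" by (auto simp: S'_def)
    ultimately show ?thesis by simp
  qed
  have Zhol: "zeta_reg holomorphic_on S'" "deriv zeta_reg holomorphic_on S'"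
    using holomorphic_on_subset[OF holomorphic_zeta_reg S'H]
      holomorphic_on_subset[OF holomorphic_deriv[OF holomorphic_zeta_reg open_Re_gt] S'H] by auto
  have Yhol: "Y holomorphic_on ?H"
  proof (rule pole_theorem_open_0[where g = "\<lambda>s. zeta_reg s - 1" and a = 1])
    show "(\<lambda>s. zeta_reg s - 1) holomorphic_on ?H" by (intro holomorphic_intros holomorphic_zeta_reg)
    have "(zeta_reg has_field_derivative deriv zeta_reg 1) (at 1)"
      by (rule holomorphic_derivI[OF holomorphic_zeta_reg open_Re_gt]) simp
    from DERIV_diff[OF this DERIV_const] have "deriv (\<lambda>s. zeta_reg s - 1) 1 = deriv zeta_reg 1"
      by (intro DERIV_imp_deriv) simp
    then show "Y 1 = deriv (\<lambda>s. zeta_reg s - 1) 1" by (simp add: Y_def)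
  qed (auto simp: Y_def zeta_reg_1 open_Re_gt)
  define G where "G s = (W s - deriv zeta_reg s / zeta_reg s - Y s) / s" for s
  have Ghol: "G holomorphic_on S'"
    unfolding G_def
    by (intro holomorphic_intros Zhol holomorphic_on_subset[OF Yhol S'H]
         holomorphic_on_subset[OF psi_err_zeta_term_sum(1)[folded W_def] S'H]) (auto simp: S'_def)
  define S where "S = (\<lambda>z. 1 + z) -` S'"
  define g where "g z = G (1 + z)" for z
  have openS: "open S" unfolding S_def by (rule continuous_open_vimage[OF openS']) (intro continuous_intros)
  have Ssub: "{z. 0 \<le> Re z} \<subseteq> S"
    using zeta_reg_nonzero by (auto simp: S_def S'_def)
  have ghol: "g holomorphic_on S"
  proof -
    have "(\<lambda>z. 1 + z) holomorphic_on S" by (intro holomorphic_intros)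
    from holomorphic_on_compose_gen[OF this Ghol] show ?thesis
      by (simp add: g_def[abs_def] o_def S_def image_vimage_subset)
  qed
  define a where "a n = complex_of_real (psi_err (Suc n) / real (Suc n))" for n
  have aC: "norm (a n) \<le> 4" for n
    using abs_psi_err_le[of "Suc n"] by (simp add: a_def norm_divide pos_divide_le_eq del: of_nat_Suc)
  have sums: "(\<lambda>n. a n * of_nat (Suc n) powr (-1 - z)) sums g z" if z: "0 < Re z" for z
  proof -
    define s where "s = 1 + z"
    have s: "1 < Re s" using z by (simp add: s_def)
    have s0: "s \<noteq> 0" "s \<noteq> 1" using s by auto
    have "(\<lambda>n. of_real (psi_err (Suc n)) * zeta_term n (s + 1)) sums W s"
      unfolding W_def using s by (intro psi_err_zeta_term_sum(2)) auto
    from sums_divide[OF sums_add[OF this sums_psi_err_diff[OF s]], of s]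
    have "(\<lambda>n. (of_real (psi_err (Suc n)) * zeta_term n (s + 1) +
        of_real (psi_err (Suc n)) * (of_nat (Suc n) powr (-s) - of_nat (Suc (Suc n)) powr (-s))) / s) sums
        ((W s + (dirichlet_sum mangoldt s - zeta s)) / s)" .
    moreover have "(of_real (psi_err (Suc n)) * zeta_term n (s + 1) +
        of_real (psi_err (Suc n)) * (of_nat (Suc n) powr (-s) - of_nat (Suc (Suc n)) powr (-s))) / s = a n * of_nat (Suc n) powr (-1 - z)" for n
    proof -
      have "zeta_term n (s + 1) + (of_nat (Suc n) powr (-s) - of_nat (Suc (Suc n)) powr (-s)) = s * of_nat (Suc n) powr (- 1 - s)"
      proof -
        have e: "- (s + 1) = - 1 - s" "1 - (s + 1) = - s" "s + 1 - 1 = s" by simp_all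
        show ?thesis unfolding zeta_term_def e by simp
      qed
      then have "(of_real (psi_err (Suc n)) * zeta_term n (s + 1) +
        of_real (psi_err (Suc n)) * (of_nat (Suc n) powr (-s) - of_nat (Suc (Suc n)) powr (-s))) / s =
         of_real (psi_err (Suc n)) * of_nat (Suc n) powr (-1 - s)"
        unfolding distrib_left[symmetric] using s0 by simp
      also have "of_nat (Suc n) powr (-1 - s) = of_nat (Suc n) powr (-1 - z) / (of_nat (Suc n) :: complex)"
        unfolding s_def using powr_diff[of "of_nat (Suc n)" "-1 - z" "1 :: complex"] by (simp del: of_nat_Suc add: algebra_simps)
      finally show ?thesis by (simp add: a_def del: of_nat_Suc)
    qed
    moreover have "(W s + (dirichlet_sum mangoldt s - zeta s)) / s = g z"
    proof -
      have "zeta s = zeta_reg s / (s - 1)" using zeta_reg_conv_zeta[OF s] s0 by simp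
      then have "dirichlet_sum mangoldt s - zeta s = - deriv zeta_reg s / zeta_reg s - (zeta_reg s - 1) / (s - 1)"
        using dirichlet_sum_mangoldt(2)[OF s] by (simp add: diff_divide_distrib)
      then show ?thesis using s0 by (simp add: g_def s_def[symmetric] G_def Y_def)
    qed
    ultimately show ?thesis by simp
  qed
  have "(\<lambda>n. a n / of_nat (Suc n)) sums g 0"
    by (rule newman_ingham[OF aC openS Ssub ghol sums])
  from sums_Re[OF this] have "(\<lambda>n. Re (a n / of_nat (Suc n))) sums Re (g 0)" .
  moreover have "Re (a n / of_nat (Suc n)) = psi_err (Suc n) / (real (Suc n))\<^sup>2" for n
  proof -
    have "a n / of_nat (Suc n) = complex_of_real (psi_err (Suc n) / (real (Suc n))\<^sup>2)"
      by (simp add: a_def power2_eq_square del: of_nat_Suc)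
    then show ?thesis by simp
  qed
  ultimately show ?thesis unfolding sums_def convergent_def by auto
qed

text \<open>If \<open>psi n\<close> exceeded \<open>(1 + e) * n\<close>, monotonicity of
  \<open>psi\<close> would keep \<open>psi_err\<close> at least \<open>e * n / 2\<close> on a block
  of length about \<open>e * n / 2\<close> after \<open>n\<close>. That block would contribute at
  least \<open>e\<^sup>2 / 32\<close> to the convergent series, against the Cauchy criterion. A
  deficit is excluded likewise by a block ending at \<open>n\<close>.\<close>

theorem psi_asymp: "(\<lambda>n. psi n / real n) \<longlonglongrightarrow> 1"
proof (rule LIMSEQ_I)
  fix r :: real assume r0: "0 < r"
  define e where "e = min (r / 2) (1/2)"
  have e: "0 < e" "e < r" "e \<le> 1/2" using r0 by (auto simp: e_def)
  define f where "f k = psi_err k / (real k)\<^sup>2" for k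
  have "Cauchy (\<lambda>N. \<Sum>n<N. f (Suc n))"
    using convergent_psi_err by (simp add: f_def convergent_Cauchy)
  then obtain M where M: "\<And>m n. M \<le> m \<Longrightarrow> M \<le> n \<Longrightarrow> norm ((\<Sum>n<m. f (Suc n)) - (\<Sum>k<n. f (Suc k))) < e\<^sup>2 / 32"
    using e unfolding Cauchy_iff by (metis zero_less_divide_iff zero_less_numeral zero_less_power)
  have seg: "\<bar>\<Sum>k\<in>{m<..n}. f k\<bar> < e\<^sup>2 / 32" if "M \<le> m" "m \<le> n" for m n
  proof -
    have "(\<Sum>k<n. f (Suc k)) = (\<Sum>k<m. f (Suc k)) + (\<Sum>k\<in>{m<..n}. f k)"
    proof -
      have *: "(\<Sum>k<n. f (Suc k)) = (\<Sum>k\<in>{0<..n}. f k)" for n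
        by (rule sum.reindex_bij_witness[of _ "\<lambda>k. k - 1" Suc]) auto
      have "{0<..n} = {0<..m} \<union> {m<..n}" "{0<..m} \<inter> {m<..n} = {}" using that by auto
      then show ?thesis unfolding * by (simp add: sum.union_disjoint)
    qed
    then show ?thesis using M[of n m] that by simp
  qed
  \<comment> \<open>\<open>2 * M\<close> keeps the block ending at \<open>n\<close> beyond
    \<open>M\<close>, as it is at most a quarter of \<open>n\<close> long; \<open>4 / e\<close>
    makes the rounded block length at least half of \<open>e * n / 2\<close>.\<close>
  define N0 where "N0 = 2 * M + nat \<lceil>4 / e\<rceil> + 1"
  have main: "\<bar>psi n / real n - 1\<bar> \<le> e" if n: "N0 \<le> n" for n
  proof -
    have n1: "2 * M \<le> n" "4 / e \<le> real n" "1 \<le> n" using n unfolding N0_def by linarith+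
    have en: "4 \<le> e * real n" using n1(2) e by (simp add: pos_divide_le_eq mult.commute)
    define m where "m = nat \<lfloor>e * real n / 2\<rfloor>"
    have m: "real m \<le> e * real n / 2" "e * real n / 4 \<le> real m" using en unfolding m_def by linarith+
    have "e * real n \<le> 1/2 * real n" using e by (intro mult_right_mono) auto
    then have mn: "4 * m \<le> n" using m by linarith
    have up: "psi n \<le> (1 + e) * real n"
    proof (rule ccontr)
      assume "\<not> psi n \<le> (1 + e) * real n"
      then have big: "(1 + e) * real n < psi n" by simp
      have "(\<Sum>k\<in>{n<..n+m}. e / (8 * real n)) \<le> (\<Sum>k\<in>{n<..n+m}. f k)"
      proof (rule sum_mono)
        fix k assume k: "k \<in> {n<..n+m}"
        have "psi n \<le> psi k" using k by (intro psi_mono) auto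
        moreover have "real k \<le> real n + real m" using k by auto
        ultimately have E: "e * real n / 2 \<le> psi_err k" using big m by (simp add: psi_err_def algebra_simps)
        have "real k \<le> 2 * real n" using k mn by auto
        then have k2: "(real k)\<^sup>2 \<le> (2 * real n)\<^sup>2" using k by (intro power_mono) auto
        have "e / (8 * real n) = (e * real n / 2) / (2 * real n)\<^sup>2" using n1 by (simp add: power2_eq_square)
        also have "\<dots> \<le> (e * real n / 2) / (real k)\<^sup>2" using k2 k e n1 by (intro divide_left_mono) auto
        also have "\<dots> \<le> f k" unfolding f_def using E by (intro divide_right_mono) auto
        finally show "e / (8 * real n) \<le> f k" .
      qed
      moreover have "e\<^sup>2 / 32 \<le> (\<Sum>k\<in>{n<..n+m}. e / (8 * real n))"
      proof -
        have "e\<^sup>2 / 32 = (e * real n / 4) * (e / (8 * real n))" using n1 by (simp add: power2_eq_square)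
        also have "\<dots> \<le> real m * (e / (8 * real n))" using m e by (intro mult_right_mono) auto
        finally show ?thesis by simp
      qed
      moreover have "\<bar>\<Sum>k\<in>{n<..n+m}. f k\<bar> < e\<^sup>2 / 32" using n1 by (intro seg) auto
      ultimately show False by linarith
    qed
    have low: "(1 - e) * real n \<le> psi n"
    proof (rule ccontr)
      assume "\<not> (1 - e) * real n \<le> psi n"
      then have small: "psi n < (1 - e) * real n" by simp
      have "(\<Sum>k\<in>{n-m<..n}. f k) \<le> (\<Sum>k\<in>{n-m<..n}. - (e / (2 * real n)))"
      proof (rule sum_mono)
        fix k assume k: "k \<in> {n-m<..n}"
        have "psi k \<le> psi n" using k by (intro psi_mono) auto
        moreover have "real n - real m \<le> real k" using k by auto
        ultimately have E: "psi_err k \<le> - (e * real n / 2)" using small m by (simp add: psi_err_def algebra_simps)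
        have k2: "(real k)\<^sup>2 \<le> (real n)\<^sup>2" using k by (intro power_mono) auto
        have "f k \<le> - (e * real n / 2) / (real k)\<^sup>2" unfolding f_def using E by (intro divide_right_mono) auto
        also have "\<dots> = - ((e * real n / 2) / (real k)\<^sup>2)" by simp
        also have "\<dots> \<le> - ((e * real n / 2) / (real n)\<^sup>2)"
          using k2 k e n1 by (intro le_imp_neg_le divide_left_mono) auto
        also have "\<dots> = - (e / (2 * real n))" using n1 by (simp add: power2_eq_square)
        finally show "f k \<le> - (e / (2 * real n))" .
      qed
      also have "\<dots> = - (real m * (e / (2 * real n)))" using mn by simp
      also have "\<dots> \<le> - ((e * real n / 4) * (e / (2 * real n)))"
        using m e by (intro le_imp_neg_le mult_right_mono) auto
      also have "(e * real n / 4) * (e / (2 * real n)) = e\<^sup>2 / 8" using n1 by (simp add: power2_eq_square)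
      finally have "(\<Sum>k\<in>{n-m<..n}. f k) \<le> - (e\<^sup>2 / 8)" .
      moreover have "\<bar>\<Sum>k\<in>{n-m<..n}. f k\<bar> < e\<^sup>2 / 32" using n1 mn by (intro seg) auto
      moreover have "0 < e\<^sup>2" using e by simp
      ultimately show False by linarith
    qed
    have "psi n / real n \<le> 1 + e" "1 - e \<le> psi n / real n"
      using up low n1 by (auto simp: pos_divide_le_eq pos_le_divide_eq)
    then show ?thesis by linarith
  qed
  have "norm (psi n / real n - 1) < r" if "N0 \<le> n" for n
    using main[OF that] e by simp
  then show "\<exists>no. \<forall>n\<ge>no. norm (psi n / real n - 1) < r" by blast
qed

section \<open>Primes of the form floor of the inverse of Li\<close>

lemma Li_strict_mono:
  assumes "2 < a" "a < b"
  shows "Li a < Li b"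
proof (rule DERIV_pos_imp_increasing[OF assms(2)])
  fix x assume "a \<le> x" "x \<le> b"
  then have x: "2 < x" using assms by simp
  then have "0 < 1 / ln x" by simp
  then show "\<exists>y. (Li has_real_derivative y) (at x) \<and> 0 < y"
    using Li_has_real_derivative[OF x] by blast
qed

lemma inj_on_Li: "inj_on Li {2<..}"
proof (rule inj_onI)
  fix a b assume ab: "a \<in> {2<..}" "b \<in> {2<..}" "Li a = Li b"
  show "a = b"
  proof (rule ccontr)
    assume "a \<noteq> b"
    then consider "a < b" | "b < a" by linarith
    then show False
    proof cases
      case 1
      then have "Li a < Li b" using ab by (intro Li_strict_mono) auto
      then show False using ab(3) by linarith
    next
      case 2
      then have "Li b < Li a" using ab by (intro Li_strict_mono) auto
      then show False using ab(3) by linarith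
    qed
  qed
qed

lemma Li_step_bounds:
  assumes "3 \<le> p"
  shows "1 / ln (real p + 1) \<le> Li (real p + 1) - Li (real p)"
    and "Li (real p + 1) - Li (real p) \<le> 1 / ln (real p)"
proof -
  have "\<exists>z. real p < z \<and> z < real p + 1 \<and> Li (real p + 1) - Li (real p) = (real p + 1 - real p) * (1 / ln z)"
    using assms by (intro MVT2[where f = Li and f' = "\<lambda>z. 1 / ln z"] Li_has_real_derivative) auto
  then obtain z where z: "real p < z" "z < real p + 1" "Li (real p + 1) - Li (real p) = 1 / ln z" by auto
  have "0 < ln (real p)" using assms by simp
  moreover have "ln (real p) \<le> ln z" "ln z \<le> ln (real p + 1)" using z assms by auto
  ultimately have L: "0 < ln (real p)" "ln (real p) \<le> ln z" "ln z \<le> ln (real p + 1)" "0 < ln z" "0 < ln (real p + 1)"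
    by linarith+
  show "1 / ln (real p + 1) \<le> Li (real p + 1) - Li (real p)"
    "Li (real p + 1) - Li (real p) \<le> 1 / ln (real p)"
    unfolding z(3) by (intro divide_left_mono mult_pos_pos L zero_le_one)+
qed

text \<open>The floor condition says that the preimage \<open>t\<close> of \<open>n\<close> lies in
  \<open>[p, p + 1)\<close>. Strict monotonicity carries this over to \<open>Li\<close>, and the
  intermediate value theorem supplies \<open>t\<close> in the other direction. For
  \<open>p >= 3\<close> the whole interval lies in the domain of the inverse.\<close>

lemma floor_Li_inv_iff:
  assumes p: "3 \<le> p"
  shows "(\<exists>n::int. of_int n \<in> Li ` {2<..} \<and> int p = \<lfloor>Li_inv (of_int n)\<rfloor>) \<longleftrightarrow>
     (\<exists>n::int. Li (real p) \<le> of_int n \<and> of_int n < Li (real p + 1))"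
proof
  assume "\<exists>n::int. of_int n \<in> Li ` {2<..} \<and> int p = \<lfloor>Li_inv (of_int n)\<rfloor>"
  then obtain n :: int and t where n: "of_int n = Li t" "2 < t" "int p = \<lfloor>Li_inv (of_int n)\<rfloor>" by auto
  have "Li_inv (Li t) = t" unfolding Li_inv_def by (rule the_inv_into_f_f[OF inj_on_Li]) (use n in simp)
  then have "int p = \<lfloor>t\<rfloor>" using n by simp
  then have t: "real p \<le> t" "t < real p + 1" by linarith+
  have "Li (real p) \<le> Li t" using Li_strict_mono[of "real p" t] t p by (cases "t = real p") auto
  moreover have "Li t < Li (real p + 1)" using Li_strict_mono n t by auto
  ultimately show "\<exists>n::int. Li (real p) \<le> of_int n \<and> of_int n < Li (real p + 1)" using n by metis
next
  assume "\<exists>n::int. Li (real p) \<le> of_int n \<and> of_int n < Li (real p + 1)"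
  then obtain n :: int where n: "Li (real p) \<le> of_int n" "of_int n < Li (real p + 1)" by blast
  have "\<exists>t\<ge>real p. t \<le> real p + 1 \<and> Li t = of_int n"
  proof (rule IVT')
    show "continuous_on {real p..real p + 1} Li"
      using p by (intro continuous_at_imp_continuous_on ballI DERIV_isCont[OF Li_has_real_derivative]) auto
  qed (use n in auto)
  then obtain t where t: "real p \<le> t" "t \<le> real p + 1" "Li t = of_int n" by blast
  have t2: "t < real p + 1" "2 < t" using t n p by (auto simp: less_le)
  have "Li_inv (of_int n) = t" unfolding t(3)[symmetric] Li_inv_def
    by (rule the_inv_into_f_f[OF inj_on_Li]) (use t2 in simp)
  moreover have "\<lfloor>t\<rfloor> = int p" using t t2 by linarith
  ultimately have "of_int n \<in> Li ` {2<..} \<and> int p = \<lfloor>Li_inv (of_int n)\<rfloor>"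
    using t t2 by (metis greaterThan_iff imageI)
  then show "\<exists>n::int. of_int n \<in> Li ` {2<..} \<and> int p = \<lfloor>Li_inv (of_int n)\<rfloor>" by blast
qed

text \<open>Such a number is \<open>p ^ k\<close> with \<open>2 <= k\<close>, so
  \<open>p <= sqrt N\<close>, and \<open>k <= 2 * ln N\<close> because
  \<open>ln 2 >= 1/2\<close>.\<close>

lemma card_proper_primepows_le:
  assumes "1 \<le> N"
  shows "real (card {n. n \<le> N \<and> primepow n \<and> \<not> prime n}) \<le> (sqrt (real N) + 1) * (2 * ln (real N) + 1)"
proof -
  define A where "A = {n. n \<le> N \<and> primepow n \<and> \<not> prime n}"
  define a where "a = nat \<lfloor>sqrt (real N)\<rfloor>"
  define b where "b = nat \<lfloor>2 * ln (real N)\<rfloor>"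
  have "A \<subseteq> (\<lambda>(p, k). p ^ k) ` ({..a} \<times> {..b})"
  proof
    fix n assume n: "n \<in> A"
    then obtain p k where pk: "prime p" "0 < k" "n = p ^ k" by (auto simp: A_def primepow_def)
    have k2: "2 \<le> k" using pk n by (cases "k = 1") (auto simp: A_def)
    have nN: "real p ^ k \<le> real N" using n pk by (metis (mono_tags, lifting) A_def mem_Collect_eq of_nat_le_iff of_nat_power)
    have p2: "2 \<le> real p" using prime_ge_2_nat[OF pk(1)] by simp
    have "real p ^ 2 \<le> real p ^ k" using p2 k2 by (intro power_increasing) auto
    then have "real p \<le> sqrt (real N)" using nN by (intro real_le_rsqrt) linarith
    then have "p \<le> a" unfolding a_def by linarith
    moreover have "k \<le> b"
    proof -
      have "(2::real) ^ k \<le> real p ^ k" using p2 by (intro power_mono) auto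
      then have "(2::real) ^ k \<le> real N" using nN by linarith
      then have "ln (2 ^ k) \<le> ln (real N)" by (rule ln_mono) simp
      then have "real k * ln 2 \<le> ln (real N)" by (simp add: ln_realpow)
      moreover have "real k * (1/2) \<le> real k * ln 2"
      proof (rule mult_left_mono)
        show "1/2 \<le> ln (2::real)" using ln2_ge_two_thirds by simp
      qed simp
      ultimately show ?thesis unfolding b_def by linarith
    qed
    ultimately show "n \<in> (\<lambda>(p, k). p ^ k) ` ({..a} \<times> {..b})" using pk by auto
  qed
  then have "card A \<le> card ((\<lambda>(p, k). p ^ k) ` ({..a} \<times> {..b}))" by (intro card_mono) auto
  also have "\<dots> \<le> card ({..a} \<times> {..b})" by (rule card_image_le) simp
  also have "\<dots> = (a + 1) * (b + 1)" by simp
  finally have "real (card A) \<le> real ((a + 1) * (b + 1))" by (rule of_nat_mono)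
  also have "\<dots> = (real a + 1) * (real b + 1)" by (simp add: algebra_simps)
  also have "\<dots> \<le> (sqrt (real N) + 1) * (2 * ln (real N) + 1)"
  proof (intro mult_mono add_right_mono)
    have "0 \<le> sqrt (real N)" by simp
    then show "real a \<le> sqrt (real N)" unfolding a_def by linarith
    have "0 \<le> ln (real N)" using assms by simp
    then show "real b \<le> 2 * ln (real N)" unfolding b_def by linarith
  qed simp_all
  finally show ?thesis by (simp add: A_def)
qed

text \<open>One common length \<delta> replaces that of the interval up to
  \<open>Li (n + 1)\<close>, since the Fejer estimate needs a fixed window. Proper prime powers and
  2 are weighted here as well; the lower bound for \<open>pi_hat\<close> has to absorb them.\<close>

definition near_weight :: "nat \<Rightarrow> real \<Rightarrow> real" where
  "near_weight N \<delta> = (\<Sum>n | n \<in> {1..N} \<and> (\<exists>m::int. Li (real n) \<le> of_int m \<and> of_int m < Li (real n) + \<delta>). mangoldt n)"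

lemma pi_hat_eq:
  assumes "0 \<le> x"
  shows "pi_hat x = pi_hat (real (nat \<lfloor>x\<rfloor>))"
proof -
  have "real p \<le> x \<longleftrightarrow> real p \<le> real (nat \<lfloor>x\<rfloor>)" for p
  proof -
    have "real p \<le> x \<longleftrightarrow> int p \<le> \<lfloor>x\<rfloor>" by (simp add: le_floor_iff)
    also have "\<dots> \<longleftrightarrow> p \<le> nat \<lfloor>x\<rfloor>" using assms by (simp add: le_nat_iff)
    finally show ?thesis by simp
  qed
  then show ?thesis by (simp add: pi_hat_def)
qed

text \<open>Primes up to the free cut-off \<open>y\<close> are counted trivially; beyond it the
  interval length is at most \<open>1 / ln y\<close> and each weight at least
  \<open>ln y\<close>.\<close>

lemma pi_hat_le:
  assumes y: "3 \<le> y"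
  shows "real (pi_hat (real N)) \<le> y + 4 + near_weight N (1 / ln y) / ln y"
proof -
  define A where "A = {p. prime p \<and> real p \<le> real N \<and> (\<exists>n::int. of_int n \<in> Li ` {2<..} \<and> int p = \<lfloor>Li_inv (of_int n)\<rfloor>)}"
  define B where "B = {p \<in> A. y < real p}"
  have fin: "finite A" by (rule finite_subset[of _ "{..N}"]) (auto simp: A_def)
  have lny: "0 < ln y" using y by simp
  have "A \<subseteq> {..nat \<lfloor>y\<rfloor>} \<union> B"
    by (auto simp: B_def) linarith
  then have "card A \<le> card ({..nat \<lfloor>y\<rfloor>} \<union> B)" using fin by (intro card_mono) (auto simp: B_def)
  also have "\<dots> \<le> card {..nat \<lfloor>y\<rfloor>} + card B" by (rule card_Un_le)
  finally have "real (card A) \<le> real (nat \<lfloor>y\<rfloor> + 1) + real (card B)" by simp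
  also have "real (nat \<lfloor>y\<rfloor> + 1) \<le> y + 4" using y by linarith
  also have "real (card B) \<le> near_weight N (1 / ln y) / ln y"
  proof -
    have "real (card B) * ln y = (\<Sum>p\<in>B. ln y)" by simp
    also have "\<dots> \<le> (\<Sum>p\<in>B. mangoldt p)"
    proof (rule sum_mono)
      fix p assume "p \<in> B"
      then have "prime p" "y < real p" by (auto simp: B_def A_def)
      then show "ln y \<le> mangoldt p" using y by simp
    qed
    also have "\<dots> \<le> near_weight N (1 / ln y)"
      unfolding near_weight_def
    proof (rule sum_mono2)
      show "B \<subseteq> {n. n \<in> {1..N} \<and> (\<exists>m::int. Li (real n) \<le> of_int m \<and> of_int m < Li (real n) + 1 / ln y)}"
      proof
        fix p assume p: "p \<in> B"
        have yp: "y < real p" "p \<le> N" "1 \<le> p" using p y by (auto simp: B_def A_def Suc_le_eq prime_gt_0_nat)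
        have p3: "3 \<le> p" using yp y by linarith
        have "\<exists>n::int. of_int n \<in> Li ` {2<..} \<and> int p = \<lfloor>Li_inv (of_int n)\<rfloor>" using p by (simp add: B_def A_def)
        then obtain n :: int where n: "Li (real p) \<le> of_int n" "of_int n < Li (real p + 1)"
          unfolding floor_Li_inv_iff[OF p3] by blast
        have "1 / ln (real p) \<le> 1 / ln y" using yp y lny by (intro divide_left_mono mult_pos_pos) auto
        then have "of_int n < Li (real p) + 1 / ln y" using n Li_step_bounds(2)[OF p3] by linarith
        then show "p \<in> {n. n \<in> {1..N} \<and> (\<exists>m::int. Li (real n) \<le> of_int m \<and> of_int m < Li (real n) + 1 / ln y)}"
          using n yp by auto
      qed
    qed (auto intro: mangoldt_nonneg)
    finally show ?thesis using lny by (simp add: pos_le_divide_eq)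
  qed
  finally show ?thesis by (simp add: pi_hat_def A_def)
qed

text \<open>For \<open>3 <= p <= N\<close> the interval of \<open>p\<close> is at least
  \<open>1 / ln (N + 1)\<close> long, so an integer in the window lies in the interval. The
  exceptions are proper prime powers and the prime 2, which \<open>floor_Li_inv_iff\<close> does not
  cover; 2 accounts for the final \<open>+ 1\<close>.\<close>

lemma pi_hat_ge:
  assumes N: "3 \<le> N"
  shows "near_weight N (1 / ln (real N + 1)) \<le> ln (real N) * (real (pi_hat (real N)) + (sqrt (real N) + 1) * (2 * ln (real N) + 1) + 1)"
proof -
  define A where "A = {p. prime p \<and> real p \<le> real N \<and> (\<exists>n::int. of_int n \<in> Li ` {2<..} \<and> int p = \<lfloor>Li_inv (of_int n)\<rfloor>)}"
  define C where "C = {n. n \<le> N \<and> primepow n \<and> \<not> prime n}"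
  define D where "D = {n. n \<in> {1..N} \<and> (\<exists>m::int. Li (real n) \<le> of_int m \<and> of_int m < Li (real n) + 1 / ln (real N + 1))}"
  have fin: "finite A" "finite C"
    by (rule finite_subset[of _ "{..N}"], auto simp: A_def C_def)+
  have lnN: "0 \<le> ln (real N)" using N by simp
  have "near_weight N (1 / ln (real N + 1)) = (\<Sum>n\<in>D. mangoldt n)"
    by (simp add: near_weight_def D_def)
  also have "\<dots> = (\<Sum>n\<in>{n \<in> D. primepow n}. mangoldt n)"
    by (rule sum.mono_neutral_right) (auto simp: D_def mangoldt_def)
  also have "\<dots> \<le> (\<Sum>n\<in>{n \<in> D. primepow n}. ln (real N))"
  proof (rule sum_mono)
    fix n assume "n \<in> {n \<in> D. primepow n}"
    then have n: "1 \<le> n" "n \<le> N" by (auto simp: D_def)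
    have "mangoldt n \<le> ln (real n)" by (rule mangoldt_le_ln[OF n(1)])
    also have "\<dots> \<le> ln (real N)" using n by simp
    finally show "mangoldt n \<le> ln (real N)" .
  qed
  also have "\<dots> \<le> (\<Sum>n\<in>A \<union> C \<union> {2}. ln (real N))"
  proof (rule sum_mono2)
    show "{n \<in> D. primepow n} \<subseteq> A \<union> C \<union> {2}"
    proof
      fix p assume p: "p \<in> {n \<in> D. primepow n}"
      show "p \<in> A \<union> C \<union> {2}"
      proof (cases "prime p \<and> p \<noteq> 2")
        case False
        then show ?thesis using p by (auto simp: C_def D_def)
      next
        case True
        then have p3: "3 \<le> p" using prime_ge_2_nat[of p] by linarith
        obtain n :: int where n: "Li (real p) \<le> of_int n" "of_int n < Li (real p) + 1 / ln (real N + 1)"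
          using p by (auto simp: D_def)
        have pN: "p \<le> N" using p by (simp add: D_def)
        have "1 / ln (real N + 1) \<le> 1 / ln (real p + 1)" using pN p3 by (intro divide_left_mono mult_pos_pos) auto
        then have "of_int n < Li (real p + 1)" using n Li_step_bounds(1)[OF p3] by linarith
        then have "\<exists>n::int. of_int n \<in> Li ` {2<..} \<and> int p = \<lfloor>Li_inv (of_int n)\<rfloor>"
          unfolding floor_Li_inv_iff[OF p3] using n by blast
        then show ?thesis using True pN by (simp add: A_def)
      qed
    qed
  qed (use fin lnN in simp_all)
  also have "\<dots> = ln (real N) * real (card (A \<union> C \<union> {2}))" by simp
  also have "\<dots> \<le> ln (real N) * (real (pi_hat (real N)) + (sqrt (real N) + 1) * (2 * ln (real N) + 1) + 1)"
  proof (rule mult_left_mono[OF _ lnN])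
    have "card (A \<union> C \<union> {2}) \<le> card A + card C + 1"
      using card_Un_le[of "A \<union> C" "{2}"] card_Un_le[of A C] by simp
    then have "real (card (A \<union> C \<union> {2})) \<le> real (card A) + real (card C) + 1" by linarith
    also have "real (card C) \<le> (sqrt (real N) + 1) * (2 * ln (real N) + 1)"
      unfolding C_def using N by (intro card_proper_primepows_le) auto
    finally show "real (card (A \<union> C \<union> {2})) \<le> real (pi_hat (real N)) + (sqrt (real N) + 1) * (2 * ln (real N) + 1) + 1"
      by (simp add: pi_hat_def A_def)
  qed
  finally show ?thesis .
qed

text \<open>With x = ln N, \<open>\<eta> = x powr (-3/2)\<close> and \<open>H\<close> about
  \<open>x ^ 4\<close>, the quantity \<open>4 * H * \<eta>\<^sup>2\<close> is at least
  \<open>x\<close>, so the kernel leaks at most \<open>1 / x\<close>, while the error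
  \<open>2 * H * S\<close> is at most \<open>4 * N / x\<close>. For \<delta> of order
  \<open>1 / x\<close> all errors are then of lower order.\<close>

lemma near_weight_bounds:
  "\<forall>\<^sub>F N in sequentially. \<forall>\<delta>. 2 * ln (real N) powr (-3/2) \<le> \<delta> \<longrightarrow> \<delta> \<le> 1 \<longrightarrow>
     (1 - 1 / ln (real N)) * near_weight N \<delta> \<le> (\<delta> + 2 * ln (real N) powr (-3/2)) * (psi N + 4 * real N / ln (real N)) \<and>
     (\<delta> - 2 * ln (real N) powr (-3/2)) * (psi N - 4 * real N / ln (real N)) \<le> near_weight N \<delta> + 1 / ln (real N) * \<delta> * psi N"
proof -
  have "\<forall>\<^sub>F N in sequentially. 4 \<le> ln (real N)" by real_asymp
  then show ?thesis
    using eventually_norm_mangoldt_Li_sum_le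
  proof eventually_elim
    case (elim N)
    define x where "x = ln (real N)"
    have x: "4 \<le> x" using elim by (simp add: x_def)
    define \<eta> where "\<eta> = x powr (-3/2)"
    define H where "H = nat \<lceil>x ^ 4\<rceil>"
    define S where "S = real N / x ^ 5"
    have x41: "1 \<le> x ^ 4" using x by (intro one_le_power) auto
    have H: "x ^ 4 \<le> real H" "real H \<le> 2 * x ^ 4" using x41 unfolding H_def by linarith+
    have H0: "0 < H" using H x41 by (intro Nat.gr0I) auto
    have \<eta>0: "0 < \<eta>" using x by (simp add: \<eta>_def)
    have \<eta>2: "\<eta>\<^sup>2 = 1 / x ^ 3"
    proof -
      have "\<eta>\<^sup>2 = x powr (-3/2 + -3/2)" unfolding \<eta>_def power2_eq_square powr_add ..
      also have "\<dots> = x powr (- real 3)" by simp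
      also have "\<dots> = 1 / x powr real 3" by (rule powr_minus_divide)
      also have "x powr real 3 = x ^ 3" using x by (intro powr_realpow) auto
      finally show ?thesis .
    qed
    have \<eta>1: "\<eta> \<le> 1/2"
    proof -
      have "\<eta> \<le> x powr (-1)" unfolding \<eta>_def using x by (intro powr_mono) auto
      also have "\<dots> = 1 / x" using x by (simp add: powr_minus_divide)
      also have "\<dots> \<le> 1/2" using x by (simp add: divide_simps)
      finally show ?thesis .
    qed
    have \<kappa>: "1 / (4 * real H * \<eta>\<^sup>2) \<le> 1 / x"
    proof -
      have "x * x ^ 3 \<le> 4 * real H" using H x41 by (simp add: power_Suc[symmetric] eval_nat_numeral mult_ac)
      then show ?thesis unfolding \<eta>2 using x H0 by (simp add: divide_simps mult.commute)
    qed
    have S0: "0 \<le> S" using x by (simp add: S_def)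
    have Sb: "norm (\<Sum>n\<in>{1..N}. complex_of_real (mangoldt n) * expi (real k * Li (real n))) \<le> S" if "1 \<le> k" "k < H" for k
    proof -
      have "real k \<le> 2 * x ^ 4" using that H by linarith
      then show ?thesis using elim(2)[rule_format, of "real k"] that by (simp add: x_def S_def)
    qed
    have HS: "2 * real H * S \<le> 4 * real N / x"
    proof -
      have "2 * real H * S \<le> 2 * (2 * x ^ 4) * S" using H S0 by (intro mult_right_mono mult_left_mono) auto
      also have "\<dots> = 4 * real N / x" using x by (simp add: S_def field_simps eval_nat_numeral)
      finally show ?thesis .
    qed
    have psi: "(\<Sum>n\<in>{1..N}. mangoldt n) = psi N" by (simp add: psi_def)
    have nw0: "0 \<le> near_weight N \<delta>" for \<delta> unfolding near_weight_def by (intro sum_nonneg mangoldt_nonneg)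
    show ?case
    proof (intro allI impI conjI)
      fix \<delta> :: real assume \<delta>': "2 * ln (real N) powr (-3/2) \<le> \<delta>" "\<delta> \<le> 1"
      then have \<delta>: "2 * \<eta> \<le> \<delta>" "\<delta> \<le> 1" by (simp_all add: \<eta>_def x_def)
      have \<delta>0: "0 \<le> \<delta>" using \<delta> \<eta>0 by linarith
      have "(1 - 1 / x) * near_weight N \<delta> \<le> (1 - 1 / (4 * real H * \<eta>\<^sup>2)) * near_weight N \<delta>"
        using \<kappa> nw0 by (intro mult_right_mono) auto
      also have "\<dots> \<le> (\<delta> + 2 * \<eta>) * ((\<Sum>n\<in>{1..N}. mangoldt n) + 2 * real H * S)"
        unfolding near_weight_def
        by (rule sum_weights_near_int_le[OF _ H0 \<eta>0 \<eta>1 \<delta>0 _ _ S0]) (use Sb in \<open>auto intro: mangoldt_nonneg\<close>)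
      also have "\<dots> \<le> (\<delta> + 2 * \<eta>) * (psi N + 4 * real N / x)"
        unfolding psi using HS \<delta>0 \<eta>0 by (intro mult_left_mono) auto
      finally show "(1 - 1 / ln (real N)) * near_weight N \<delta> \<le> (\<delta> + 2 * ln (real N) powr (-3/2)) * (psi N + 4 * real N / ln (real N))"
        by (simp add: \<eta>_def x_def)
      have "(\<delta> - 2 * \<eta>) * (psi N - 4 * real N / x) \<le> (\<delta> - 2 * \<eta>) * ((\<Sum>n\<in>{1..N}. mangoldt n) - 2 * real H * S)"
        unfolding psi using HS \<delta> by (intro mult_left_mono) auto
      also have "\<dots> \<le> near_weight N \<delta> + 1 / (4 * real H * \<eta>\<^sup>2) * \<delta> * (\<Sum>n\<in>{1..N}. mangoldt n)"
        unfolding near_weight_def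
        by (rule sum_weights_near_int_ge[OF _ H0 \<eta>0 \<delta> _ _ S0]) (use Sb in \<open>auto intro: mangoldt_nonneg\<close>)
      also have "\<dots> \<le> near_weight N \<delta> + 1 / x * \<delta> * psi N"
        unfolding psi using \<kappa> \<delta>0 psi_nonneg by (intro add_left_mono mult_right_mono) auto
      finally show "(\<delta> - 2 * ln (real N) powr (-3/2)) * (psi N - 4 * real N / ln (real N)) \<le> near_weight N \<delta> + 1 / ln (real N) * \<delta> * psi N"
        by (simp add: \<eta>_def x_def)
    qed
  qed
qed

lemma pi_hat_nat_asymp: "(\<lambda>N. real (pi_hat (real N)) / (real N / (ln (real N))\<^sup>2)) \<longlonglongrightarrow> 1"
proof -
  define \<rho> where "\<rho> N = psi N / real N" for N
  have \<rho>: "\<rho> \<longlonglongrightarrow> 1" unfolding \<rho>_def by (rule psi_asymp)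
  define \<eta> where "\<eta> N = ln (real N) powr (-3/2)" for N :: nat
  \<comment> \<open>\<open>y\<close> must be of lower order than \<open>N / (ln N)\<^sup>2\<close>,
    as primes up to \<open>y\<close> are counted trivially, yet so large that \<open>ln y\<close> is
    asymptotic to \<open>ln N\<close>.\<close>
  define y where "y N = real N / ln (real N) ^ 3" for N :: nat
  \<comment> \<open>\<open>u\<close> and \<open>l\<close> bound the normalised count and are
    arranged so that \<open>psi\<close> enters only through \<open>\<rho>\<close>; all other factors
    are explicit elementary functions of \<open>N\<close>.\<close>
  define u where "u N = (y N + 4) * (ln (real N))\<^sup>2 / real N +
     (ln (real N))\<^sup>2 * (1 / ln (y N) * (1 / ln (y N) + 2 * \<eta> N)) * (\<rho> N + 4 / ln (real N)) / (1 - 1 / ln (real N))" for N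
  define l where "l N = ln (real N) * (1 / ln (real N + 1) - 2 * \<eta> N) * (\<rho> N - 4 / ln (real N)) - 1 / ln (real N + 1) * \<rho> N
     - (ln (real N))\<^sup>2 / real N * ((sqrt (real N) + 1) * (2 * ln (real N) + 1) + 1)" for N
  have "u \<longlonglongrightarrow> 0 + 1 * (1 + 0) / 1"
    unfolding u_def
  proof (intro tendsto_add tendsto_mult tendsto_divide \<rho>)
    show "(\<lambda>N. (y N + 4) * (ln (real N))\<^sup>2 / real N) \<longlonglongrightarrow> 0" unfolding y_def by real_asymp
    show "(\<lambda>N. (ln (real N))\<^sup>2 * (1 / ln (y N) * (1 / ln (y N) + 2 * \<eta> N))) \<longlonglongrightarrow> 1" unfolding y_def \<eta>_def by real_asymp
    show "(\<lambda>N. 4 / ln (real N)) \<longlonglongrightarrow> 0" by real_asymp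
    show "(\<lambda>N. 1 - 1 / ln (real N)) \<longlonglongrightarrow> 1" by real_asymp
  qed simp
  then have u: "u \<longlonglongrightarrow> 1" by simp
  have "l \<longlonglongrightarrow> 1 * (1 - 0) - 0 * 1 - 0"
    unfolding l_def
  proof (intro tendsto_diff tendsto_mult \<rho>)
    show "(\<lambda>N. ln (real N) * (1 / ln (real N + 1) - 2 * \<eta> N)) \<longlonglongrightarrow> 1" unfolding \<eta>_def by real_asymp
    show "(\<lambda>N. 4 / ln (real N)) \<longlonglongrightarrow> 0" by real_asymp
    show "(\<lambda>N. 1 / ln (real N + 1)) \<longlonglongrightarrow> 0" by real_asymp
    show "(\<lambda>N. (ln (real N))\<^sup>2 / real N * ((sqrt (real N) + 1) * (2 * ln (real N) + 1) + 1)) \<longlonglongrightarrow> 0" by real_asymp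
  qed
  then have l: "l \<longlonglongrightarrow> 1" by simp
  have e1: "\<forall>\<^sub>F N in sequentially. 4 \<le> ln (real N)" by real_asymp
  have e2: "\<forall>\<^sub>F N in sequentially. 3 \<le> y N" unfolding y_def by real_asymp
  have e3: "\<forall>\<^sub>F N in sequentially. 2 * \<eta> N \<le> 1 / ln (real N + 1)" unfolding \<eta>_def by real_asymp
  have e4: "\<forall>\<^sub>F N in sequentially. 2 * \<eta> N \<le> 1 / ln (y N)" unfolding \<eta>_def y_def by real_asymp
  have up: "\<forall>\<^sub>F N in sequentially. real (pi_hat (real N)) / (real N / (ln (real N))\<^sup>2) \<le> u N"
    using near_weight_bounds e1 e2 e4
  proof eventually_elim
    case (elim N)
    define x where "x = ln (real N)"
    define Y where "Y = ln (y N)"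
    have x: "4 \<le> x" using elim(2) by (simp add: x_def)
    have N: "0 < real N" using x by (cases "N = 0") (auto simp: x_def)
    have Y: "1 \<le> Y" unfolding Y_def using elim by (intro ln_ge_1) auto
    have d1: "1 / Y \<le> 1" using Y by simp
    have x1: "0 < 1 - 1 / x" using x by simp
    have nw: "(1 - 1 / x) * near_weight N (1 / Y) \<le> (1 / Y + 2 * \<eta> N) * (psi N + 4 * real N / x)"
      using elim(1) elim(4) d1 unfolding \<eta>_def x_def Y_def by blast
    have psi: "psi N + 4 * real N / x = real N * (\<rho> N + 4 / x)" using N by (simp add: \<rho>_def distrib_left)
    have nw': "near_weight N (1 / Y) \<le> (1 / Y + 2 * \<eta> N) * (real N * (\<rho> N + 4 / x)) / (1 - 1 / x)"
      using nw x1 unfolding psi by (simp add: pos_le_divide_eq mult.commute)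
    have "real (pi_hat (real N)) \<le> y N + 4 + near_weight N (1 / Y) / Y"
      unfolding Y_def by (rule pi_hat_le[OF elim(3)])
    also have "\<dots> \<le> y N + 4 + ((1 / Y + 2 * \<eta> N) * (real N * (\<rho> N + 4 / x)) / (1 - 1 / x)) / Y"
      using nw' Y by (intro add_left_mono divide_right_mono) auto
    finally have "real (pi_hat (real N)) * (x\<^sup>2 / real N) \<le> (y N + 4 + ((1 / Y + 2 * \<eta> N) * (real N * (\<rho> N + 4 / x)) / (1 - 1 / x)) / Y) * (x\<^sup>2 / real N)"
      using N by (intro mult_right_mono) auto
    also have "\<dots> = u N"
    proof -
      have "(p + A * (n * b) / c / z) * (q / n) = p * q / n + q * (1 / z * A) * b / c" if "n \<noteq> 0" for p A n b c z q :: real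
        using that by (cases "c = 0"; cases "z = 0") (simp_all add: field_simps)
      note alg = this
      show ?thesis unfolding u_def x_def[symmetric] Y_def[symmetric] by (rule alg) (use N in simp)
    qed
    finally show ?case by (simp add: x_def)
  qed
  have lo: "\<forall>\<^sub>F N in sequentially. l N \<le> real (pi_hat (real N)) / (real N / (ln (real N))\<^sup>2)"
    using near_weight_bounds e1 e3
  proof eventually_elim
    case (elim N)
    define x where "x = ln (real N)"
    define Y where "Y = ln (real N + 1)"
    have x: "4 \<le> x" using elim(2) by (simp add: x_def)
    have N: "0 < real N" using x by (cases "N = 0") (auto simp: x_def)
    have xY: "x \<le> Y" unfolding x_def Y_def using N by simp
    have N3: "3 \<le> N"
    proof -
      have "x \<le> real N - 1" unfolding x_def using N by (rule ln_le_minus_one)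
      then show ?thesis using x by linarith
    qed
    define R where "R = (sqrt (real N) + 1) * (2 * x + 1) + 1"
    have d1: "1 / Y \<le> 1" using x xY by simp
    have nw: "(1 / Y - 2 * \<eta> N) * (psi N - 4 * real N / x) \<le> near_weight N (1 / Y) + 1 / x * (1 / Y) * psi N"
      using elim(1) elim(3) d1 unfolding \<eta>_def x_def Y_def by blast
    have psi: "psi N - 4 * real N / x = real N * (\<rho> N - 4 / x)" "psi N = real N * \<rho> N" using N by (simp_all add: \<rho>_def right_diff_distrib)
    have "near_weight N (1 / Y) \<le> x * (real (pi_hat (real N)) + (sqrt (real N) + 1) * (2 * x + 1) + 1)"
      unfolding x_def Y_def by (rule pi_hat_ge[OF N3])
    then have "(1 / Y - 2 * \<eta> N) * (real N * (\<rho> N - 4 / x)) - 1 / x * (1 / Y) * (real N * \<rho> N) - x * R \<le> x * real (pi_hat (real N))"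
    proof -
      assume "near_weight N (1 / Y) \<le> x * (real (pi_hat (real N)) + (sqrt (real N) + 1) * (2 * x + 1) + 1)"
      also have "\<dots> = x * real (pi_hat (real N)) + x * R" unfolding R_def by (simp only: distrib_left add.assoc)
      finally show ?thesis using nw[unfolded psi(1), unfolded psi(2)] by linarith
    qed
    then have "((1 / Y - 2 * \<eta> N) * (real N * (\<rho> N - 4 / x)) - 1 / x * (1 / Y) * (real N * \<rho> N) - x * R) * (x / real N) \<le> x * real (pi_hat (real N)) * (x / real N)"
      by (rule mult_right_mono) (use N x in simp)
    also have "((1 / Y - 2 * \<eta> N) * (real N * (\<rho> N - 4 / x)) - 1 / x * (1 / Y) * (real N * \<rho> N) - x * R) * (x / real N) = l N"
    proof -
      have "(A * (n * b) - 1 / z * (1 / w) * (n * r) - z * q) * (z / n) = z * A * b - 1 / w * r - z\<^sup>2 / n * q"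
        if "n \<noteq> 0" "z \<noteq> 0" for A n b z w r q :: real
        using that by (cases "w = 0") (simp_all add: field_simps power2_eq_square)
      note alg = this
      show ?thesis unfolding l_def x_def[symmetric] Y_def[symmetric] R_def[symmetric] by (rule alg) (use N x in simp_all)
    qed
    also have "x * real (pi_hat (real N)) * (x / real N) = real (pi_hat (real N)) / (real N / x\<^sup>2)"
      by (simp add: power2_eq_square)
    finally show ?case unfolding x_def .
  qed
  show ?thesis by (rule tendsto_sandwich[OF lo up l u])
qed

theorem theorem1p1:
  "(\<lambda>x :: real. real (pi_hat x)) \<sim>[at_top] (\<lambda>x. x / (ln x)\<^sup>2)"
proof (rule asymp_equivI')
  have f: "filterlim (\<lambda>x::real. nat \<lfloor>x\<rfloor>) sequentially at_top"
    by (intro filterlim_compose[OF filterlim_nat_sequentially] filterlim_floor_sequentially)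
  have "((\<lambda>x::real. real (pi_hat (real (nat \<lfloor>x\<rfloor>))) / (real (nat \<lfloor>x\<rfloor>) / (ln (real (nat \<lfloor>x\<rfloor>)))\<^sup>2)) \<longlongrightarrow> 1) at_top"
    by (rule filterlim_compose[OF pi_hat_nat_asymp f])
  \<comment> \<open>\<open>pi_hat\<close> depends only on the integer part of its argument, and the
    comparison function changes by a factor tending to 1.\<close>
  moreover have "((\<lambda>x::real. (of_int \<lfloor>x\<rfloor> / (ln (of_int \<lfloor>x\<rfloor>))\<^sup>2) / (x / (ln x)\<^sup>2)) \<longlongrightarrow> 1) at_top"
    by real_asymp
  ultimately have "((\<lambda>x::real. real (pi_hat (real (nat \<lfloor>x\<rfloor>))) / (real (nat \<lfloor>x\<rfloor>) / (ln (real (nat \<lfloor>x\<rfloor>)))\<^sup>2) *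
     ((of_int \<lfloor>x\<rfloor> / (ln (of_int \<lfloor>x\<rfloor>))\<^sup>2) / (x / (ln x)\<^sup>2))) \<longlongrightarrow> 1 * 1) at_top"
    by (rule tendsto_mult)
  moreover have "\<forall>\<^sub>F x::real in at_top. real (pi_hat (real (nat \<lfloor>x\<rfloor>))) / (real (nat \<lfloor>x\<rfloor>) / (ln (real (nat \<lfloor>x\<rfloor>)))\<^sup>2) *
     ((of_int \<lfloor>x\<rfloor> / (ln (of_int \<lfloor>x\<rfloor>))\<^sup>2) / (x / (ln x)\<^sup>2)) = real (pi_hat x) / (x / (ln x)\<^sup>2)"
    using eventually_ge_at_top[of 3]
  proof eventually_elim
    case (elim x)
    define n where "n = nat \<lfloor>x\<rfloor>"
    have n: "3 \<le> n" "of_int \<lfloor>x\<rfloor> = real n" using elim by (simp_all add: n_def le_nat_floor)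
    have p: "pi_hat x = pi_hat (real n)" unfolding n_def by (rule pi_hat_eq) (use elim in simp)
    have "0 < ln (real n)" using n(1) by simp
    then have D: "real n / (ln (real n))\<^sup>2 \<noteq> 0" using n(1) by simp
    have "c / D * (D / E) = c / E" if "D \<noteq> 0" for c D E :: real using that by simp
    from this[OF D] show ?case unfolding n(2) n_def[symmetric] p .
  qed
  ultimately have "((\<lambda>x. real (pi_hat x) / (x / (ln x)\<^sup>2)) \<longlongrightarrow> 1 * 1) at_top"
    by (rule Lim_transform_eventually)
  then show "((\<lambda>x. real (pi_hat x) / (x / (ln x)\<^sup>2)) \<longlongrightarrow> 1) at_top" by simp
qed

end
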